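(* Let $P\subset\mathbb S^2$ be a geodesic polygon in the unit sphere, and for $z\in P$ let $h_z(l)$ be the position complexity of the billiard flow in $P$. Then for any $\varepsilon>0$ and (Lebesgue) almost every $z\in P$ we have $h_z(l)=O(l^{1+\varepsilon})$ as $l\to\infty$.
   Context: A geodesic polygon $P$ is a compact connected region bounded by finitely many geodesic sides, not necessarily simply connected. The billiard flow moves a point with unit speed along geodesics in $P$, reflecting at the sides by the law of geometric optics; an orbit is regular if it does not hit a corner of $P$. For $z\in P$ let $R_z$ be the set of unit vectors at $z$ (directed into $P$) and let $O_z(l)$ be the set of regular billiard orbits of length $l$ starting from $R_z$. Two orbits in $O_z(l)$ are homotopic if they can be joined by a continuous family of orbits in $O_z(l)$. The position complexity $h_z(l)$ is the number of homotopy classes in $O_z(l)$, i.e. the number of connected components of the set of initial directions at $z$ whose billiard orbit hits no corner up to time $l$. *)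

theory Defs
  imports "HOL-Analysis.Analysis" "HOL-Library.Landau_Symbols"
begin

abbreviation unit_sphere :: "(real^3) set" where
  "unit_sphere \<equiv> sphere 0 1"

text \<open>
  Area on the unit sphere as cone measure: the area of \<open>A\<close> is three times the volume of the cone
  of all \<open>r x\<close> with \<open>x \<in> A\<close> and \<open>0 < r \<le> 1\<close>, so that the whole sphere has area \<open>4 \<pi>\<close>.
\<close>
definition sphere_area :: "(real^3) measure" where
  "sphere_area =
     scale_measure 3
       (distr (restrict_space lborel (cball 0 1 - {0})) (restrict_space borel unit_sphere)
         (\<lambda>y. y /\<^sub>R norm y))"

lemma emeasure_sphere_area:
  assumes "A \<in> sets (restrict_space borel unit_sphere)"
  shows "emeasure sphere_area A =
           3 * emeasure lborel {y \<in> cball 0 1 - {0}. y /\<^sub>R norm y \<in> A}"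
proof -
  let ?M = "restrict_space lborel (cball 0 1 - {0}) :: (real^3) measure"
  let ?f = "\<lambda>y::real^3. y /\<^sub>R norm y"
  have m: "?f \<in> ?M \<rightarrow>\<^sub>M restrict_space borel unit_sphere"
  proof (rule measurable_restrict_space2)
    show "?f \<in> space ?M \<rightarrow> unit_sphere"
      by (auto simp: space_restrict_space)
    show "?f \<in> borel_measurable ?M"
      by (rule measurable_restrict_space1) simp
  qed
  have "?f -` A \<inter> space ?M = {y \<in> cball 0 1 - {0}. ?f y \<in> A}"
    by (auto simp: space_restrict_space)
  moreover have "emeasure ?M {y \<in> cball 0 1 - {0}. ?f y \<in> A} =
      emeasure lborel {y \<in> cball 0 1 - {0}. ?f y \<in> A}"
    by (rule emeasure_restrict_space) auto
  ultimately show ?thesis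
    using assms m by (simp add: sphere_area_def emeasure_distr)
qed

text \<open>Unit speed geodesic of the sphere, for orthonormal \<open>x\<close> and \<open>v\<close>, and its velocity.\<close>
definition geodesic :: "real^3 \<Rightarrow> real^3 \<Rightarrow> real \<Rightarrow> real^3" where
  "geodesic x v t = cos t *\<^sub>R x + sin t *\<^sub>R v"

definition geodesic_velocity :: "real^3 \<Rightarrow> real^3 \<Rightarrow> real \<Rightarrow> real^3" where
  "geodesic_velocity x v t = - sin t *\<^sub>R x + cos t *\<^sub>R v"

datatype great_arc =
  Great_Arc (arc_start: "real^3") (arc_dir: "real^3") (arc_length: real)

text \<open>Arcs longer than \<open>\<pi>\<close>, and the full great circle, are geodesic segments as well.\<close>
definition valid_arc :: "great_arc \<Rightarrow> bool" where
  "valid_arc s \<longleftrightarrow>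
     norm (arc_start s) = 1 \<and> norm (arc_dir s) = 1 \<and> arc_start s \<bullet> arc_dir s = 0 \<and>
     0 < arc_length s \<and> arc_length s \<le> 2 * pi"

definition arc_points :: "great_arc \<Rightarrow> (real^3) set" where
  "arc_points s = geodesic (arc_start s) (arc_dir s) ` {0..arc_length s}"

text \<open>A full great circle is a closed side and has no end points.\<close>
definition arc_ends :: "great_arc \<Rightarrow> (real^3) set" where
  "arc_ends s =
     (if arc_length s = 2 * pi then {}
      else {arc_start s, geodesic (arc_start s) (arc_dir s) (arc_length s)})"

definition arc_normal :: "great_arc \<Rightarrow> real^3" where
  "arc_normal s = cross3 (arc_start s) (arc_dir s)"

definition reflection :: "real^3 \<Rightarrow> real^3 \<Rightarrow> real^3" where
  "reflection n w = w - (2 * (w \<bullet> n)) *\<^sub>R n"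

definition corners :: "great_arc set \<Rightarrow> (real^3) set" where
  "corners S = (\<Union>s\<in>S. arc_ends s)"

definition sphere_interior :: "(real^3) set \<Rightarrow> (real^3) set" where
  "sphere_interior P = top_of_set unit_sphere interior_of P"

text \<open>
  The polygon is given together with its sides. That \<open>P\<close> is the closure of its interior
  excludes lower-dimensional pieces and slits with \<open>P\<close> on both sides.
\<close>
definition geodesic_polygon :: "(real^3) set \<Rightarrow> great_arc set \<Rightarrow> bool" where
  "geodesic_polygon P S \<longleftrightarrow>
     P \<subseteq> unit_sphere \<and> compact P \<and> connected P \<and> closure (sphere_interior P) = P \<and>
     finite S \<and> S \<noteq> {} \<and> (\<forall>s\<in>S. valid_arc s) \<and>
     top_of_set unit_sphere frontier_of P = (\<Union>s\<in>S. arc_points s) \<and>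
     (\<forall>s\<in>S. \<forall>s'\<in>S. s \<noteq> s' \<longrightarrow> arc_points s \<inter> arc_points s' \<subseteq> arc_ends s \<inter> arc_ends s')"

definition inward_directions :: "(real^3) set \<Rightarrow> real^3 \<Rightarrow> (real^3) set" where
  "inward_directions P z =
     {u. norm u = 1 \<and> z \<bullet> u = 0 \<and>
         (\<exists>\<delta>>0. \<forall>t\<in>{0<..<\<delta>}. geodesic z u t \<in> sphere_interior P)}"

text \<open>
  A billiard orbit \<open>\<gamma>\<close> of length \<open>l\<close> with initial position \<open>z\<close> and direction \<open>u\<close>, with reflections
  at the times \<open>\<tau> 1 < \<dots> < \<tau> n\<close>. The unit normal of the plane spanned by a side is tangent to the sphere
  and orthogonal to the side at each of its points, so \<open>reflection\<close> along it is the law of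
  geometric optics; its sign is irrelevant. The flow is not continued beyond a
  corner; only the behaviour of \<open>\<gamma>\<close> on \<open>{0..l}\<close> is constrained.
\<close>
definition billiard_orbit ::
  "(real^3) set \<Rightarrow> great_arc set \<Rightarrow> real^3 \<Rightarrow> real^3 \<Rightarrow> real \<Rightarrow> (real \<Rightarrow> real^3) \<Rightarrow> bool" where
  "billiard_orbit P S z u l \<gamma> \<longleftrightarrow>
     (\<exists>(n::nat) (\<tau>::nat \<Rightarrow> real) (x::nat \<Rightarrow> real^3) (v::nat \<Rightarrow> real^3).
        \<tau> 0 = 0 \<and> \<tau> (Suc n) = l \<and> (\<forall>i\<le>n. \<tau> i < \<tau> (Suc i)) \<and>
        x 0 = z \<and> v 0 = u \<and>
        (\<forall>i\<le>n. (\<forall>t\<in>{\<tau> i..\<tau> (Suc i)}. \<gamma> t = geodesic (x i) (v i) (t - \<tau> i)) \<and>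
                (\<forall>t\<in>{\<tau> i<..<\<tau> (Suc i)}. \<gamma> t \<in> sphere_interior P)) \<and>
        (\<forall>i<n. \<exists>s\<in>S. x (Suc i) \<in> arc_points s - corners S \<and>
                v (Suc i) = reflection (arc_normal s)
                  (geodesic_velocity (x i) (v i) (\<tau> (Suc i) - \<tau> i))))"

definition regular_orbits ::
  "(real^3) set \<Rightarrow> great_arc set \<Rightarrow> real^3 \<Rightarrow> real \<Rightarrow> (real \<Rightarrow> real^3) set" where
  "regular_orbits P S z l =
     {\<gamma>. (\<exists>u\<in>inward_directions P z. billiard_orbit P S z u l \<gamma>) \<and>
         \<gamma> ` {0..l} \<inter> corners S = {}}"

definition homotopic_orbits ::
  "(real^3) set \<Rightarrow> great_arc set \<Rightarrow> real^3 \<Rightarrow> real \<Rightarrow> ((real \<Rightarrow> real^3) \<times> (real \<Rightarrow> real^3)) set" where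
  "homotopic_orbits P S z l =
     {(\<gamma>, \<gamma>'). \<exists>H :: real \<Rightarrow> real \<Rightarrow> real^3.
        continuous_on ({0..1} \<times> {0..l}) (\<lambda>(s, t). H s t) \<and>
        (\<forall>s\<in>{0..1}. H s \<in> regular_orbits P S z l) \<and> H 0 = \<gamma> \<and> H 1 = \<gamma>'}"

definition orbit_classes ::
  "(real^3) set \<Rightarrow> great_arc set \<Rightarrow> real^3 \<Rightarrow> real \<Rightarrow> (real \<Rightarrow> real^3) set set" where
  "orbit_classes P S z l = regular_orbits P S z l // homotopic_orbits P S z l"

definition position_complexity ::
  "(real^3) set \<Rightarrow> great_arc set \<Rightarrow> real^3 \<Rightarrow> real \<Rightarrow> nat" where
  "position_complexity P S z l = card (orbit_classes P S z l)"

end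

theory Submission
  imports Defs
begin

text \<open>
  Unfolding along its reflections turns an orbit from \<open>z\<close> into a single great circle, so an orbit from
  \<open>z\<close> that hits the corner \<open>c\<close> after the sequence \<open>w\<close> of reflections is determined by \<open>z\<close>, \<open>c\<close>, \<open>w\<close> and
  the integer \<open>m\<close> for which the hitting time lies between \<open>m \<pi>\<close> and \<open>(m + 1) \<pi>\<close>, unless \<open>z\<close> is one of
  countably many conjugate points. For fixed \<open>c\<close> and \<open>m\<close>, unfold the set of these \<open>z\<close> by the
  isometry belonging to \<open>w\<close>: followed backwards from \<open>c\<close>, an orbit recovers its reflections, so the
  unfolded sets for different \<open>w\<close> are disjoint, and their areas sum up to at most \<open>4 \<pi>\<close>. Hence the
  number \<open>f m z\<close> of hits of \<open>c\<close> has bounded integral over \<open>z\<close>, the sum of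
  \<open>f m z / (m + 1)\<^sup>1\<^sup>+\<^sup>\<epsilon>\<close> over \<open>m\<close> is finite for almost every \<open>z\<close>, and the number of
  directions at \<open>z\<close> that run into a corner up to time \<open>l\<close> is \<open>O(l\<^sup>1\<^sup>+\<^sup>\<epsilon>)\<close>. Regular orbits vary continuously with
  their direction, so that these directions separate the homotopy classes.
\<close>

section \<open>Geodesics and reflections\<close>

text \<open>Unfolding keeps the great circle \<open>G\<close> fixed; \<open>reflections w\<close>
  folds it back into the polygon. The mirrors are planes through the origin, so each folding is an
  orthogonal map of the ambient space and linear algebra suffices.

  Strips of length \<open>pi\<close> appear because great circles from one point refocus after time
  \<open>pi\<close>: inside a strip \<open>cos\<close> is injective and \<open>sin\<close> has no
  zero, so time and direction can be read off from the two end points. At multiples of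
  \<open>pi\<close> they cannot, which is the origin of the conjugate points.

  Area bounds only the mean number of hits per strip; \<epsilon> is the price of a pointwise bound,
  since the weights over \<open>m\<close> must be summable.

  Integrating the counts needs measurable sets, and the sets of \<open>z\<close> turn out to be
  open. The obstacle is the corner itself, where stability of orbits is lost. There the polygon is
  locally a union of rays, so a geodesic aimed at the corner that is inside \<open>P\<close> shortly
  before stays inside until the hit.\<close>

definition unit_tangent :: "real^3 \<Rightarrow> real^3 \<Rightarrow> bool" where
  "unit_tangent x v \<longleftrightarrow> norm x = 1 \<and> norm v = 1 \<and> x \<bullet> v = 0"

lemma inner_geodesic:
  "y \<bullet> geodesic x v t = cos t * (y \<bullet> x) + sin t * (y \<bullet> v)"
  by (simp add: geodesic_def inner_add_right)

lemma inner_geodesic_geodesic: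
  assumes "unit_tangent x v"
  shows "geodesic x v s \<bullet> geodesic x v t = cos (s - t)"
  using assms
  by (simp add: geodesic_def unit_tangent_def inner_add_right inner_add_left inner_commute cos_diff
      norm_eq_1)

lemma norm_geodesic [simp]: "unit_tangent x v \<Longrightarrow> norm (geodesic x v t) = 1"
  by (simp add: norm_eq_1 inner_geodesic_geodesic)

lemma geodesic_0 [simp]: "geodesic x v 0 = x"
  by (simp add: geodesic_def)

lemma geodesic_add:
  "geodesic x v (a + t) = geodesic (geodesic x v a) (geodesic_velocity x v a) t"
  by (simp add: geodesic_def geodesic_velocity_def cos_add sin_add algebra_simps)

lemma geodesic_diff:
  "geodesic x v (a - t) = geodesic (geodesic x v a) (- geodesic_velocity x v a) t"
  by (simp add: geodesic_def geodesic_velocity_def cos_diff sin_diff algebra_simps)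

lemma geodesic_shift:
  "geodesic x v t = geodesic (geodesic x v a) (geodesic_velocity x v a) (t - a)"
  by (simp flip: geodesic_add)

lemma unit_tangent_geodesic:
  assumes "unit_tangent x v"
  shows "unit_tangent (geodesic x v a) (geodesic_velocity x v a)"
    and "unit_tangent (geodesic x v a) (- geodesic_velocity x v a)"
proof -
  have "cos a * cos a + sin a * sin a = 1"
    by (metis power2_eq_square sin_cos_squared_add2)
  then show "unit_tangent (geodesic x v a) (geodesic_velocity x v a)"
    using assms
    by (simp add: geodesic_def geodesic_velocity_def unit_tangent_def inner_add_right inner_add_left
        inner_diff_right inner_diff_left inner_commute norm_eq_1)
  then show "unit_tangent (geodesic x v a) (- geodesic_velocity x v a)"
    by (simp add: unit_tangent_def)
qed

text \<open>Points at angle \<open>s - t\<close> are joined by a chord of length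
  \<open>2 * \<bar>sin ((s - t) / 2)\<bar>\<close>.\<close>

lemma dist_geodesic:
  assumes "unit_tangent x v"
  shows "dist (geodesic x v s) (geodesic x v t) \<le> \<bar>s - t\<bar>"
proof -
  have "cos (s - t) = 1 - 2 * (sin ((s - t) / 2))\<^sup>2"
    using cos_double_sin[of "(s - t) / 2"] by (metis field_sum_of_halves mult_2)
  then have "(dist (geodesic x v s) (geodesic x v t))\<^sup>2 = (2 * sin ((s - t) / 2))\<^sup>2"
    using inner_geodesic_geodesic[OF assms, of s t] inner_geodesic_geodesic[OF assms, of s s]
      inner_geodesic_geodesic[OF assms, of t t]
    by (simp add: dist_norm power2_norm_eq_inner inner_diff_right inner_diff_left inner_commute
        power_mult_distrib)
  then have "dist (geodesic x v s) (geodesic x v t) = \<bar>2 * sin ((s - t) / 2)\<bar>"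
    by (metis real_sqrt_abs abs_of_nonneg zero_le_dist)
  also have "\<dots> \<le> \<bar>s - t\<bar>"
    using abs_sin_x_le_abs_x[of "(s - t) / 2"] by (simp add: abs_mult)
  finally show ?thesis .
qed

text \<open>The initial data enter with the coefficients \<open>cos t\<close> and
  \<open>sin t\<close>, so great circles that start close stay close for all times.\<close>

lemma dist_geodesic_geodesic:
  "dist (geodesic x v t) (geodesic x' v' t) \<le> dist x x' + dist v v'"
proof -
  have "geodesic x v t - geodesic x' v' t = cos t *\<^sub>R (x - x') + sin t *\<^sub>R (v - v')"
    by (simp add: geodesic_def algebra_simps)
  then have "dist (geodesic x v t) (geodesic x' v' t) \<le> \<bar>cos t\<bar> * dist x x' + \<bar>sin t\<bar> * dist v v'"
    by (metis dist_norm norm_scaleR norm_triangle_ineq)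
  also have "\<dots> \<le> 1 * dist x x' + 1 * dist v v'"
    by (intro add_mono mult_right_mono) auto
  finally show ?thesis by simp
qed

lemma continuous_on_geodesic [continuous_intros]:
  fixes f :: "'a::t2_space \<Rightarrow> real"
  assumes "continuous_on A f"
  shows "continuous_on A (\<lambda>t. geodesic x v (f t))"
  unfolding geodesic_def by (intro continuous_intros assms)

lemma geodesic_inj:
  assumes "unit_tangent x v" "geodesic x v s = geodesic x v t"
  shows "\<exists>n::int. s = t + 2 * pi * n"
proof -
  have "cos (s - t) = 1"
    using inner_geodesic_geodesic[OF assms(1), of s t] inner_geodesic_geodesic[OF assms(1), of t t]
      assms(2) by simp
  then obtain n :: int where "s - t = of_int n * 2 * pi"
    unfolding cos_one_2pi_int by blast
  then show ?thesis by (intro exI[of _ n]) (simp add: algebra_simps)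
qed

lemma geodesic_periodic: "geodesic x v (t + 2 * pi) = geodesic x v t"
  by (simp add: geodesic_def)

text \<open>The height of a great circle over a plane through the origin is a sinusoid. With
  \<open>y\<close> normal to a side, this shows on which side of a mirror the orbit is for a time
  \<open>pi\<close> before and after a zero.\<close>

lemma inner_geodesic_zero:
  assumes "y \<bullet> geodesic x v b = 0"
  shows "y \<bullet> geodesic x v t = (y \<bullet> geodesic_velocity x v b) * sin (t - b)"
  using assms by (subst geodesic_shift[of x v t b]) (simp add: inner_geodesic)

lemma linear_geodesic: "linear f \<Longrightarrow> f (geodesic x v t) = geodesic (f x) (f v) t"
  by (simp add: geodesic_def linear_add linear_scale)

lemma linear_geodesic_velocity:
  "linear f \<Longrightarrow> f (geodesic_velocity x v t) = geodesic_velocity (f x) (f v) t"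
  by (simp add: geodesic_velocity_def linear_add linear_diff linear_scale)

section \<open>Orthogonal maps and reflections\<close>

lemma orthogonal_transformation_unit_tangent:
  "orthogonal_transformation f \<Longrightarrow> unit_tangent x v \<Longrightarrow> unit_tangent (f x) (f v)"
  by (simp add: unit_tangent_def orthogonal_transformation_norm)
     (simp add: orthogonal_transformation_def)

lemma dist_orthogonal_transformation:
  "orthogonal_transformation f \<Longrightarrow> dist (f x) (f y) = dist x y"
  using orthogonal_transformation_norm[of f "x - y"]
  by (simp add: dist_norm linear_diff orthogonal_transformation_linear)

lemma reflection_fixes: "x \<bullet> n = 0 \<Longrightarrow> reflection n x = x"
  by (simp add: reflection_def)

lemma inner_reflection: "norm n = 1 \<Longrightarrow> n \<bullet> reflection n x = - (n \<bullet> x)"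
  by (simp add: reflection_def inner_diff_right norm_eq_1 inner_commute)

lemma reflection_reflection: "norm n = 1 \<Longrightarrow> reflection n (reflection n x) = x"
  by (simp add: reflection_def inner_diff_left norm_eq_1 algebra_simps)

lemma orthogonal_transformation_reflection:
  assumes "norm n = 1"
  shows "orthogonal_transformation (reflection n)"
  unfolding orthogonal_transformation_def
proof
  show "linear (reflection n)"
    by (rule linearI) (simp_all add: reflection_def inner_add_left algebra_simps)
  show "\<forall>x y. reflection n x \<bullet> reflection n y = x \<bullet> y"
    using assms
    by (simp add: reflection_def inner_diff_left inner_diff_right norm_eq_1 inner_commute algebra_simps)
qed

section \<open>Arcs and their great circles\<close>

lemma valid_arc_unit_tangent: "valid_arc s \<Longrightarrow> unit_tangent (arc_start s) (arc_dir s)"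
  by (simp add: valid_arc_def unit_tangent_def)

lemma norm_cross3_unit_tangent: "unit_tangent x v \<Longrightarrow> norm (cross3 x v) = 1"
  using norm_cross_dot[of x v] norm_ge_zero[of "cross3 x v"]
  by (auto simp: unit_tangent_def power2_eq_1_iff)

lemma norm_arc_normal: "valid_arc s \<Longrightarrow> norm (arc_normal s) = 1"
  by (simp add: arc_normal_def norm_cross3_unit_tangent valid_arc_unit_tangent)

lemma arc_normal_orthogonal: "p \<in> arc_points s \<Longrightarrow> p \<bullet> arc_normal s = 0"
  by (auto simp: arc_points_def arc_normal_def geodesic_def inner_add_left dot_cross_self)

lemma great_circle_param:
  assumes "unit_tangent x v" "norm y = 1" "y \<bullet> cross3 x v = 0"
  obtains \<phi> where "0 \<le> \<phi>" "\<phi> < 2 * pi" "y = geodesic x v \<phi>"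
proof -
  let ?n = "cross3 x v"
  have xv: "x \<bullet> x = 1" "v \<bullet> v = 1" "x \<bullet> v = 0" "v \<bullet> x = 0"
    using assms(1) by (auto simp: unit_tangent_def norm_eq_1 inner_commute)
  have n: "?n \<bullet> ?n = 1"
    using norm_cross3_unit_tangent[OF assms(1)] by (simp add: norm_eq_1)
  \<comment> \<open>As \<open>y\<close> is orthogonal to the unit vector \<open>?n\<close>, it
    equals this double product; expanding the inner product by Lagrange's identity gives the
    coordinates of \<open>y\<close> with respect to \<open>x\<close> and \<open>v\<close>.\<close>
  have "cross3 ?n (cross3 y ?n) = y"
    unfolding Lagrange[of ?n y ?n] using n assms(3) by (simp add: inner_commute)
  moreover have "cross3 y ?n = (y \<bullet> v) *\<^sub>R x - (y \<bullet> x) *\<^sub>R v"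
    by (simp add: Lagrange)
  moreover have "cross3 ?n x = v"
    using xv by (subst cross_skew) (simp add: Lagrange)
  moreover have "cross3 ?n v = - x"
    using xv by (subst cross_skew) (simp add: Lagrange)
  ultimately have "(y \<bullet> v) *\<^sub>R v - (y \<bullet> x) *\<^sub>R (- x) = y"
    by (simp add: Cross3.right_diff_distrib cross_mult_right)
  then have y: "y = (y \<bullet> x) *\<^sub>R x + (y \<bullet> v) *\<^sub>R v"
    by (simp only: diff_minus_eq_add scaleR_minus_right add.commute)
  have "1 = y \<bullet> y"
    using assms(2) by (simp add: norm_eq_1)
  also have "\<dots> = y \<bullet> ((y \<bullet> x) *\<^sub>R x + (y \<bullet> v) *\<^sub>R v)"
    by (simp only: y[symmetric])
  also have "\<dots> = (y \<bullet> x)\<^sup>2 + (y \<bullet> v)\<^sup>2"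
    by (simp only: inner_add_right power2_eq_square inner_scaleR_right)
  finally have "(y \<bullet> x)\<^sup>2 + (y \<bullet> v)\<^sup>2 = 1" by simp
  then obtain \<phi> where \<phi>: "0 \<le> \<phi>" "\<phi> < 2 * pi" "y \<bullet> x = cos \<phi>" "y \<bullet> v = sin \<phi>"
    by (rule sincos_total_2pi)
  have "y = geodesic x v \<phi>"
    unfolding geodesic_def \<phi>(3,4)[symmetric] by (rule y)
  with \<phi>(1,2) show thesis by (rule that)
qed

text \<open>Codes list the sides in reverse order: the most recent reflection comes first.\<close>
primrec reflections :: "great_arc list \<Rightarrow> real^3 \<Rightarrow> real^3" where
  "reflections [] x = x"
| "reflections (s # w) x = reflection (arc_normal s) (reflections w x)"

section \<open>Local geometry of the polygon\<close>

lemma closed_arc_points: "closed (arc_points s)"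
  unfolding arc_points_def
  by (intro compact_imp_closed compact_continuous_image continuous_intros compact_Icc)

lemma arc_points_sphere: "valid_arc s \<Longrightarrow> p \<in> arc_points s \<Longrightarrow> norm p = 1"
  by (auto simp: arc_points_def valid_arc_unit_tangent)

text \<open>From a point of the arc, each of the two directions along the circle either stays on the
  arc for a while or leaves it at once. On a full circle, running past the end of the parameter
  interval returns to the arc.\<close>

lemma arc_direction_locally_constant:
  assumes "valid_arc s" "0 \<le> t0" "t0 \<le> arc_length s" "\<sigma> = 1 \<or> \<sigma> = -1"
  shows "\<exists>r>0. \<forall>t t'. 0 < t \<longrightarrow> t < r \<longrightarrow> 0 < t' \<longrightarrow> t' < r \<longrightarrow>
           geodesic (arc_start s) (arc_dir s) (t0 + \<sigma> * t) \<in> arc_points s \<longrightarrow>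
           geodesic (arc_start s) (arc_dir s) (t0 + \<sigma> * t') \<in> arc_points s"
proof -
  define L where "L = arc_length s"
  let ?g = "geodesic (arc_start s) (arc_dir s)"
  note ut = valid_arc_unit_tangent[OF assms(1)]
  have L: "0 < L" "L \<le> 2 * pi" "t0 \<le> L"
    using assms(1,3) by (auto simp: valid_arc_def L_def)
  have in_arc: "?g t \<in> arc_points s" if "0 \<le> t" "t \<le> L" for t
    using that by (auto simp: arc_points_def L_def)
  have in_arc_full: "?g t \<in> arc_points s" if "L = 2 * pi" "- 2 * pi \<le> t" "t \<le> 4 * pi" for t
  proof -
    consider "t < 0" | "0 \<le> t" "t \<le> 2 * pi" | "2 * pi < t" by linarith
    then show ?thesis
    proof cases
      case 1
      then show ?thesis
        using in_arc[of "t + 2 * pi"] that by (simp add: geodesic_periodic)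
    next
      case 2
      then show ?thesis using in_arc that by simp
    next
      case 3
      then show ?thesis
        using in_arc[of "t - 2 * pi"] that geodesic_periodic[of _ _ "t - 2 * pi"] by simp
    qed
  qed
  have not_in_arc: "?g t \<notin> arc_points s" if "L < t" "t < 2 * pi" for t
  proof
    assume "?g t \<in> arc_points s"
    then obtain t' where t': "0 \<le> t'" "t' \<le> L" "?g t = ?g t'"
      by (auto simp: arc_points_def L_def)
    with geodesic_inj[OF ut] obtain n :: int where n: "t = t' + 2 * pi * n" by blast
    have "0 < 2 * pi * n" "2 * pi * n < 2 * pi * 1"
      using n t' that L by linarith+
    then have "0 < n" "n < 1"
      using pi_gt_zero by (simp_all add: zero_less_mult_iff)
    then show False by simp
  qed
  show ?thesis
  proof (cases "L = 2 * pi")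
    case True
    \<comment> \<open>Any radius would do; \<open>pi\<close> keeps the parameters within one period
      of the interval of the arc.\<close>
    show ?thesis
    proof (intro exI[of _ pi] conjI allI impI)
      fix t' :: real assume "0 < t'" "t' < pi"
      then show "?g (t0 + \<sigma> * t') \<in> arc_points s"
        using in_arc_full[OF True] assms(2,4) L True by auto
    qed simp
  next
    case False
    then have L2: "L < 2 * pi" using L by simp
    consider (fwd) "\<sigma> = 1" "t0 < L" | (fwd_end) "\<sigma> = 1" "t0 = L"
      | (bwd) "\<sigma> = -1" "0 < t0" | (bwd_end) "\<sigma> = -1" "t0 = 0"
      using assms(2,4) L by linarith
    then show ?thesis
    proof cases
      case fwd
      then show ?thesis
        using assms(2) by (intro exI[of _ "L - t0"]) (auto intro!: in_arc)
    next
      \<comment> \<open>\<open>2 * pi - L\<close> is the length of the complementary arc.\<close>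
      case fwd_end
      then show ?thesis
        using L2 L not_in_arc by (intro exI[of _ "2 * pi - L"]) auto
    next
      case bwd
      then show ?thesis
        using L by (intro exI[of _ t0]) (auto intro!: in_arc)
    next
      case bwd_end
      have "?g (- t) \<notin> arc_points s" if "0 < t" "t < 2 * pi - L" for t
        using not_in_arc[of "2 * pi - t"] geodesic_periodic[of _ _ "- t"] that by simp
      then show ?thesis
        using bwd_end L2 by (intro exI[of _ "2 * pi - L"]) auto
    qed
  qed
qed

text \<open>A geodesic from \<open>p\<close> that meets the circle of the arc again before time
  \<open>pi\<close> lies on that circle, so only the two directions along the arc matter. This makes
  \<open>r\<close> uniform in \<open>e\<close>.\<close>

lemma arc_locally_conical:
  assumes "valid_arc s" "p \<in> arc_points s"
  obtains r where "0 < r"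
    "\<And>e t t'. unit_tangent p e \<Longrightarrow> 0 < t \<Longrightarrow> t < r \<Longrightarrow> 0 < t' \<Longrightarrow> t' < r \<Longrightarrow>
       geodesic p e t \<in> arc_points s \<Longrightarrow> geodesic p e t' \<in> arc_points s"
proof -
  let ?g = "geodesic (arc_start s) (arc_dir s)"
  note ut = valid_arc_unit_tangent[OF assms(1)]
  obtain t0 where t0: "0 \<le> t0" "t0 \<le> arc_length s" and p: "p = ?g t0"
    using assms(2) by (auto simp: arc_points_def)
  obtain r1 where r1: "0 < r1" "\<And>t t'. 0 < t \<Longrightarrow> t < r1 \<Longrightarrow> 0 < t' \<Longrightarrow> t' < r1 \<Longrightarrow>
           ?g (t0 + t) \<in> arc_points s \<Longrightarrow> ?g (t0 + t') \<in> arc_points s"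
    using arc_direction_locally_constant[OF assms(1) t0, of 1] by auto
  obtain r2 where r2: "0 < r2" "\<And>t t'. 0 < t \<Longrightarrow> t < r2 \<Longrightarrow> 0 < t' \<Longrightarrow> t' < r2 \<Longrightarrow>
           ?g (t0 - t) \<in> arc_points s \<Longrightarrow> ?g (t0 - t') \<in> arc_points s"
    using arc_direction_locally_constant[OF assms(1) t0, of "-1"] by auto
  show thesis
  proof (rule that[of "min pi (min r1 r2)"])
    show "0 < min pi (min r1 r2)" using r1 r2 by simp
    fix e t t'
    assume e: "unit_tangent p e" and t: "0 < t" "t < min pi (min r1 r2)"
      and t': "0 < t'" "t' < min pi (min r1 r2)" and arc: "geodesic p e t \<in> arc_points s"
    have "sin t * (e \<bullet> arc_normal s) = 0"
      using arc_normal_orthogonal[OF arc] arc_normal_orthogonal[OF assms(2)]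
      by (simp add: geodesic_def inner_add_left)
    moreover have "sin t \<noteq> 0"
      using t sin_gt_zero[of t] by simp
    ultimately have "e \<bullet> cross3 (arc_start s) (arc_dir s) = 0"
      by (simp add: arc_normal_def)
    moreover have "norm e = 1"
      using e by (simp add: unit_tangent_def)
    ultimately obtain \<psi> where \<psi>: "e = ?g \<psi>"
      using great_circle_param[OF ut] by metis
    have c: "cos (\<psi> - t0) = 0"
      using e unfolding unit_tangent_def p \<psi>
      using inner_geodesic_geodesic[OF ut, of \<psi> t0] by (simp add: inner_commute)
    then have s: "(sin (\<psi> - t0))\<^sup>2 = 1"
      using sin_cos_squared_add[of "\<psi> - t0"] by simp
    \<comment> \<open>On the common circle \<open>e\<close> is a quarter turn away from
      \<open>p\<close>; \<open>\<sigma>\<close> tells whether it points along the arc or against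
      it.\<close>
    define \<sigma> where "\<sigma> = sin (\<psi> - t0)"
    have \<sigma>: "\<sigma> = 1 \<or> \<sigma> = -1"
      using s by (simp add: \<sigma>_def power2_eq_1_iff)
    have "cos \<psi> = - \<sigma> * sin t0" "sin \<psi> = \<sigma> * cos t0"
      using cos_add[of t0 "\<psi> - t0"] sin_add[of t0 "\<psi> - t0"] c by (simp_all add: \<sigma>_def)
    then have g: "geodesic p e u = ?g (t0 + \<sigma> * u)" for u
      unfolding p \<psi> using \<sigma>
      by (auto simp: geodesic_def cos_add sin_add cos_diff sin_diff algebra_simps)
    show "geodesic p e t' \<in> arc_points s"
      using \<sigma>
    proof
      assume "\<sigma> = 1"
      then show ?thesis using arc t t' r1(2)[of t t'] by (simp add: g)
    next
      assume "\<sigma> = -1"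
      then show ?thesis using arc t t' r2(2)[of t t'] by (simp add: g)
    qed
  qed
qed

locale polygon =
  fixes P :: "(real^3) set" and S :: "great_arc set"
  assumes geodesic_polygon: "geodesic_polygon P S"
begin

abbreviation "I \<equiv> sphere_interior P"

definition "boundary = (\<Union>s\<in>S. arc_points s)"

lemma P_sphere: "P \<subseteq> unit_sphere" and compact_P: "compact P"
  and closure_I: "closure I = P" and finite_S: "finite S" and S_nonempty: "S \<noteq> {}"
  and valid_arcs: "s \<in> S \<Longrightarrow> valid_arc s"
  and arcs_intersect: "s \<in> S \<Longrightarrow> s' \<in> S \<Longrightarrow> s \<noteq> s' \<Longrightarrow>
        arc_points s \<inter> arc_points s' \<subseteq> arc_ends s \<inter> arc_ends s'"
  using geodesic_polygon by (auto simp: geodesic_polygon_def)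

lemma I_subset: "I \<subseteq> P"
  using closure_I closure_subset by blast

lemma norm_I: "x \<in> I \<Longrightarrow> norm x = 1"
  using I_subset P_sphere by (auto simp: subset_iff)

lemma openin_I: "openin (top_of_set unit_sphere) I"
  by (simp add: sphere_interior_def)

lemma boundary_eq: "boundary = P - I"
proof -
  have "closedin (top_of_set unit_sphere) P"
    using compact_P P_sphere by (simp add: closed_subset compact_imp_closed)
  then have "top_of_set unit_sphere frontier_of P = P - I"
    by (simp add: frontier_of_def closure_of_closedin sphere_interior_def)
  then show ?thesis
    using geodesic_polygon by (simp add: geodesic_polygon_def boundary_def)
qed

lemma I_ball:
  assumes "x \<in> I"
  obtains r where "0 < r" "\<And>y. norm y = 1 \<Longrightarrow> dist y x < r \<Longrightarrow> y \<in> I"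
  using openin_I assms unfolding openin_euclidean_subtopology_iff by fastforce

lemma I_compact_nbhd:
  assumes "compact K" "K \<subseteq> I"
  obtains r where "0 < r" "\<And>x y. x \<in> K \<Longrightarrow> norm y = 1 \<Longrightarrow> dist y x < r \<Longrightarrow> y \<in> I"
proof -
  obtain U where U: "open U" "I = unit_sphere \<inter> U"
    using openin_I by (auto simp: openin_open)
  then have "K \<subseteq> U" using assms by auto
  then obtain r where r: "0 < r" "(\<Union>x\<in>K. ball x r) \<subseteq> U"
    using compact_subset_open_imp_ball_epsilon_subset[OF assms(1) U(1)] by blast
  show thesis
  proof (rule that[OF r(1)])
    fix x y assume "x \<in> K" "norm y = 1" "dist y x < r"
    then have "y \<in> (\<Union>x\<in>K. ball x r)" by (auto simp: dist_commute)
    then have "y \<in> U" using r by blast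
    then show "y \<in> I" using U \<open>norm y = 1\<close> by auto
  qed
qed

text \<open>Off the boundary the sphere is the union of two disjoint open sets, \<open>I\<close> and
  the complement of \<open>P\<close>.\<close>

lemma connected_subset_I:
  assumes "connected C" "C \<subseteq> unit_sphere" "C \<inter> boundary = {}" "C \<inter> I \<noteq> {}"
  shows "C \<subseteq> I"
proof -
  obtain U where U: "open U" "I = unit_sphere \<inter> U"
    using openin_I by (auto simp: openin_open)
  have "open (- P)" using compact_P compact_imp_closed by blast
  moreover have "U \<inter> - P \<inter> C = {}" using U assms(2) I_subset by blast
  moreover have "C \<subseteq> U \<union> - P" using assms(3) U boundary_eq by blast
  moreover have "U \<inter> C \<noteq> {}" using U assms(4) by blast
  ultimately have "- P \<inter> C = {}"
    using connectedD[OF assms(1) U(1)] by blast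
  then show ?thesis using assms(3) boundary_eq by blast
qed

lemma finite_corners: "finite (corners S)"
  by (simp add: corners_def arc_ends_def finite_S)

lemma side_unique:
  "s \<in> S \<Longrightarrow> s' \<in> S \<Longrightarrow> p \<in> arc_points s - corners S \<Longrightarrow> p \<in> arc_points s' \<Longrightarrow> s' = s"
  using arcs_intersect[of s s'] by (auto simp: corners_def)

lemma sides_away:
  obtains r where "0 < r" "\<And>s x. s \<in> S \<Longrightarrow> p \<notin> arc_points s \<Longrightarrow> x \<in> arc_points s \<Longrightarrow> r \<le> dist x p"
proof -
  have "closed (\<Union>s\<in>{s\<in>S. p \<notin> arc_points s}. arc_points s)"
    by (intro closed_UN ballI closed_arc_points) (simp add: finite_S)
  then obtain r where "0 < r" "\<forall>x\<in>(\<Union>s\<in>{s\<in>S. p \<notin> arc_points s}. arc_points s). r \<le> dist p x"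
    using separate_point_closed[of _ p] by blast
  then show thesis by (intro that[of r]) (auto simp: dist_commute)
qed

text \<open>If a short ray from \<open>p\<close> touched a side at one time, that side would contain
  \<open>p\<close> and then the whole short ray. The point \<open>p\<close> may be a corner, and
  \<open>r\<close> does not depend on the direction; both matter when geodesics run into a
  corner.\<close>

lemma interior_locally_conical:
  obtains r where "0 < r"
    "\<And>e t t'. unit_tangent p e \<Longrightarrow> 0 < t \<Longrightarrow> t < r \<Longrightarrow> 0 < t' \<Longrightarrow> t' < r \<Longrightarrow>
       geodesic p e t \<in> I \<Longrightarrow> geodesic p e t' \<in> I"
proof -
  have "\<exists>r>0. \<forall>e t t'. unit_tangent p e \<longrightarrow> 0 < t \<longrightarrow> t < r \<longrightarrow> 0 < t' \<longrightarrow> t' < r \<longrightarrow>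
       geodesic p e t \<in> arc_points s \<longrightarrow> geodesic p e t' \<in> arc_points s"
    if "s \<in> S" "p \<in> arc_points s" for s
    using arc_locally_conical[OF valid_arcs[OF that(1)] that(2)] by metis
  then obtain R where R: "\<And>s. s \<in> S \<Longrightarrow> p \<in> arc_points s \<Longrightarrow> 0 < R s"
    "\<And>s e t t'. \<lbrakk>s \<in> S; p \<in> arc_points s; unit_tangent p e; 0 < t; t < R s; 0 < t'; t' < R s;
       geodesic p e t \<in> arc_points s\<rbrakk> \<Longrightarrow> geodesic p e t' \<in> arc_points s"
    by metis
  obtain r0 where r0: "0 < r0"
    "\<And>s x. s \<in> S \<Longrightarrow> p \<notin> arc_points s \<Longrightarrow> x \<in> arc_points s \<Longrightarrow> r0 \<le> dist x p"
    using sides_away[of p] by blast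
  define r where "r = Min (insert r0 (R ` {s\<in>S. p \<in> arc_points s}))"
  have r: "0 < r" "r \<le> r0" "\<And>s. s \<in> S \<Longrightarrow> p \<in> arc_points s \<Longrightarrow> r \<le> R s"
    using r0 R finite_S by (auto simp: r_def)
  show thesis
  proof (rule that[OF r(1)])
    fix e t t'
    assume e: "unit_tangent p e" and t: "0 < t" "t < r" and t': "0 < t'" "t' < r"
      and I: "geodesic p e t \<in> I"
    have "geodesic p e u \<notin> boundary" if u: "u \<in> {0<..<r}" for u
    proof
      assume "geodesic p e u \<in> boundary"
      then obtain s where s: "s \<in> S" "geodesic p e u \<in> arc_points s"
        by (auto simp: boundary_def)
      have "dist (geodesic p e u) p < r0"
        using dist_geodesic[OF e, of u 0] u r by auto
      then have "p \<in> arc_points s" using r0 s by force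
      then have "geodesic p e t \<in> arc_points s"
        using R(2)[OF s(1) _ e, of u t] s r(3) u t by force
      then show False using I s boundary_eq by (auto simp: boundary_def)
    qed
    moreover have "connected (geodesic p e ` {0<..<r})"
      by (intro connected_continuous_image continuous_intros connected_Ioo)
    ultimately have "geodesic p e ` {0<..<r} \<subseteq> I"
      using I t e by (intro connected_subset_I) (auto simp: disjoint_iff image_iff intro!: exI[of _ "geodesic p e t"] bexI[of _ t])
    then show "geodesic p e t' \<in> I" using t' by auto
  qed
qed

end

section \<open>One-sided neighbourhoods of side points\<close>

lemma half_disc_connected:
  assumes "0 \<le> \<kappa>"
  shows "connected {x. norm x = 1 \<and> \<kappa> < x \<bullet> p \<and> 0 < \<nu> \<bullet> (x::real^3)}"
\<comment> \<open>The set is the radial projection of the cone \<open>?C\<close>, which is convex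
  because \<open>\<kappa> * norm y\<close> is a convex function of \<open>y\<close>.\<close>
proof -
  let ?C = "{y. \<kappa> * norm y < y \<bullet> p \<and> 0 < \<nu> \<bullet> y}"
  have "convex ?C"
  proof (rule convexI)
    fix x y and u v :: real
    assume x: "x \<in> ?C" and y: "y \<in> ?C" and uv: "0 \<le> u" "0 \<le> v" "u + v = 1"
    have pos: "0 < u * a + v * b" if "0 < a" "0 < b" for a b :: real
    proof (cases "u = 0")
      case True
      then show ?thesis using uv that by simp
    next
      case False
      then show ?thesis using uv that by (simp add: add_pos_nonneg)
    qed
    have "\<kappa> * norm (u *\<^sub>R x + v *\<^sub>R y) \<le> \<kappa> * (u * norm x + v * norm y)"
      using norm_triangle_ineq[of "u *\<^sub>R x" "v *\<^sub>R y"] uv assms by (intro mult_left_mono) auto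
    moreover have "0 < u * (x \<bullet> p - \<kappa> * norm x) + v * (y \<bullet> p - \<kappa> * norm y)"
      using x y by (intro pos) auto
    moreover have "0 < u * (\<nu> \<bullet> x) + v * (\<nu> \<bullet> y)"
      using x y by (intro pos) auto
    ultimately show "u *\<^sub>R x + v *\<^sub>R y \<in> ?C"
      by (simp add: inner_add_left inner_add_right algebra_simps)
  qed
  moreover have "continuous_on ?C (\<lambda>y. y /\<^sub>R norm y)"
    by (intro continuous_intros) auto
  ultimately have "connected ((\<lambda>y. y /\<^sub>R norm y) ` ?C)"
    using convex_connected connected_continuous_image by blast
  also have "(\<lambda>y. y /\<^sub>R norm y) ` ?C = {x. norm x = 1 \<and> \<kappa> < x \<bullet> p \<and> 0 < \<nu> \<bullet> x}" (is "_ = ?D")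
  proof (intro equalityI subsetI)
    fix x assume "x \<in> (\<lambda>y. y /\<^sub>R norm y) ` ?C"
    then obtain y where y: "y \<in> ?C" "x = y /\<^sub>R norm y" by auto
    have "0 < norm y" using y by auto
    moreover have "\<kappa> < (y \<bullet> p) / norm y"
      using y \<open>0 < norm y\<close> by (simp add: pos_less_divide_eq)
    moreover have "0 < (\<nu> \<bullet> y) / norm y"
      using y \<open>0 < norm y\<close> by simp
    ultimately show "x \<in> ?D" using y(2) by (simp add: divide_inverse_commute)
  next
    fix x assume "x \<in> ?D"
    then show "x \<in> (\<lambda>y. y /\<^sub>R norm y) ` ?C" by (intro image_eqI[of _ _ x]) auto
  qed
  finally show ?thesis .
qed

lemma dist_sphere_less_iff:
  assumes "norm (x::real^3) = 1" "norm p = 1" "0 < r"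
  shows "dist x p < r \<longleftrightarrow> 1 - r\<^sup>2 / 2 < x \<bullet> p"
proof -
  have "dist x p < r \<longleftrightarrow> (dist x p)\<^sup>2 < r\<^sup>2"
    using assms(3) power2_less_imp_less[of "dist x p" r] power_strict_mono[of "dist x p" r 2] by auto
  also have "(dist x p)\<^sup>2 = 2 - 2 * (x \<bullet> p)"
    using assms by (simp add: dist_norm power2_norm_eq_inner inner_diff_left inner_diff_right
        norm_eq_1 inner_commute)
  finally show ?thesis by auto
qed

text \<open>Unless the arc is a full circle, a point of it that is no end point has positive
  distance from the closed complementary arc \<open>K\<close>.\<close>

lemma arc_interior_point:
  assumes "valid_arc s" "p \<in> arc_points s" "p \<notin> arc_ends s"
  obtains r where "0 < r"
    "\<And>x. norm x = 1 \<Longrightarrow> x \<bullet> arc_normal s = 0 \<Longrightarrow> dist x p < r \<Longrightarrow> x \<in> arc_points s"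
proof -
  let ?g = "geodesic (arc_start s) (arc_dir s)" and ?L = "arc_length s"
  note ut = valid_arc_unit_tangent[OF assms(1)]
  have circle: "\<exists>\<phi>. 0 \<le> \<phi> \<and> \<phi> < 2 * pi \<and> x = ?g \<phi>" if "norm x = 1" "x \<bullet> arc_normal s = 0" for x
    using great_circle_param[OF ut that(1)] that(2) by (auto simp: arc_normal_def)
  show thesis
  proof (cases "?L = 2 * pi")
    case True
    show thesis
    proof (rule that[of 1])
      fix x assume "norm x = 1" "x \<bullet> arc_normal s = 0"
      then show "x \<in> arc_points s" using circle True by (fastforce simp: arc_points_def)
    qed simp
  next
    case False
    then have L: "0 < ?L" "?L < 2 * pi" using assms(1) by (auto simp: valid_arc_def)
    obtain t0 where t0: "0 < t0" "t0 < ?L" "p = ?g t0"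
    proof -
      obtain t0 where "0 \<le> t0" "t0 \<le> ?L" "p = ?g t0"
        using assms(2) by (auto simp: arc_points_def)
      moreover from this have "t0 \<noteq> 0" "t0 \<noteq> ?L"
        using assms(3) False by (auto simp: arc_ends_def)
      ultimately show thesis using that[of t0] by simp
    qed
    define K where "K = ?g ` {?L..2 * pi}"
    have "p \<notin> K" unfolding K_def
    proof
      assume "p \<in> ?g ` {?L..2 * pi}"
      then obtain t where t: "?L \<le> t" "t \<le> 2 * pi" "?g t = ?g t0" using t0(3) by auto
      with geodesic_inj[OF ut] obtain n :: int where n: "t = t0 + 2 * pi * n" by blast
      have "0 < 2 * pi * n" "2 * pi * n < 2 * pi * 1"
        using n t t0 by linarith+
      then have "0 < n" "n < 1"
        using pi_gt_zero by (simp_all add: zero_less_mult_iff)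
      then show False by simp
    qed
    moreover have "closed K" unfolding K_def
      by (intro compact_imp_closed compact_continuous_image continuous_intros compact_Icc)
    ultimately obtain r where r: "0 < r" "\<And>x. x \<in> K \<Longrightarrow> r \<le> dist p x"
      using separate_point_closed[of _ p] by blast
    show thesis
    proof (rule that[OF r(1)])
      fix x assume x: "norm x = 1" "x \<bullet> arc_normal s = 0" "dist x p < r"
      obtain \<phi> where \<phi>: "0 \<le> \<phi>" "\<phi> < 2 * pi" "x = ?g \<phi>"
        using circle[OF x(1,2)] by blast
      then have "\<not> ?L \<le> \<phi>"
        using r(2)[of x] x(3) by (auto simp: dist_commute K_def)
      then show "x \<in> arc_points s" using \<phi> by (auto simp: arc_points_def)
    qed
  qed
qed

text \<open>The side cuts a small disc about \<open>p\<close> into two half discs, each inside or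
  disjoint from \<open>I\<close>. One is inside because \<open>P\<close> is the closure of its
  interior; if both were, the disc would lie in \<open>P\<close> and \<open>p\<close> would be
  interior. So \<open>\<nu>\<close> is the inward normal.\<close>

lemma (in polygon) regular_side_point:
  assumes "s \<in> S" "p \<in> arc_points s - corners S"
  obtains \<nu> r where "0 < r" "\<nu> = arc_normal s \<or> \<nu> = - arc_normal s"
    "\<And>x. norm x = 1 \<Longrightarrow> dist x p < r \<Longrightarrow> x \<in> I \<longleftrightarrow> 0 < \<nu> \<bullet> x"
    "\<And>x. norm x = 1 \<Longrightarrow> dist x p < r \<Longrightarrow> \<nu> \<bullet> x = 0 \<Longrightarrow> x \<in> arc_points s - corners S"
proof -
  let ?n = "arc_normal s"
  have p: "norm p = 1" using arc_points_sphere assms valid_arcs by blast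
  have "p \<notin> arc_ends s" using assms by (auto simp: corners_def)
  then obtain r1 where r1: "0 < r1"
    "\<And>x. norm x = 1 \<Longrightarrow> x \<bullet> ?n = 0 \<Longrightarrow> dist x p < r1 \<Longrightarrow> x \<in> arc_points s"
    using arc_interior_point[OF valid_arcs[OF assms(1)], of p] assms(2) by blast
  obtain r2 where r2: "0 < r2"
    "\<And>s x. s \<in> S \<Longrightarrow> p \<notin> arc_points s \<Longrightarrow> x \<in> arc_points s \<Longrightarrow> r2 \<le> dist x p"
    using sides_away[of p] by blast
  obtain r3 where r3: "0 < r3" "\<And>x. x \<in> corners S \<Longrightarrow> r3 \<le> dist p x"
    using separate_point_closed[OF finite_imp_closed[OF finite_corners], of p] assms(2) by blast
  \<comment> \<open>The bound 1 keeps the level \<open>1 - r\<^sup>2 / 2\<close> of the cap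
    nonnegative, as \<open>half_disc_connected\<close> requires.\<close>
  define r where "r = min (min r1 r2) (min r3 1)"
  have r: "0 < r" "r \<le> r1" "r \<le> r2" "r \<le> r3" "r \<le> 1"
    using r1 r2 r3 by (auto simp: r_def)
  have bd: "x \<in> boundary \<longleftrightarrow> ?n \<bullet> x = 0" if x: "norm x = 1" "dist x p < r" for x
  proof
    assume "x \<in> boundary"
    then obtain s' where s': "s' \<in> S" "x \<in> arc_points s'" by (auto simp: boundary_def)
    then have "p \<in> arc_points s'" using r2(2)[of s' x] x r by force
    then have "s' = s" using side_unique assms s' by blast
    then show "?n \<bullet> x = 0" using arc_normal_orthogonal[OF s'(2)] by (simp add: inner_commute)
  next
    assume "?n \<bullet> x = 0"
    then show "x \<in> boundary"
      using r1(2)[of x] x r assms by (auto simp: boundary_def inner_commute)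
  qed
  define D where "D \<nu> = {x. norm x = 1 \<and> dist x p < r \<and> 0 < \<nu> \<bullet> x}" for \<nu>
  have D_I: "D \<nu> \<subseteq> I" if "\<nu> = ?n \<or> \<nu> = - ?n" "D \<nu> \<inter> I \<noteq> {}" for \<nu>
  proof (rule connected_subset_I)
    have "r\<^sup>2 \<le> 1" using r by (simp add: power_le_one)
    moreover have "D \<nu> = {x. norm x = 1 \<and> 1 - r\<^sup>2 / 2 < x \<bullet> p \<and> 0 < \<nu> \<bullet> x}"
      using dist_sphere_less_iff[OF _ p r(1)] by (auto simp: D_def)
    ultimately show "connected (D \<nu>)" using half_disc_connected[of "1 - r\<^sup>2 / 2"] by simp
    show "D \<nu> \<subseteq> unit_sphere" by (auto simp: D_def)
    show "D \<nu> \<inter> boundary = {}" using bd that(1) by (auto simp: D_def)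
    show "D \<nu> \<inter> I \<noteq> {}" by fact
  qed
  have p_bd: "p \<in> boundary" using assms by (auto simp: boundary_def)
  then have "p \<in> closure I" using closure_I boundary_eq by auto
  then obtain y where y: "y \<in> I" "dist y p < r"
    using r(1) closure_approachable by blast
  then have "?n \<bullet> y \<noteq> 0" using bd[of y] norm_I boundary_eq by blast
  define \<nu> where "\<nu> = (if 0 < ?n \<bullet> y then ?n else - ?n)"
  have \<nu>: "\<nu> = ?n \<or> \<nu> = - ?n" by (simp add: \<nu>_def)
  have "y \<in> D \<nu>"
    using y norm_I \<open>?n \<bullet> y \<noteq> 0\<close> by (auto simp: D_def \<nu>_def)
  then have pos: "D \<nu> \<subseteq> I" using D_I[OF \<nu>] y by blast
  have neg: "D (- \<nu>) \<inter> I = {}"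
  proof (rule ccontr)
    assume "D (- \<nu>) \<inter> I \<noteq> {}"
    then have neg: "D (- \<nu>) \<subseteq> I" using D_I \<nu> by (metis minus_minus)
    have "unit_sphere \<inter> ball p r \<subseteq> P"
    proof
      fix x assume "x \<in> unit_sphere \<inter> ball p r"
      then have x: "norm x = 1" "dist x p < r" by (auto simp: dist_commute)
      consider "0 < \<nu> \<bullet> x" | "\<nu> \<bullet> x < 0" | "\<nu> \<bullet> x = 0" by linarith
      then show "x \<in> P"
      proof cases
        case 1
        then have "x \<in> D \<nu>" using x by (simp add: D_def)
        then show ?thesis using pos I_subset by blast
      next
        case 2
        then have "x \<in> D (- \<nu>)" using x by (simp add: D_def)
        then show ?thesis using neg I_subset by blast
      next
        case 3
        then have "?n \<bullet> x = 0" using \<nu> by auto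
        then show ?thesis using bd[OF x] boundary_eq by blast
      qed
    qed
    moreover have "openin (top_of_set unit_sphere) (unit_sphere \<inter> ball p r)" by auto
    ultimately have "unit_sphere \<inter> ball p r \<subseteq> I"
      by (simp add: sphere_interior_def interior_of_maximal)
    moreover have "p \<in> unit_sphere \<inter> ball p r" using p r by simp
    ultimately show False using p_bd boundary_eq by blast
  qed
  show thesis
  proof (rule that[OF r(1) \<nu>])
    fix x assume x: "norm x = 1" "dist x p < r"
    consider "0 < \<nu> \<bullet> x" | "\<nu> \<bullet> x < 0" | "\<nu> \<bullet> x = 0" by linarith
    then show "x \<in> I \<longleftrightarrow> 0 < \<nu> \<bullet> x"
    proof cases
      case 1
      then have "x \<in> D \<nu>" using x by (simp add: D_def)
      then show ?thesis using pos 1 by blast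
    next
      case 2
      then have "x \<in> D (- \<nu>)" using x by (simp add: D_def)
      then show ?thesis using neg 2 by fastforce
    next
      case 3
      then have "?n \<bullet> x = 0" using \<nu> by auto
      then have "x \<notin> I" using bd[OF x] boundary_eq by blast
      then show ?thesis using 3 by simp
    qed
    assume "\<nu> \<bullet> x = 0"
    then have "x \<in> arc_points s"
      using r1(2)[of x] x \<nu> r by (auto simp: inner_commute)
    moreover have "x \<notin> corners S"
      using r3(2)[of x] x r by (auto simp: dist_commute)
    ultimately show "x \<in> arc_points s - corners S" by blast
  qed
qed

section \<open>Orbits as unfolded geodesics\<close>

context polygon
begin

text \<open>\<open>G\<close> is the unfolded curve, \<open>reflections w (G t)\<close> the actual
  position, and the last argument the time of the latest reflection.\<close>

inductive reach :: "(real \<Rightarrow> real^3) \<Rightarrow> great_arc list \<Rightarrow> real \<Rightarrow> bool" for G where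
  start: "reach G [] 0"
| reflect: "reach G w a \<Longrightarrow> a < b \<Longrightarrow> (\<And>t. a < t \<Longrightarrow> t < b \<Longrightarrow> reflections w (G t) \<in> I) \<Longrightarrow>
    s \<in> S \<Longrightarrow> reflections w (G b) \<in> arc_points s - corners S \<Longrightarrow> reach G (s # w) b"

text \<open>Nothing is required at time \<open>T\<close> itself, so that a flight may end at a
  reflection or at a corner.\<close>

definition flight :: "(real \<Rightarrow> real^3) \<Rightarrow> great_arc list \<Rightarrow> real \<Rightarrow> real \<Rightarrow> bool" where
  "flight G w a T \<longleftrightarrow> reach G w a \<and> a < T \<and> (\<forall>t. a < t \<longrightarrow> t < T \<longrightarrow> reflections w (G t) \<in> I)"

text \<open>At a reflection time the codes before and after it both qualify;
  \<open>flight_agree\<close> shows that they give the same point.\<close>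

definition orbit :: "(real \<Rightarrow> real^3) \<Rightarrow> real \<Rightarrow> real^3" where
  "orbit G t = (THE p. \<exists>w a T. flight G w a T \<and> a \<le> t \<and> t \<le> T \<and> p = reflections w (G t))"

lemma orthogonal_transformation_reflections:
  "set w \<subseteq> S \<Longrightarrow> orthogonal_transformation (reflections w)"
proof (induction w)
  case Nil
  have "reflections [] = (\<lambda>x. x)" by auto
  then show ?case by simp
next
  case (Cons s w)
  have "orthogonal_transformation (reflection (arc_normal s) \<circ> reflections w)"
    using Cons norm_arc_normal valid_arcs
    by (intro orthogonal_transformation_compose orthogonal_transformation_reflection) auto
  moreover have "reflections (s # w) = reflection (arc_normal s) \<circ> reflections w" by auto
  ultimately show ?case by metis
qed

lemma reach_set: "reach G w a \<Longrightarrow> set w \<subseteq> S"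
  by (induction rule: reach.induct) auto

lemmas reach_orthogonal = orthogonal_transformation_reflections[OF reach_set]

lemma reflections_geodesic:
  assumes "set w \<subseteq> S"
  shows "reflections w (geodesic x v t) = geodesic (reflections w x) (reflections w v) t"
  using assms
  by (simp add: linear_geodesic orthogonal_transformation_linear orthogonal_transformation_reflections)

lemma unit_tangent_reflections:
  "set w \<subseteq> S \<Longrightarrow> unit_tangent x v \<Longrightarrow> unit_tangent (reflections w x) (reflections w v)"
  by (simp add: orthogonal_transformation_unit_tangent orthogonal_transformation_reflections)

lemma reach_nonneg: "reach G w a \<Longrightarrow> 0 \<le> a"
  by (induction rule: reach.induct) auto

lemma reach_pos: "reach G (s # w) a \<Longrightarrow> 0 < a"
  by (cases rule: reach.cases) (auto dest: reach_nonneg)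

lemma reach_reflection_point:
  assumes "reach G (s # w) b"
  shows "s \<in> S" "reflections w (G b) \<in> arc_points s - corners S"
    "reflections (s # w) (G b) = reflections w (G b)"
proof -
  show "s \<in> S" and *: "reflections w (G b) \<in> arc_points s - corners S"
    using assms by (auto elim: reach.cases)
  show "reflections (s # w) (G b) = reflections w (G b)"
    using * by (auto simp: arc_normal_orthogonal reflection_fixes)
qed

section \<open>Uniqueness of codes\<close>

lemma not_I_side: "s \<in> S \<Longrightarrow> p \<in> arc_points s \<Longrightarrow> p \<notin> I"
  using boundary_eq by (auto simp: boundary_def)

text \<open>The next reflection takes place at the first time outside \<open>I\<close>, and off the
  corners its side is unique.\<close>

lemma reach_unique:
  assumes "reach G w a" "reach G w' a'" "length w = length w'"
  shows "w = w' \<and> a = a'"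
  using assms
proof (induction arbitrary: w' a' rule: reach.induct)
  case start
  then show ?case by (auto elim: reach.cases)
next
  case (reflect w a b s)
  from reflect.prems obtain s' w0 where w': "w' = s' # w0" "length w = length w0"
    by (cases w') auto
  from reflect.prems(1)[unfolded w'(1)] obtain a0 where
    r0: "reach G w0 a0" "a0 < a'" "\<And>t. a0 < t \<Longrightarrow> t < a' \<Longrightarrow> reflections w0 (G t) \<in> I"
      "s' \<in> S" "reflections w0 (G a') \<in> arc_points s' - corners S"
    by (cases rule: reach.cases) auto
  then have eq: "w = w0" "a = a0" using reflect.IH w'(2) by auto
  have "b = a'"
    using reflect.hyps r0 not_I_side unfolding eq by (metis DiffD1 not_less_iff_gr_or_eq)
  moreover from this have "s' = s"
    using side_unique[of s s' "reflections w0 (G b)"] reflect.hyps r0 unfolding eq by blast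
  ultimately show ?case using w' eq by simp
qed

text \<open>The shorter code is an earlier stage of the longer history, and \<open>b\<close> is the
  time at which that stage ended with a reflection.\<close>

lemma reach_shorter:
  assumes "reach G w' a'" "reach G w a" "length w < length w'"
  shows "\<exists>b s. flight G w a b \<and> s \<in> S \<and> reflections w (G b) \<in> arc_points s - corners S \<and>
           b \<le> a' \<and> (b = a' \<longrightarrow> w' = s # w)"
  using assms
proof (induction rule: reach.induct)
  case start
  then show ?case by simp
next
  case (reflect w0 a0 b s)
  show ?case
  proof (cases "length w = length w0")
    case True
    then have "w = w0" "a = a0" using reach_unique reflect by blast+
    then show ?thesis
      using reflect.hyps by (intro exI[of _ b] exI[of _ s]) (auto simp: flight_def)
  next
    case False
    then have "length w < length w0" using reflect.prems by simp
    from reflect.IH[OF reflect.prems(1) this] obtain b' s' where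
      "flight G w a b'" "s' \<in> S" "reflections w (G b') \<in> arc_points s' - corners S" "b' \<le> a0"
      by blast
    then show ?thesis using reflect.hyps(2) by (intro exI[of _ b'] exI[of _ s']) auto
  qed
qed

text \<open>Flights with codes of different length overlap at most in the reflection point between
  them, which the new mirror fixes.\<close>

lemma flight_agree:
  assumes "flight G w a T" "a \<le> t" "t \<le> T" "flight G w' a' T'" "a' \<le> t" "t \<le> T'"
  shows "reflections w (G t) = reflections w' (G t)"
proof -
  have *: "reflections w (G t) = reflections w' (G t)"
    if "flight G w a T" "a \<le> t" "t \<le> T" "flight G w' a' T'" "a' \<le> t" "t \<le> T'"
      "length w < length w'" for w w' a a' T T'
  proof -
    from that reach_shorter[of G w' a' w a] obtain b s where
      b: "flight G w a b" "s \<in> S" "reflections w (G b) \<in> arc_points s - corners S"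
        "b \<le> a'" "b = a' \<longrightarrow> w' = s # w"
      by (auto simp: flight_def)
    \<comment> \<open>At time \<open>b\<close> the point folded by \<open>w\<close> is on a side,
      hence outside \<open>I\<close>.\<close>
    have "T \<le> b"
      using b that(1) not_I_side unfolding flight_def by (meson DiffD1 not_le)
    then have "b = a'" "t = b" using b(4) that by auto
    then show ?thesis
      using b reach_reflection_point(3)[of G s w b] that(4) by (auto simp: flight_def)
  qed
  consider "length w = length w'" | "length w < length w'" | "length w' < length w" by linarith
  then show ?thesis
  proof cases
    case 1
    then show ?thesis using reach_unique assms unfolding flight_def by metis
  qed (use * assms in metis)+
qed

lemma orbit_eq:
  assumes "flight G w a T" "a \<le> t" "t \<le> T"
  shows "orbit G t = reflections w (G t)"
  unfolding orbit_def by (rule the_equality) (use assms flight_agree in blast)+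

section \<open>Continuing an orbit\<close>

lemma flight_restrict: "flight G w a T \<Longrightarrow> a < T' \<Longrightarrow> T' \<le> T \<Longrightarrow> flight G w a T'"
  by (auto simp: flight_def)

lemma reach_restrict:
  "reach G w a \<Longrightarrow> 0 < T \<Longrightarrow> T \<le> a \<Longrightarrow> \<exists>w' a'. flight G w' a' T"
proof (induction rule: reach.induct)
  case start
  then show ?case by simp
next
  case (reflect w a b s)
  show ?case
  proof (cases "T \<le> a")
    case True
    then show ?thesis using reflect by blast
  next
    case False
    then show ?thesis using reflect by (intro exI[of _ w] exI[of _ a]) (auto simp: flight_def)
  qed
qed

lemma flight_earlier:
  assumes "flight G w a T" "0 < T'" "T' \<le> T"
  obtains w' a' where "flight G w' a' T'"
  using assms reach_restrict[of G w a T'] flight_restrict[of G w a T T']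
  by (meson flight_def not_le)

text \<open>The height over the mirror is \<open>C * sin (t - a)\<close> and positive just before
  \<open>a\<close>, so \<open>C < 0\<close>; the reflection changes its sign and the orbit returns
  into \<open>I\<close>.\<close>

lemma reach_leaves:
  assumes "reach (geodesic x v) w a" "unit_tangent x v" "x \<in> I"
  obtains T where "flight (geodesic x v) w a T"
proof -
  let ?G = "geodesic x v"
  have "\<exists>T. flight ?G w a T"
    using assms(1)
  proof (cases rule: reach.cases)
    case start
    obtain r where r: "0 < r" "\<And>y. norm y = 1 \<Longrightarrow> dist y x < r \<Longrightarrow> y \<in> I"
      using I_ball[OF assms(3)] by blast
    have "?G t \<in> I" if "0 < t" "t < r" for t
      using that dist_geodesic[OF assms(2), of t 0] by (intro r(2)) (simp_all add: assms(2))
    then show ?thesis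
      using r(1) start reach.start by (intro exI[of _ r]) (auto simp: flight_def)
  next
    case (reflect w0 a0 s)
    let ?g = "\<lambda>t. reflections w0 (?G t)"
    have S: "set w0 \<subseteq> S" "set w \<subseteq> S" using reach_set reflect assms(1) by blast+
    have s: "norm (arc_normal s) = 1" using norm_arc_normal valid_arcs reflect by blast
    obtain \<nu> r where r: "0 < r" and \<nu>: "\<nu> = arc_normal s \<or> \<nu> = - arc_normal s" and
      half: "\<And>y. norm y = 1 \<Longrightarrow> dist y (?g a) < r \<Longrightarrow> y \<in> I \<longleftrightarrow> 0 < \<nu> \<bullet> y"
      using regular_side_point[OF reflect(5,6)] by metis
    define x' v' where "x' = reflections w0 x" and "v' = reflections w0 v"
    have ut: "unit_tangent x' v'"
      using unit_tangent_reflections S(1) assms(2) by (simp add: x'_def v'_def)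
    have g: "?g t = geodesic x' v' t" for t
      using reflections_geodesic[OF S(1)] by (simp add: x'_def v'_def)
    have "\<nu> \<bullet> geodesic x' v' a = 0"
      using reflect(6) \<nu> arc_normal_orthogonal[of "?g a" s] by (auto simp: g inner_commute)
    then obtain C where C: "\<And>t. \<nu> \<bullet> geodesic x' v' t = C * sin (t - a)"
      using inner_geodesic_zero by blast
    \<comment> \<open>Within the last flight, within the disc where \<open>I\<close> is a half disc,
      and within the range where the sine keeps its sign.\<close>
    define \<eta> where "\<eta> = min (a - a0) (min r pi) / 2"
    have \<eta>: "0 < \<eta>" "\<eta> < a - a0" "\<eta> < r" "\<eta> < pi"
      using r reflect(3) pi_gt_zero by (auto simp: \<eta>_def min_def)
    have "?g (a - \<eta>) \<in> I" using reflect(4) \<eta> by simp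
    then have "0 < \<nu> \<bullet> ?g (a - \<eta>)"
      using half[of "?g (a - \<eta>)"] dist_geodesic[OF ut, of "a - \<eta>" a] \<eta> ut by (simp add: g)
    then have "C < 0"
      using C[of "a - \<eta>"] sin_gt_zero[OF \<eta>(1,4)] by (simp add: g mult_less_0_iff)
    have "reflections w (?G t) \<in> I" if t: "a < t" "t < a + \<eta>" for t
    proof -
      have "\<nu> \<bullet> reflections w (?G t) = - (\<nu> \<bullet> ?g t)"
        using reflect(1) s \<nu> inner_reflection by auto
      also have "\<dots> = - C * sin (t - a)" by (simp add: g C)
      also have "\<dots> > 0" using \<open>C < 0\<close> t \<eta> by (simp add: mult_neg_pos sin_gt_zero)
      finally have "0 < \<nu> \<bullet> reflections w (?G t)" .
      moreover have "norm (reflections w (?G t)) = 1"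
        using S(2) assms(2) by (simp add: reflections_geodesic unit_tangent_reflections)
      moreover have "dist (reflections w (?G t)) (?g a) < r"
      proof -
        have "?g a = reflections w (?G a)"
          using reach_reflection_point(3) assms(1) reflect(1) by simp
        then have "dist (reflections w (?G t)) (?g a) = dist (?G t) (?G a)"
          using dist_orthogonal_transformation[OF orthogonal_transformation_reflections[OF S(2)]]
          by simp
        also have "\<dots> \<le> \<bar>t - a\<bar>" using dist_geodesic[OF assms(2)] .
        finally show ?thesis using t \<eta> by simp
      qed
      ultimately show ?thesis using half by blast
    qed
    then show ?thesis
      using assms(1) \<eta>(1) by (intro exI[of _ "a + \<eta>"]) (auto simp: flight_def)
  qed
  then show thesis using that by blast
qed

text \<open>Under \<open>stop\<close> the flight must leave \<open>I\<close> by time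
  \<open>l\<close>. The exit point lies on the boundary and is no corner, so a further reflection
  takes place.\<close>

lemma reach_extend:
  assumes "reach (geodesic x v) w a" "unit_tangent x v" "x \<in> I" "a < l"
  assumes no_corner: "\<And>w a T. flight (geodesic x v) w a T \<Longrightarrow> T \<le> l \<Longrightarrow>
    reflections w (geodesic x v T) \<notin> corners S"
  assumes stop: "\<And>w a T. flight (geodesic x v) w a T \<Longrightarrow> T \<le> l"
  shows "\<exists>s b. reach (geodesic x v) (s # w) b \<and> a < b \<and> b < l"
proof -
  let ?g = "\<lambda>t. reflections w (geodesic x v t)"
  have w: "set w \<subseteq> S" using reach_set[OF assms(1)] .
  have cont: "continuous_on UNIV ?g"
    unfolding reflections_geodesic[OF w] by (intro continuous_intros)
  have norm: "norm (?g t) = 1" for t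
    using w assms(2) by (simp add: reflections_geodesic unit_tangent_reflections)
  have isCont: "isCont ?g t" for t
    using cont by (simp add: continuous_on_eq_continuous_at)
  obtain T where T: "flight (geodesic x v) w a T"
    using reach_leaves assms(1-3) by blast
  have "\<exists>b. a < b \<and> b \<le> l \<and> ?g b \<notin> I \<and> (\<forall>t. a < t \<longrightarrow> t < b \<longrightarrow> ?g t \<in> I)"
  proof -
    \<comment> \<open>The search starts at \<open>T\<close> because the position at time
      \<open>a\<close> may itself be on a side.\<close>
    define B where "B = {t. T \<le> t \<and> t \<le> l \<and> ?g t \<notin> I}"
    \<comment> \<open>Otherwise the orbit is still in \<open>I\<close> at time \<open>l\<close>, and
      openness of \<open>I\<close> carries the flight beyond \<open>l\<close>, against
      \<open>stop\<close>.\<close>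
    have "B \<noteq> {}"
    proof
      assume "B = {}"
      then have in_I: "?g t \<in> I" if "a < t" "t \<le> l" for t
        using T that by (cases "t < T") (auto simp: B_def flight_def)
      obtain r where r: "0 < r" "\<And>y. norm y = 1 \<Longrightarrow> dist y (?g l) < r \<Longrightarrow> y \<in> I"
        using I_ball[OF in_I] assms(4) by blast
      obtain d where d: "0 < d" "\<And>t. dist t l < d \<Longrightarrow> dist (?g t) (?g l) < r"
        using isCont[of l] r(1) unfolding continuous_at_eps_delta by blast
      have "?g t \<in> I" if "a < t" "t < l + d" for t
        using in_I[of t] that r(2)[OF norm d(2)[of t]] by (cases "t \<le> l") (auto simp: dist_real_def)
      then have "flight (geodesic x v) w a (l + d)"
        using assms(1,4) d(1) by (simp add: flight_def)
      then show False using stop d(1) by force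
    qed
    moreover have "closed B"
    proof -
      obtain U where U: "open U" "I = unit_sphere \<inter> U"
        using openin_I by (auto simp: openin_open)
      have "B = {T..l} \<inter> ?g -` (- U)"
        using norm U by (auto simp: B_def)
      moreover have "closed (?g -` (- U))"
        using U(1) cont by (intro closed_vimage) (auto simp: closed_Compl)
      ultimately show ?thesis by auto
    qed
    moreover have bdd: "bdd_below B" by (auto simp: B_def bdd_below_def)
    ultimately have "Inf B \<in> B" by (intro closed_contains_Inf)
    moreover have "?g t \<in> I" if "a < t" "t < Inf B" for t
    proof (cases "t < T")
      case True
      then show ?thesis using T that by (auto simp: flight_def)
    next
      case False
      then have "t \<notin> B" using cInf_lower[OF _ bdd] that by force
      then show ?thesis using False that \<open>Inf B \<in> B\<close> by (auto simp: B_def)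
    qed
    moreover have "a < T" using T by (simp add: flight_def)
    ultimately show ?thesis by (intro exI[of _ "Inf B"]) (auto simp: B_def)
  qed
  then obtain b where b: "a < b" "b \<le> l" "?g b \<notin> I" "\<And>t. a < t \<Longrightarrow> t < b \<Longrightarrow> ?g t \<in> I"
    by blast
  have fl: "flight (geodesic x v) w a b" using b assms(1) by (simp add: flight_def)
  have "?g b \<in> closure I"
  proof -
    have "?g ` closure {a<..<b} \<subseteq> closure I"
      using b(4) closure_subset[of I]
      by (intro image_closure_subset continuous_on_subset[OF cont]) auto
    then show ?thesis using b(1) by (auto simp: closure_greaterThanLessThan)
  qed
  then have "?g b \<in> boundary" using b(3) closure_I boundary_eq by auto
  then obtain s where "s \<in> S" "?g b \<in> arc_points s" by (auto simp: boundary_def)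
  then have "reach (geodesic x v) (s # w) b"
    using b assms(1) no_corner[OF fl b(2)] by (intro reach.reflect) auto
  moreover from this obtain T' where "flight (geodesic x v) (s # w) b T'"
    using reach_leaves assms(2,3) by blast
  \<comment> \<open>The orbit goes on after the reflection, and that flight too ends by time
    \<open>l\<close>; this makes the inequality strict.\<close>
  then have "b < l" using stop by (fastforce simp: flight_def)
  ultimately show ?thesis using b(1) by blast
qed

text \<open>
  Reflections cannot accumulate in finite time: all sides near an accumulation point \<open>p\<close> contain \<open>p\<close>,
  so the unfolded orbit is a geodesic running straight into \<open>p\<close>, and close to \<open>p\<close> such a geodesic
  lies entirely inside or entirely outside the interior of \<open>P\<close>.
\<close>
lemma flight_or_corner:
  assumes "unit_tangent x v" "x \<in> I" "0 < l"
  assumes no_corner: "\<And>w a T. flight (geodesic x v) w a T \<Longrightarrow> T \<le> l \<Longrightarrow>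
    reflections w (geodesic x v T) \<notin> corners S"
  obtains w a T where "flight (geodesic x v) w a T" "l < T"
proof (rule ccontr)
  assume "\<not> thesis"
  then have stop: "T \<le> l" if "flight (geodesic x v) w a T" for w a T
    using that \<open>\<And>T a w. flight (geodesic x v) w a T \<Longrightarrow> l < T \<Longrightarrow> thesis\<close> by force
  let ?G = "geodesic x v"
  have extend: "\<exists>s b. reach ?G (s # w) b \<and> a < b \<and> b < l" if "reach ?G w a" "a < l" for w a
    by (rule reach_extend) (use that assms(1,2) no_corner stop in blast)+
  have "\<exists>f. \<forall>k. (reach ?G (fst (f k)) (snd (f k)) \<and> snd (f k) < l) \<and>
     ((\<exists>s. fst (f (Suc k)) = s # fst (f k)) \<and> snd (f k) < snd (f (Suc k)))"
  proof (rule dependent_nat_choice)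
    show "\<exists>p. reach ?G (fst p) (snd p) \<and> snd p < l"
      using reach.start assms(3) by (intro exI[of _ "([], 0)"]) auto
    fix p and n :: nat assume "reach ?G (fst p) (snd p) \<and> snd p < l"
    then obtain s b where "reach ?G (s # fst p) b" "snd p < b" "b < l"
      using extend by blast
    then show "\<exists>q. (reach ?G (fst q) (snd q) \<and> snd q < l) \<and>
       (\<exists>s. fst q = s # fst p) \<and> snd p < snd q"
      by (intro exI[of _ "(s # fst p, b)"]) auto
  qed
  then obtain f where f: "\<And>k. reach ?G (fst (f k)) (snd (f k))" "\<And>k. snd (f k) < l"
      "\<And>k. \<exists>s. fst (f (Suc k)) = s # fst (f k)" "\<And>k. snd (f k) < snd (f (Suc k))"
    by blast
  define w a where "w k = fst (f k)" and "a k = snd (f k)" for k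
  obtain \<sigma> where \<sigma>: "\<And>k. w (Suc k) = \<sigma> k # w k"
    using f(3) unfolding w_def by metis
  have reach: "reach ?G (w k) (a k)" and a_l: "a k < l" and a_less: "a k < a (Suc k)" for k
    using f by (simp_all add: w_def a_def)
  have wS: "set (w k) \<subseteq> S" for k using reach_set[OF reach] .
  have iso: "orthogonal_transformation (reflections (w k))" for k
    using orthogonal_transformation_reflections[OF wS] .
  have hit: "\<sigma> k \<in> S" "reflections (w k) (?G (a (Suc k))) \<in> arc_points (\<sigma> k)"
    "reflections (w (Suc k)) (?G (a (Suc k))) = reflections (w k) (?G (a (Suc k)))" for k
    using reach_reflection_point[of ?G "\<sigma> k" "w k" "a (Suc k)"] reach[of "Suc k"] \<sigma>[of k] by auto
  have "incseq a" using a_less by (intro incseq_SucI less_imp_le)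
  moreover have "\<forall>k. a k \<le> l" using a_l less_imp_le by blast
  ultimately obtain Ts where Ts: "a \<longlonglongrightarrow> Ts" "\<And>k. a k \<le> Ts"
    using incseq_convergent by metis
  \<comment> \<open>The actual reflection points; they form a Cauchy sequence because the orbit has
    unit speed and the times converge.\<close>
  define q where "q k = reflections (w k) (?G (a k))" for k
  have dq: "dist (q k) (q m) \<le> a m - a k" if "k \<le> m" for k m
    using that
  proof (induction m rule: dec_induct)
    case base
    then show ?case by simp
  next
    case (step m)
    have "dist (q m) (q (Suc m)) = dist (?G (a m)) (?G (a (Suc m)))"
      using hit(3) dist_orthogonal_transformation[OF iso] by (simp add: q_def)
    also have "\<dots> \<le> a (Suc m) - a m"
      using dist_geodesic[OF assms(1), of "a m" "a (Suc m)"] a_less[of m] by simp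
    finally show ?case
      using dist_triangle[of "q k" "q (Suc m)" "q m"] step.IH by linarith
  qed
  have "Cauchy q"
  proof (rule metric_CauchyI)
    fix e :: real assume "0 < e"
    then obtain N where N: "\<And>m n. m \<ge> N \<Longrightarrow> n \<ge> N \<Longrightarrow> dist (a m) (a n) < e"
      using LIMSEQ_imp_Cauchy[OF Ts(1)] metric_CauchyD by blast
    have "dist (q m) (q n) < e" if "m \<ge> N" "n \<ge> N" for m n
    proof (cases "m \<le> n")
      case True
      then show ?thesis using dq[of m n] N[OF that] by (simp add: dist_real_def)
    next
      case False
      then show ?thesis using dq[of n m] N[OF that] by (simp add: dist_real_def dist_commute)
    qed
    then show "\<exists>M. \<forall>m\<ge>M. \<forall>n\<ge>M. dist (q m) (q n) < e" by blast
  qed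
  then obtain p where p: "q \<longlonglongrightarrow> p"
    using Cauchy_convergent convergent_def by blast
  obtain r0 where r0: "0 < r0"
    "\<And>s x. s \<in> S \<Longrightarrow> p \<notin> arc_points s \<Longrightarrow> x \<in> arc_points s \<Longrightarrow> r0 \<le> dist x p"
    using sides_away[of p] by blast
  obtain r where r: "0 < r" "\<And>e t t'. unit_tangent p e \<Longrightarrow> 0 < t \<Longrightarrow> t < r \<Longrightarrow> 0 < t' \<Longrightarrow> t' < r \<Longrightarrow>
       geodesic p e t \<in> I \<Longrightarrow> geodesic p e t' \<in> I"
    using interior_locally_conical[of p] by blast
  have "\<forall>\<^sub>F k in sequentially. dist (q k) p < r0" "\<forall>\<^sub>F k in sequentially. dist (a k) Ts < r"
    using p Ts(1) r0(1) r(1) by (auto intro: tendstoD)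
  then obtain K where K: "\<And>k. k \<ge> K \<Longrightarrow> dist (q k) p < r0" "\<And>k. k \<ge> K \<Longrightarrow> dist (a k) Ts < r"
    unfolding eventually_sequentially by (metis linorder_le_cases order_trans)
  \<comment> \<open>From stage \<open>K\<close> on every mirror contains \<open>p\<close>, so each
    later folding arises from the one at stage \<open>K\<close> by isometries that fix
    \<open>p\<close>.\<close>
  have fix_p: "dist (reflections (w k) y) p = dist (reflections (w K) y) p" if "K \<le> k" for k y
    using that
  proof (induction k rule: dec_induct)
    case base
    then show ?case by simp
  next
    case (step k)
    have "p \<in> arc_points (\<sigma> k)"
      using r0(2)[OF hit(1) _ hit(2)[of k]] K(1)[of "Suc k"] step(1) hit(3)[of k]
      unfolding q_def by fastforce
    then have fixed: "reflection (arc_normal (\<sigma> k)) p = p"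
      by (simp add: arc_normal_orthogonal reflection_fixes)
    have "orthogonal_transformation (reflection (arc_normal (\<sigma> k)))"
      using hit(1) valid_arcs norm_arc_normal orthogonal_transformation_reflection by blast
    then have "dist (reflections (w (Suc k)) y) p = dist (reflections (w k) y) p"
      using dist_orthogonal_transformation[of _ "reflections (w k) y" p] fixed
      by (metis \<sigma> reflections.simps(2))
    then show ?case using step.IH by simp
  qed
  define x' v' where "x' = reflections (w K) x" and "v' = reflections (w K) v"
  have g: "reflections (w K) (?G t) = geodesic x' v' t" for t
    using reflections_geodesic[OF wS] by (simp add: x'_def v'_def)
  have ut: "unit_tangent x' v'"
    using unit_tangent_reflections wS assms(1) by (simp add: x'_def v'_def)
  \<comment> \<open>Only distances to \<open>p\<close> count here, so the later foldings may be
    replaced by that of stage \<open>K\<close>, which yields a single geodesic.\<close>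
  have "(\<lambda>k. geodesic x' v' (a k)) \<longlonglongrightarrow> p"
  proof (rule metric_LIMSEQ_I)
    fix e :: real assume "0 < e"
    then obtain N where "\<forall>k\<ge>N. dist (q k) p < e" using p metric_LIMSEQ_D by blast
    moreover have "dist (geodesic x' v' (a k)) p = dist (q k) p" if "K \<le> k" for k
      unfolding q_def fix_p[OF that] g ..
    ultimately have "\<forall>k\<ge>max N K. dist (geodesic x' v' (a k)) p < e" by simp
    then show "\<exists>no. \<forall>k\<ge>no. dist (geodesic x' v' (a k)) p < e" by blast
  qed
  moreover have "(\<lambda>k. geodesic x' v' (a k)) \<longlonglongrightarrow> geodesic x' v' Ts"
    unfolding geodesic_def by (intro tendsto_intros Ts)
  ultimately have p_eq: "p = geodesic x' v' Ts" by (rule LIMSEQ_unique)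
  \<comment> \<open>Reversing time turns it into a ray from \<open>p\<close>.\<close>
  define e where "e = - geodesic_velocity x' v' Ts"
  have ute: "unit_tangent p e" using unit_tangent_geodesic(2)[OF ut] by (simp add: p_eq e_def)
  have ge: "geodesic x' v' t = geodesic p e (Ts - t)" for t
    using geodesic_diff[of x' v' Ts "Ts - t"] by (simp add: p_eq e_def)
  \<comment> \<open>At \<open>m\<close> the ray is inside \<open>I\<close>, at the next reflection
    it is on a side, and both points are within the conical radius of \<open>p\<close>.\<close>
  define m where "m = (a K + a (Suc K)) / 2"
  have m: "a K < m" "m < a (Suc K)" using a_less[of K] by (auto simp: m_def field_simps)
  have lt: "a (Suc K) < Ts" using a_less[of "Suc K"] Ts(2)[of "Suc (Suc K)"] by linarith
  have near: "Ts - a K < r" using K(2)[of K] Ts(2)[of K] by (simp add: dist_real_def)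
  have "geodesic x' v' m \<in> I"
  proof -
    have "reach ?G (\<sigma> K # w K) (a (Suc K))" using reach[of "Suc K"] \<sigma> by simp
    then obtain a' where "reach ?G (w K) a'" "\<And>t. a' < t \<Longrightarrow> t < a (Suc K) \<Longrightarrow> geodesic x' v' t \<in> I"
      unfolding g[symmetric] by (auto elim: reach.cases)
    then show ?thesis using reach_unique[OF reach[of K]] m by blast
  qed
  moreover have "geodesic x' v' (a (Suc K)) \<notin> I"
    using hit(1,2) not_I_side g by metis
  ultimately show False
    using r(2)[OF ute, of "Ts - m" "Ts - a (Suc K)"] m lt near a_less[of K] by (auto simp: ge)
qed

end

section \<open>Stability of orbits\<close>

context polygon
begin

lemma dist_reflections:
  "set w \<subseteq> S \<Longrightarrow> dist (reflections w y) (reflections w y') = dist y y'"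
  by (simp add: dist_orthogonal_transformation orthogonal_transformation_reflections)

text \<open>Induction on the reflections. Away from reflection times compactness leaves room inside
  \<open>I\<close>. Near one, the height over the mirror changes sign for a nearby orbit as well,
  which thus meets the same side at a nearby time. Demanding \<open>I\<close> also at the end time
  \<open>T\<close> is what compactness needs.\<close>

lemma flight_stable:
  assumes "reach (geodesic x v) w a" "unit_tangent x v" "x \<in> I" "a < T"
    "\<And>t. a < t \<Longrightarrow> t \<le> T \<Longrightarrow> reflections w (geodesic x v t) \<in> I" "0 < \<epsilon>"
  shows "\<exists>\<delta>>0. \<forall>x' v'. unit_tangent x' v' \<longrightarrow> dist x' x + dist v' v < \<delta> \<longrightarrow>
    (\<exists>a'. flight (geodesic x' v') w a' T \<and> reflections w (geodesic x' v' T) \<in> I \<and>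
      (\<forall>t. 0 \<le> t \<longrightarrow> t \<le> T \<longrightarrow>
         dist (orbit (geodesic x' v') t) (orbit (geodesic x v) t) < \<epsilon>))"
  using assms(1,4-6)
proof (induction arbitrary: T \<epsilon> rule: reach.induct)
  case start
  let ?G = "geodesic x v"
  have I: "?G t \<in> I" if "0 \<le> t" "t \<le> T" for t
    using start(2)[of t] assms(3) that by (cases "t = 0") auto
  have "compact (?G ` {0..T})" by (intro compact_continuous_image continuous_intros compact_Icc)
  moreover have "?G ` {0..T} \<subseteq> I" using I by auto
  ultimately obtain r where
    r: "0 < r" "\<And>y z. y \<in> ?G ` {0..T} \<Longrightarrow> norm z = 1 \<Longrightarrow> dist z y < r \<Longrightarrow> z \<in> I"
    using I_compact_nbhd by metis
  show ?case
  proof (rule exI[of _ "min r \<epsilon>"], intro conjI allI impI)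
    show "0 < min r \<epsilon>" using r(1) start by simp
    fix x' v' assume ut: "unit_tangent x' v'" and d: "dist x' x + dist v' v < min r \<epsilon>"
    let ?G' = "geodesic x' v'"
    have dG: "dist (?G' t) (?G t) < min r \<epsilon>" for t
      using dist_geodesic_geodesic d by (rule le_less_trans)
    have I': "?G' t \<in> I" if "0 \<le> t" "t \<le> T" for t
      using r(2)[of "?G t" "?G' t"] dG[of t] ut that by simp
    then have fl': "flight ?G' [] 0 T" using start reach.start by (simp add: flight_def)
    have fl: "flight ?G [] 0 T" using start reach.start by (simp add: flight_def)
    show "\<exists>a'. flight ?G' [] a' T \<and> reflections [] (?G' T) \<in> I \<and>
      (\<forall>t. 0 \<le> t \<longrightarrow> t \<le> T \<longrightarrow> dist (orbit ?G' t) (orbit ?G t) < \<epsilon>)"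
      using fl' I' start dG orbit_eq[OF fl] orbit_eq[OF fl'] by (intro exI[of _ 0]) simp
  qed
next
  case (reflect w a b s)
  let ?G = "geodesic x v"
  have bT: "b < T" and I_T: "\<And>t. b < t \<Longrightarrow> t \<le> T \<Longrightarrow> reflections (s # w) (?G t) \<in> I"
    and \<epsilon>: "0 < \<epsilon>" using reflect.prems by blast+
  have reach_sw: "reach ?G (s # w) b" using reflect.hyps by (intro reach.reflect)
  have wS: "set w \<subseteq> S" "set (s # w) \<subseteq> S"
    using reach_set[OF reflect.hyps(1)] reach_set[OF reach_sw] .
  define p where "p = reflections w (?G b)"
  have p: "u = w \<or> u = s # w \<Longrightarrow> reflections u (?G b) = p" for u
    using reach_reflection_point(3)[OF reach_sw] by (auto simp: p_def)
  obtain \<nu> r where r: "0 < r" and \<nu>: "\<nu> = arc_normal s \<or> \<nu> = - arc_normal s" and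
    half: "\<And>y. norm y = 1 \<Longrightarrow> dist y p < r \<Longrightarrow> y \<in> I \<longleftrightarrow> 0 < \<nu> \<bullet> y" and
    side: "\<And>y. norm y = 1 \<Longrightarrow> dist y p < r \<Longrightarrow> \<nu> \<bullet> y = 0 \<Longrightarrow> y \<in> arc_points s - corners S"
    by (rule regular_side_point[OF reflect.hyps(4,5), folded p_def]) (rule that; assumption)
  have n: "norm (arc_normal s) = 1" using norm_arc_normal valid_arcs reflect.hyps by blast
  then have \<nu>1: "norm \<nu> = 1" using \<nu> by auto
  have flip: "\<nu> \<bullet> reflections (s # w) y = - (\<nu> \<bullet> reflections w y)" for y
    using \<nu> inner_reflection[OF n] by auto
  \<comment> \<open>Around the reflection both orbits stay within \<open>\<rho>\<close> of
    \<open>p\<close>, hence within \<open>\<epsilon>\<close> of each other.\<close>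
  define \<rho> where "\<rho> = min r (\<epsilon> / 2)"
  have \<rho>: "0 < \<rho>" "\<rho> \<le> r" "2 * \<rho> \<le> \<epsilon>" using r \<epsilon> by (auto simp: \<rho>_def)
  \<comment> \<open>Points near the reflection are at distance at most
    \<open>\<delta> + \<eta> \<le> 2 * \<eta>\<close> from \<open>p\<close>, and the window has
    length \<open>2 * \<eta>\<close>; the factor 4 keeps this below both \<open>\<rho>\<close> and
    \<open>pi\<close>.\<close>
  define \<eta> where "\<eta> = min (min (b - a) (T - b)) (min \<rho> pi) / 4"
  have \<eta>: "0 < \<eta>" "\<eta> < b - a" "\<eta> < T - b" "2 * \<eta> < \<rho>" "2 * \<eta> < pi"
    using \<rho> reflect.hyps(2) bT pi_gt_zero by (auto simp: \<eta>_def min_def)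
  have "\<And>t. a < t \<Longrightarrow> t \<le> b - \<eta> \<Longrightarrow> reflections w (?G t) \<in> I"
    using reflect.hyps(3) \<eta>(1) by simp
  then obtain \<delta>0 where \<delta>0: "0 < \<delta>0" and
    IH: "\<And>x' v'. unit_tangent x' v' \<Longrightarrow> dist x' x + dist v' v < \<delta>0 \<Longrightarrow>
    \<exists>a'. flight (geodesic x' v') w a' (b - \<eta>) \<and> reflections w (geodesic x' v' (b - \<eta>)) \<in> I \<and>
      (\<forall>t. 0 \<le> t \<longrightarrow> t \<le> b - \<eta> \<longrightarrow> dist (orbit (geodesic x' v') t) (orbit ?G t) < \<epsilon>)"
    using reflect.IH[of "b - \<eta>" \<epsilon>] \<eta>(2) \<epsilon> by auto
  have near: "dist (reflections u (geodesic x' v' t)) p \<le> dist x' x + dist v' v + \<bar>t - b\<bar>"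
    if "u = w \<or> u = s # w" for u x' v' t
  proof -
    have "dist (reflections u (geodesic x' v' t)) p = dist (geodesic x' v' t) (?G b)"
      using dist_reflections[of u "geodesic x' v' t" "?G b"] p[OF that] wS that by auto
    also have "\<dots> \<le> dist (geodesic x' v' t) (?G t) + dist (?G t) (?G b)"
      by (rule dist_triangle)
    also have "\<dots> \<le> dist x' x + dist v' v + \<bar>t - b\<bar>"
      using dist_geodesic_geodesic dist_geodesic[OF assms(2)] by (rule add_mono)
    finally show ?thesis .
  qed
  have norm1: "norm (reflections u (geodesic x' v' t)) = 1"
    if "u = w \<or> u = s # w" "unit_tangent x' v'" for u x' v' t
    using that wS reflections_geodesic unit_tangent_reflections by (metis norm_geodesic)
  \<comment> \<open>Heights over the mirror at both ends of the window, the second measured after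
    folding; a perturbation smaller than both keeps their signs.\<close>
  define c1 c2 where "c1 = \<nu> \<bullet> reflections w (?G (b - \<eta>))"
    and "c2 = \<nu> \<bullet> reflections (s # w) (?G (b + \<eta>))"
  have c1: "0 < c1"
    using half[OF norm1[of w]] near[of w x v "b - \<eta>"] reflect.hyps(3)[of "b - \<eta>"] \<eta> \<rho> assms(2)
    by (simp add: c1_def)
  have c2: "0 < c2"
    using half[OF norm1[of "s # w"]] near[of "s # w" x v "b + \<eta>"] I_T[of "b + \<eta>"] \<eta> \<rho> assms(2)
    by (simp add: c2_def del: reflections.simps)
  define K where "K = (\<lambda>t. reflections (s # w) (?G t)) ` {b + \<eta>..T}"
  have "compact K" unfolding K_def reflections_geodesic[OF wS(2)]
    by (intro compact_continuous_image continuous_intros compact_Icc)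
  moreover have "K \<subseteq> I" unfolding K_def using I_T \<eta>(1) by (auto simp del: reflections.simps)
  ultimately obtain r3 where
    r3: "0 < r3" "\<And>y z. y \<in> K \<Longrightarrow> norm z = 1 \<Longrightarrow> dist z y < r3 \<Longrightarrow> z \<in> I"
    using I_compact_nbhd by metis
  define \<delta> where "\<delta> = min (min \<delta>0 \<eta>) (min (min c1 c2) (min r3 \<epsilon>))"
  have \<delta>: "0 < \<delta>" "\<delta> \<le> \<delta>0" "\<delta> \<le> \<eta>" "\<delta> \<le> c1" "\<delta> \<le> c2" "\<delta> \<le> r3" "\<delta> \<le> \<epsilon>"
    using \<delta>0 \<eta> c1 c2 r3 \<epsilon> by (auto simp: \<delta>_def)
  show ?case
  proof (rule exI[of _ \<delta>], intro conjI allI impI)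
    show "0 < \<delta>" by fact
    fix x' v' assume ut: "unit_tangent x' v'" and d: "dist x' x + dist v' v < \<delta>"
    let ?G' = "geodesic x' v'"
    have dG: "dist (?G' t) (?G t) < \<delta>" for t
      using dist_geodesic_geodesic d by (rule le_less_trans)
    have d\<nu>: "\<bar>\<nu> \<bullet> reflections u (?G' t) - \<nu> \<bullet> reflections u (?G t)\<bar> < \<delta>"
      if "u = w \<or> u = s # w" for u t
    proof -
      have "\<bar>\<nu> \<bullet> reflections u (?G' t) - \<nu> \<bullet> reflections u (?G t)\<bar>
          \<le> dist (reflections u (?G' t)) (reflections u (?G t))"
        using Cauchy_Schwarz_ineq2[of \<nu> "reflections u (?G' t) - reflections u (?G t)"] \<nu>1
        by (simp add: inner_diff_right dist_norm)
      then show ?thesis using dG[of t] dist_reflections[of u] wS that by auto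
    qed
    obtain a' where a': "flight ?G' w a' (b - \<eta>)" "reflections w (?G' (b - \<eta>)) \<in> I"
      "\<And>t. 0 \<le> t \<Longrightarrow> t \<le> b - \<eta> \<Longrightarrow> dist (orbit ?G' t) (orbit ?G t) < \<epsilon>"
      using IH[OF ut] d \<delta>(2) by auto
    let ?f = "\<lambda>t. \<nu> \<bullet> reflections w (?G' t)"
    have f1: "0 < ?f (b - \<eta>)"
      using d\<nu>[of w "b - \<eta>"] \<delta>(4) by (simp add: c1_def)
    have f2: "?f (b + \<eta>) < 0"
      using d\<nu>[of "s # w" "b + \<eta>"] \<delta>(5) flip by (simp add: c2_def del: reflections.simps)
    have "continuous_on {b - \<eta>..b + \<eta>} ?f"
      unfolding reflections_geodesic[OF wS(1)] by (intro continuous_intros)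
    then obtain b' where b': "b - \<eta> \<le> b'" "b' \<le> b + \<eta>" "?f b' = 0"
      using IVT2'[of ?f "b + \<eta>" 0 "b - \<eta>"] f1 f2 \<eta>(1) by auto
    have b'2: "b - \<eta> < b'" "b' < b + \<eta>"
      using b' f1 f2 by (auto simp: less_le)
    \<comment> \<open>The sinusoid has no zero in the window other than \<open>b'\<close>, so the
      perturbed orbit meets the mirror exactly once there.\<close>
    obtain C where C: "\<And>t. ?f t = C * sin (t - b')"
      using inner_geodesic_zero[of \<nu> "reflections w x'" "reflections w v'" b'] b'(3)
      unfolding reflections_geodesic[OF wS(1)] by blast
    have "sin (b - \<eta> - b') < 0"
      using b'2 \<eta>(5) sin_gt_zero[of "b' - (b - \<eta>)"] sin_minus[of "b' - (b - \<eta>)"] by simp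
    then have "C < 0" using f1 C[of "b - \<eta>"] by (simp add: zero_less_mult_iff)
    have before: "0 < ?f t" if "b - \<eta> \<le> t" "t < b'" for t
    proof -
      have "sin (t - b') < 0"
        using that b'2 \<eta>(5) sin_gt_zero[of "b' - t"] sin_minus[of "b' - t"] by simp
      then show ?thesis using C \<open>C < 0\<close> by (simp add: mult_neg_neg)
    qed
    have after: "?f t < 0" if "b' < t" "t \<le> b + \<eta>" for t
    proof -
      have "0 < sin (t - b')" using that b'2 \<eta>(5) by (intro sin_gt_zero) auto
      then show ?thesis using C \<open>C < 0\<close> by (simp add: mult_neg_pos)
    qed
    have close: "dist (reflections u (?G' t)) p < \<rho>" "dist (reflections u (?G t)) p < \<rho>"
      if "u = w \<or> u = s # w" "b - \<eta> \<le> t" "t \<le> b + \<eta>" for u t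
    proof -
      have "\<bar>t - b\<bar> \<le> \<eta>" using that by auto
      then show "dist (reflections u (?G' t)) p < \<rho>" "dist (reflections u (?G t)) p < \<rho>"
        using near[OF that(1), of x' v' t] near[OF that(1), of x v t] d \<delta>(3) \<eta>(1,4) by simp_all
    qed
    have fl_w: "flight ?G' w a' b'"
      unfolding flight_def
    proof (intro conjI allI impI)
      show "reach ?G' w a'" "a' < b'" using a'(1) b'2 by (auto simp: flight_def)
      fix t assume t: "a' < t" "t < b'"
      show "reflections w (?G' t) \<in> I"
      proof (cases "t < b - \<eta>")
        case True
        then show ?thesis using a'(1) t by (auto simp: flight_def)
      next
        case False
        then show ?thesis
          using half[OF norm1[OF _ ut, of w t]] close(1)[of w t] before[of t] t b'2 \<rho>(2) by simp
      qed
    qed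
    have reach': "reach ?G' (s # w) b'"
      using fl_w reflect.hyps(4) side[OF norm1[OF _ ut, of w b']] close(1)[of w b'] b' \<rho>(2)
      by (intro reach.reflect[of ?G' w a']) (auto simp: flight_def)
    have last: "reflections (s # w) (?G' t) \<in> I" if "b + \<eta> \<le> t" "t \<le> T" for t
      using r3(2)[of "reflections (s # w) (?G t)" "reflections (s # w) (?G' t)"]
        norm1[OF _ ut, of "s # w" t] dG[of t] \<delta>(6) dist_reflections[OF wS(2)] that
      by (simp add: K_def del: reflections.simps)
    have fl_sw: "flight ?G' (s # w) b' T"
      unfolding flight_def
    proof (intro conjI allI impI)
      show "reach ?G' (s # w) b'" by fact
      show "b' < T" using b'2 \<eta> by simp
      fix t assume t: "b' < t" "t < T"
      show "reflections (s # w) (?G' t) \<in> I"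
      proof (cases "t < b + \<eta>")
        case True
        then have "0 < \<nu> \<bullet> reflections (s # w) (?G' t)"
          using after[of t] t flip by (simp del: reflections.simps)
        then show ?thesis
          using half[OF norm1[OF _ ut, of "s # w" t]] close(1)[of "s # w" t] True t b'2 \<rho>(2) by simp
      next
        case False
        then show ?thesis using last t by simp
      qed
    qed
    have flG: "flight ?G w a b" using reflect.hyps by (simp add: flight_def)
    have flG': "flight ?G (s # w) b T" using reach_sw bT I_T by (simp add: flight_def)
    have "dist (orbit ?G' t) (orbit ?G t) < \<epsilon>" if t: "0 \<le> t" "t \<le> T" for t
    proof -
      have a'b: "a' < b - \<eta>" using a'(1) by (simp add: flight_def)
      consider "t \<le> b - \<eta>" | "b - \<eta> \<le> t" "t \<le> b + \<eta>" | "b + \<eta> \<le> t" by linarith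
      then show ?thesis
      proof cases
        case 1
        then show ?thesis using a'(3) t by blast
      next
        \<comment> \<open>The two orbits may already have different codes here; both are compared
          with the reflection point \<open>p\<close>.\<close>
        case 2
        have "dist (orbit ?G' t) p < \<rho>"
          using orbit_eq[OF fl_w, of t] orbit_eq[OF fl_sw, of t] close(1)[OF _ 2] 2 a'b \<eta>
          by (cases "t \<le> b'") (auto simp del: reflections.simps)
        moreover have "dist (orbit ?G t) p < \<rho>"
          using orbit_eq[OF flG, of t] orbit_eq[OF flG', of t] close(2)[OF _ 2] 2 \<eta>
          by (cases "t \<le> b") (auto simp del: reflections.simps)
        ultimately show ?thesis
          using dist_triangle2[of "orbit ?G' t" "orbit ?G t" p] \<rho>(3) by linarith
      next
        case 3
        then have "dist (orbit ?G' t) (orbit ?G t) = dist (?G' t) (?G t)"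
          using orbit_eq[OF fl_sw, of t] orbit_eq[OF flG', of t] dist_reflections[OF wS(2)] t \<eta> b'2
          by (simp del: reflections.simps)
        then show ?thesis using dG[of t] \<delta>(7) by simp
      qed
    qed
    then show "\<exists>a'. flight ?G' (s # w) a' T \<and> reflections (s # w) (?G' T) \<in> I \<and>
      (\<forall>t. 0 \<le> t \<longrightarrow> t \<le> T \<longrightarrow> dist (orbit ?G' t) (orbit ?G t) < \<epsilon>)"
      using fl_sw last[of T] \<eta> by (intro exI[of _ b']) simp
  qed
qed

end

section \<open>Regular orbits and singular directions\<close>

lemma geodesic_velocity_shift:
  "geodesic_velocity x v t = geodesic_velocity (geodesic x v a) (geodesic_velocity x v a) (t - a)"
proof -
  have c: "cos t = cos (t - a) * cos a - sin (t - a) * sin a"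
    using cos_add[of "t - a" a] by simp
  have s: "sin t = sin (t - a) * cos a + cos (t - a) * sin a"
    using sin_add[of "t - a" a] by simp
  show ?thesis
    by (simp add: geodesic_def geodesic_velocity_def c s algebra_simps)
qed

lemma step_interval:
  fixes \<tau> :: "nat \<Rightarrow> real"
  assumes "\<tau> 0 \<le> t" "t \<le> \<tau> (Suc n)"
  shows "\<exists>i\<le>n. \<tau> i \<le> t \<and> t \<le> \<tau> (Suc i)"
  using assms
proof (induction n)
  case (Suc n)
  then show ?case by (cases "t \<le> \<tau> (Suc n)") (auto intro: le_SucI)
qed auto

context polygon
begin

text \<open>The leg data \<open>x i\<close>, \<open>v i\<close> are the position and velocity of one
  great circle folded by the first \<open>i\<close> reflections; the shifts of
  \<open>geodesic\<close> and \<open>geodesic_velocity\<close> carry this over each mirror.\<close>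

lemma billiard_orbit_imp_flight:
  assumes "billiard_orbit P S z u l \<gamma>"
  shows "\<exists>w a. flight (geodesic z u) w a l" "\<forall>t\<in>{0..l}. \<gamma> t = orbit (geodesic z u) t"
proof -
  let ?G = "geodesic z u"
  obtain n \<tau> x v where b: "\<tau> 0 = 0" "\<tau> (Suc n) = l" "\<And>i. i \<le> n \<Longrightarrow> \<tau> i < \<tau> (Suc i)" "x 0 = z" "v 0 = u"
    and seg: "\<And>i t. i \<le> n \<Longrightarrow> \<tau> i \<le> t \<Longrightarrow> t \<le> \<tau> (Suc i) \<Longrightarrow> \<gamma> t = geodesic (x i) (v i) (t - \<tau> i)"
    and int: "\<And>i t. i \<le> n \<Longrightarrow> \<tau> i < t \<Longrightarrow> t < \<tau> (Suc i) \<Longrightarrow> \<gamma> t \<in> I"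
    and refl: "\<And>i. i < n \<Longrightarrow> \<exists>s\<in>S. x (Suc i) \<in> arc_points s - corners S \<and>
                v (Suc i) = reflection (arc_normal s)
                  (geodesic_velocity (x i) (v i) (\<tau> (Suc i) - \<tau> i))"
    using assms unfolding billiard_orbit_def by (smt (verit) atLeastAtMost_iff greaterThanLessThan_iff)
  have *: "\<exists>w. flight ?G w (\<tau> i) (\<tau> (Suc i)) \<and> x i = reflections w (?G (\<tau> i)) \<and>
      v i = reflections w (geodesic_velocity z u (\<tau> i))" if "i \<le> n" for i
    using that
  proof (induction i)
    case 0
    have "\<gamma> t = ?G t" if "0 \<le> t" "t \<le> \<tau> 1" for t using seg[of 0 t] b that by simp
    then have "flight ?G [] 0 (\<tau> 1)"
      using int[of 0] b(1) b(3)[of 0] reach.start by (force simp: flight_def)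
    then show ?case using b by (intro exI[of _ "[]"]) (simp add: geodesic_velocity_def)
  next
    case (Suc i)
    then obtain w where w: "flight ?G w (\<tau> i) (\<tau> (Suc i))" "x i = reflections w (?G (\<tau> i))"
      "v i = reflections w (geodesic_velocity z u (\<tau> i))" by auto
    have wS: "set w \<subseteq> S" using w(1) reach_set by (auto simp: flight_def)
    then have lin: "linear (reflections w)"
      using orthogonal_transformation_linear orthogonal_transformation_reflections by blast
    have g: "geodesic (x i) (v i) (t - \<tau> i) = reflections w (?G t)" for t
      using linear_geodesic[OF lin] geodesic_shift[of z u t "\<tau> i"] by (simp add: w)
    have g': "geodesic_velocity (x i) (v i) (t - \<tau> i) = reflections w (geodesic_velocity z u t)" for t
      using linear_geodesic_velocity[OF lin] geodesic_velocity_shift[of z u t "\<tau> i"] by (simp add: w)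
    obtain s where s: "s \<in> S" "x (Suc i) \<in> arc_points s - corners S"
      "v (Suc i) = reflection (arc_normal s) (geodesic_velocity (x i) (v i) (\<tau> (Suc i) - \<tau> i))"
      using refl[of i] Suc.prems by auto
    have "x (Suc i) = \<gamma> (\<tau> (Suc i))" using seg[of "Suc i" "\<tau> (Suc i)"] b(3)[of "Suc i"] Suc.prems by simp
    also have "\<dots> = reflections w (?G (\<tau> (Suc i)))"
      using seg[of i "\<tau> (Suc i)"] b(3)[of i] Suc.prems g by simp
    finally have x: "x (Suc i) = reflections w (?G (\<tau> (Suc i)))" .
    have reach: "reach ?G (s # w) (\<tau> (Suc i))"
      using w(1) s x by (intro reach.reflect[of ?G w "\<tau> i"]) (auto simp: flight_def)
    have x2: "x (Suc i) = reflections (s # w) (?G (\<tau> (Suc i)))"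
      using x reach_reflection_point(3)[OF reach] by simp
    have v2: "v (Suc i) = reflections (s # w) (geodesic_velocity z u (\<tau> (Suc i)))"
      using s(3) g' by simp
    have lin2: "linear (reflections (s # w))"
      using orthogonal_transformation_linear reach_orthogonal[OF reach] by blast
    have "reflections (s # w) (?G t) \<in> I" if "\<tau> (Suc i) < t" "t < \<tau> (Suc (Suc i))" for t
    proof -
      have "\<gamma> t = reflections (s # w) (?G t)"
        using seg[of "Suc i" t] that Suc.prems linear_geodesic[OF lin2]
          geodesic_shift[of z u t "\<tau> (Suc i)"] x2 v2 by simp
      then show ?thesis using int[of "Suc i" t] that Suc.prems by simp
    qed
    then show ?case using reach x2 v2 b(3)[OF Suc.prems] unfolding flight_def by blast
  qed
  show "\<exists>w a. flight ?G w a l" using *[of n] b(2) by auto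
  show "\<forall>t\<in>{0..l}. \<gamma> t = orbit ?G t"
  proof
    fix t assume "t \<in> {0..l}"
    then obtain i where i: "i \<le> n" "\<tau> i \<le> t" "t \<le> \<tau> (Suc i)"
      using step_interval[of \<tau> t n] b(1,2) by auto
    obtain w where w: "flight ?G w (\<tau> i) (\<tau> (Suc i))" "x i = reflections w (?G (\<tau> i))"
      "v i = reflections w (geodesic_velocity z u (\<tau> i))" using *[OF i(1)] by blast
    have "linear (reflections w)"
      using w(1) orthogonal_transformation_linear reach_orthogonal by (auto simp: flight_def)
    then have "\<gamma> t = reflections w (?G t)"
      using seg[OF i] linear_geodesic geodesic_shift[of z u t "\<tau> i"] w by simp
    then show "\<gamma> t = orbit ?G t" using orbit_eq[OF w(1) i(2,3)] by simp
  qed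
qed

text \<open>Turns the inductive derivation into the sequences of codes and times that
  \<open>billiard_orbit\<close> asks for.\<close>

lemma reach_history:
  assumes "reach G w a"
  shows "\<exists>n \<tau> c. c 0 = [] \<and> \<tau> 0 = 0 \<and> c n = w \<and> \<tau> n = a \<and>
    (\<forall>i<n. flight G (c i) (\<tau> i) (\<tau> (Suc i)) \<and> (\<exists>s. c (Suc i) = s # c i \<and> reach G (s # c i) (\<tau> (Suc i))))"
  using assms
proof (induction rule: reach.induct)
  case start
  show ?case by (rule exI[of _ 0], rule exI[of _ "\<lambda>_. 0"], rule exI[of _ "\<lambda>_. []"]) simp
next
  case (reflect w a b s)
  then obtain n \<tau> c where h: "c 0 = []" "\<tau> 0 = 0" "c n = w" "\<tau> n = a"
    "\<And>i. i < n \<Longrightarrow> flight G (c i) (\<tau> i) (\<tau> (Suc i)) \<and>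
       (\<exists>s. c (Suc i) = s # c i \<and> reach G (s # c i) (\<tau> (Suc i)))" by blast
  have "flight G w a b" "reach G (s # w) b"
    using reflect.hyps reach.reflect by (auto simp: flight_def)
  then show ?case
    using h by (intro exI[of _ "Suc n"] exI[of _ "\<tau>(Suc n := b)"] exI[of _ "c(Suc n := s # w)"])
      (auto simp: less_Suc_eq)
qed

lemma flight_imp_billiard_orbit:
  assumes "flight (geodesic z u) w a l"
  shows "billiard_orbit P S z u l (orbit (geodesic z u))"
proof -
  let ?G = "geodesic z u"
  obtain n \<tau>0 c where h: "c 0 = []" "\<tau>0 0 = 0" "c n = w" "\<tau>0 n = a"
    "\<And>i. i < n \<Longrightarrow> flight ?G (c i) (\<tau>0 i) (\<tau>0 (Suc i)) \<and>
       (\<exists>s. c (Suc i) = s # c i \<and> reach ?G (s # c i) (\<tau>0 (Suc i)))"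
    using reach_history[of ?G w a] assms unfolding flight_def by blast
  define \<tau> where "\<tau> = \<tau>0(Suc n := l)"
  have fl: "flight ?G (c i) (\<tau> i) (\<tau> (Suc i))" if "i \<le> n" for i
    using h assms that by (cases "i = n") (auto simp: \<tau>_def)
  define x v where "x i = reflections (c i) (?G (\<tau> i))"
    and "v i = reflections (c i) (geodesic_velocity z u (\<tau> i))" for i
  have lin: "linear (reflections (c i))" if "i \<le> n" for i
    using fl[OF that] orthogonal_transformation_linear reach_orthogonal by (auto simp: flight_def)
  have g: "geodesic (x i) (v i) (t - \<tau> i) = reflections (c i) (?G t)"
    "geodesic_velocity (x i) (v i) (t - \<tau> i) = reflections (c i) (geodesic_velocity z u t)"
    if "i \<le> n" for i t
    using linear_geodesic[OF lin[OF that]] geodesic_shift[of z u t "\<tau> i"]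
      linear_geodesic_velocity[OF lin[OF that]] geodesic_velocity_shift[of z u t "\<tau> i"]
    by (simp_all add: x_def v_def)
  have "(\<forall>t\<in>{\<tau> i..\<tau> (Suc i)}. orbit ?G t = geodesic (x i) (v i) (t - \<tau> i)) \<and>
        (\<forall>t\<in>{\<tau> i<..<\<tau> (Suc i)}. orbit ?G t \<in> I)" if "i \<le> n" for i
    using fl[OF that] orbit_eq[OF fl[OF that]] g[OF that] by (auto simp: flight_def)
  moreover have "\<exists>s\<in>S. x (Suc i) \<in> arc_points s - corners S \<and> v (Suc i) =
     reflection (arc_normal s) (geodesic_velocity (x i) (v i) (\<tau> (Suc i) - \<tau> i))" if i: "i < n" for i
  proof -
    obtain s where s: "c (Suc i) = s # c i" "reach ?G (s # c i) (\<tau> (Suc i))"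
      using h(5)[OF i] i by (auto simp: \<tau>_def)
    then show ?thesis
      using reach_reflection_point[OF s(2)] g(2)[of i "\<tau> (Suc i)"] i
      by (intro bexI[of _ s]) (simp_all add: x_def v_def)
  qed
  moreover have "\<tau> 0 = 0" "\<tau> (Suc n) = l" "\<forall>i\<le>n. \<tau> i < \<tau> (Suc i)" "x 0 = z" "v 0 = u"
    using h fl by (auto simp: \<tau>_def x_def v_def flight_def geodesic_velocity_def)
  ultimately show ?thesis unfolding billiard_orbit_def by blast
qed

lemma corners_not_I: "p \<in> corners S \<Longrightarrow> p \<notin> I"
proof -
  assume "p \<in> corners S"
  then obtain s where s: "s \<in> S" "p \<in> arc_ends s" by (auto simp: corners_def)
  have "geodesic (arc_start s) (arc_dir s) t \<in> arc_points s" if "0 \<le> t" "t \<le> arc_length s" for t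
    using that by (auto simp: arc_points_def)
  from this[of 0] this[of "arc_length s"] have "p \<in> arc_points s"
    using s valid_arcs[OF s(1)] by (auto simp: arc_ends_def valid_arc_def split: if_splits)
  then show ?thesis using s not_I_side by blast
qed

lemma inward_directions_I:
  assumes "z \<in> I"
  shows "inward_directions P z = {u. unit_tangent z u}"
proof -
  have "\<exists>\<delta>>0. \<forall>t\<in>{0<..<\<delta>}. geodesic z u t \<in> I" if "unit_tangent z u" for u
  proof -
    obtain r where r: "0 < r" "\<And>y. norm y = 1 \<Longrightarrow> dist y z < r \<Longrightarrow> y \<in> I"
      using I_ball[OF assms] by blast
    have "geodesic z u t \<in> I" if "0 < t" "t < r" for t
      using that dist_geodesic[OF \<open>unit_tangent z u\<close>, of t 0] \<open>unit_tangent z u\<close> by (intro r(2)) auto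
    then show ?thesis using r(1) by (intro exI[of _ r]) auto
  qed
  then show ?thesis
    using norm_I[OF assms] unfolding inward_directions_def unit_tangent_def by blast
qed

definition singular_directions :: "real^3 \<Rightarrow> real \<Rightarrow> (real^3) set" where
  "singular_directions z l = {u. unit_tangent z u \<and>
     (\<exists>w a T. flight (geodesic z u) w a T \<and> T \<le> l \<and> reflections w (geodesic z u T) \<in> corners S)}"

text \<open>A singular direction would bring \<open>\<gamma>\<close> itself to a corner, since
  \<open>\<gamma>\<close> follows the folded great circle up to the hit.\<close>

lemma regular_orbitsE:
  assumes "\<gamma> \<in> regular_orbits P S z l" "z \<in> I"
  obtains u where "unit_tangent z u" "u \<notin> singular_directions z l"
    "\<And>t. 0 \<le> t \<Longrightarrow> t \<le> l \<Longrightarrow> \<gamma> t = orbit (geodesic z u) t"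
proof -
  obtain u where u: "unit_tangent z u" "billiard_orbit P S z u l \<gamma>"
    using assms inward_directions_I by (auto simp: regular_orbits_def)
  have eq: "\<gamma> t = orbit (geodesic z u) t" if "0 \<le> t" "t \<le> l" for t
    using billiard_orbit_imp_flight(2)[OF u(2)] that by simp
  have "u \<notin> singular_directions z l"
  proof
    assume "u \<in> singular_directions z l"
    then obtain w a T where T: "flight (geodesic z u) w a T" "T \<le> l"
      "reflections w (geodesic z u T) \<in> corners S" by (auto simp: singular_directions_def)
    have "0 \<le> T" "a \<le> T" using T(1) reach_nonneg by (force simp: flight_def)+
    then have "\<gamma> T \<in> corners S" using eq[of T] orbit_eq[OF T(1), of T] T by simp
    moreover have "\<gamma> T \<in> \<gamma> ` {0..l}" using \<open>0 \<le> T\<close> T(2) by simp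
    ultimately show False using assms(1) by (auto simp: regular_orbits_def)
  qed
  then show thesis using that u(1) eq by blast
qed

lemma regular_flight:
  assumes "z \<in> I" "0 < l" "unit_tangent z u" "u \<notin> singular_directions z l"
  obtains w a T where "flight (geodesic z u) w a T" "l < T"
  using assms flight_or_corner[of z u l] unfolding singular_directions_def by blast

lemma regular_orbitsI:
  assumes "z \<in> I" "0 < l" "unit_tangent z u" "u \<notin> singular_directions z l"
  shows "orbit (geodesic z u) \<in> regular_orbits P S z l"
proof -
  obtain w a T where T: "flight (geodesic z u) w a T" "l < T" using regular_flight[OF assms] .
  obtain w' a' where "flight (geodesic z u) w' a' l"
    using flight_earlier[OF T(1) assms(2)] T(2) by auto
  then have "billiard_orbit P S z u l (orbit (geodesic z u))" by (rule flight_imp_billiard_orbit)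
  moreover have "orbit (geodesic z u) t \<notin> corners S" if t: "0 \<le> t" "t \<le> l" for t
  proof (cases "t = 0")
    case True
    obtain T' where "flight (geodesic z u) [] 0 T'"
      using reach_leaves[OF reach.start assms(3,1)] .
    then have "orbit (geodesic z u) t = z" using orbit_eq[of _ "[]" 0 T' t] True
      by (simp add: flight_def)
    then show ?thesis using corners_not_I assms(1) by auto
  next
    case False
    then obtain w' a' where w': "flight (geodesic z u) w' a' t"
      using flight_earlier[OF T(1), of t] T(2) t by force
    then have "orbit (geodesic z u) t = reflections w' (geodesic z u t)"
      using orbit_eq[OF w', of t] by (simp add: flight_def)
    then show ?thesis using w' assms(3,4) t(2) by (auto simp: singular_directions_def)
  qed
  ultimately show ?thesis
    using assms(1,3) inward_directions_I by (auto simp: regular_orbits_def)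
qed

section \<open>Continuity in time and direction\<close>

lemma dist_orbit_flight:
  assumes "unit_tangent z u" "flight (geodesic z u) w a b" "a \<le> s" "s \<le> b" "a \<le> t" "t \<le> b"
  shows "dist (orbit (geodesic z u) s) (orbit (geodesic z u) t) \<le> \<bar>s - t\<bar>"
proof -
  have "set w \<subseteq> S" using assms(2) reach_set by (auto simp: flight_def)
  then show ?thesis
    using orbit_eq[OF assms(2)] dist_reflections dist_geodesic[OF assms(1)] assms(3-) by simp
qed

lemma dist_orbit_reach:
  assumes "reach (geodesic z u) w a" "unit_tangent z u" "0 \<le> s" "s \<le> t" "t \<le> a"
  shows "dist (orbit (geodesic z u) s) (orbit (geodesic z u) t) \<le> t - s"
  using assms(1,3-)
proof (induction arbitrary: s t rule: reach.induct)
  case start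
  then have "s = t" by simp
  then show ?case by simp
next
  case (reflect w a b c)
  have fl: "flight (geodesic z u) w a b" using reflect.hyps by (simp add: flight_def)
  consider "t \<le> a" | "a \<le> s" | "s \<le> a" "a \<le> t" by linarith
  then show ?case
  proof cases
    case 1
    then show ?thesis using reflect by blast
  next
    case 2
    then show ?thesis using dist_orbit_flight[OF assms(2) fl, of s t] reflect.prems by simp
  next
    case 3
    then show ?thesis
      using dist_orbit_flight[OF assms(2) fl, of a t] reflect.prems reflect.IH[of s a]
        dist_triangle[of "orbit (geodesic z u) s" "orbit (geodesic z u) t" "orbit (geodesic z u) a"]
      by simp
  qed
qed

text \<open>Folding preserves unit speed, and the triangle inequality glues the legs, so the orbit
  is 1-Lipschitz.\<close>

lemma continuous_on_orbit:
  assumes "unit_tangent z u" "flight (geodesic z u) w a T" 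
  shows "continuous_on {0..T} (orbit (geodesic z u))"
proof -
  let ?O = "orbit (geodesic z u)"
  have a: "reach (geodesic z u) w a" "a < T" "0 \<le> a"
    using assms(2) reach_nonneg by (auto simp: flight_def)
  have *: "dist (?O s) (?O t) \<le> t - s" if "0 \<le> s" "s \<le> t" "t \<le> T" for s t
  proof -
    consider "t \<le> a" | "a \<le> s" | "s \<le> a" "a \<le> t" by linarith
    then show ?thesis
    proof cases
      case 1
      then show ?thesis using dist_orbit_reach[OF a(1) assms(1)] that by simp
    next
      case 2
      then show ?thesis using dist_orbit_flight[OF assms, of s t] that by simp
    next
      case 3
      then show ?thesis
        using dist_orbit_flight[OF assms, of a t] dist_orbit_reach[OF a(1) assms(1), of s a] that
          dist_triangle[of "?O s" "?O t" "?O a"] by simp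
    qed
  qed
  have "dist (?O s) (?O t) \<le> 1 * dist s t" if "s \<in> {0..T}" "t \<in> {0..T}" for s t
    using that *[of s t] *[of t s] dist_commute[of "?O s" "?O t"]
    by (cases "s \<le> t") (simp_all add: dist_real_def)
  then have "1-lipschitz_on {0..T} ?O" by (intro lipschitz_onI) auto
  then show ?thesis by (rule lipschitz_on_continuous_on)
qed

text \<open>Stability gives closeness in the direction uniformly in time; together with continuity
  in time of one orbit this gives joint continuity.\<close>

lemma continuous_on_orbit_family:
  fixes A :: "real set"
  assumes "z \<in> I" "0 < l" "continuous_on A U"
    and U: "\<And>s. s \<in> A \<Longrightarrow> unit_tangent z (U s) \<and> U s \<notin> singular_directions z l"
  shows "continuous_on (A \<times> {0..l}) (\<lambda>(s, t). orbit (geodesic z (U s)) t)"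
  unfolding continuous_on_iff
proof (intro ballI allI impI)
  fix q and e :: real
  assume "q \<in> A \<times> {0..l}" and e: "0 < e"
  then obtain s0 t0 where q: "q = (s0, t0)" "s0 \<in> A" "0 \<le> t0" "t0 \<le> l" by auto
  let ?u = "U s0"
  have ut: "unit_tangent z ?u" "?u \<notin> singular_directions z l" using U q by auto
  obtain w a T1 where T1: "flight (geodesic z ?u) w a T1" "l < T1"
    using regular_flight[OF assms(1,2) ut] .
  \<comment> \<open>Strictly below \<open>T1\<close>, so that the orbit is in \<open>I\<close> at
    \<open>T\<close> too, and above \<open>a\<close>, both as \<open>flight_stable\<close>
    requires.\<close>
  define T where "T = (max l a + T1) / 2"
  have T: "a < T" "l < T" "T < T1" using T1 by (auto simp: T_def flight_def)
  have fl: "flight (geodesic z ?u) w a T" using flight_restrict[OF T1(1) T(1)] T by simp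
  obtain \<delta> where \<delta>: "0 < \<delta>" "\<And>x' v'. unit_tangent x' v' \<Longrightarrow> dist x' z + dist v' ?u < \<delta> \<Longrightarrow>
    (\<exists>a'. flight (geodesic x' v') w a' T \<and> reflections w (geodesic x' v' T) \<in> I \<and>
      (\<forall>t. 0 \<le> t \<longrightarrow> t \<le> T \<longrightarrow>
         dist (orbit (geodesic x' v') t) (orbit (geodesic z ?u) t) < e / 2))"
    using flight_stable[of z ?u w a T "e / 2"] T1(1) T ut(1) assms(1) e
    unfolding flight_def by auto
  obtain d1 where d1: "0 < d1" "\<And>s. s \<in> A \<Longrightarrow> dist s s0 < d1 \<Longrightarrow> dist (U s) ?u < \<delta>"
    using assms(3) q(2) \<delta>(1) unfolding continuous_on_iff by blast
  have "continuous_on {0..T} (orbit (geodesic z ?u))" using continuous_on_orbit[OF ut(1) fl] .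
  moreover have "t0 \<in> {0..T}" using q(3,4) T by simp
  ultimately obtain d2 where d2: "0 < d2"
    "\<And>t. t \<in> {0..T} \<Longrightarrow> dist t t0 < d2 \<Longrightarrow>
       dist (orbit (geodesic z ?u) t) (orbit (geodesic z ?u) t0) < e / 2"
    using half_gt_zero[OF e] unfolding continuous_on_iff by blast
  show "\<exists>d>0. \<forall>q'\<in>A \<times> {0..l}. dist q' q < d \<longrightarrow>
     dist (case q' of (s, t) \<Rightarrow> orbit (geodesic z (U s)) t) (case q of (s, t) \<Rightarrow> orbit (geodesic z (U s)) t) < e"
  proof (intro exI[of _ "min d1 d2"] conjI ballI impI)
    show "0 < min d1 d2" using d1 d2 by simp
    fix q' assume "q' \<in> A \<times> {0..l}" and d: "dist q' q < min d1 d2"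
    then obtain s t where q': "q' = (s, t)" "s \<in> A" "0 \<le> t" "t \<le> l" by auto
    have ds: "dist s s0 < d1" "dist t t0 < d2"
      using d dist_fst_le[of q' q] dist_snd_le[of q' q] by (auto simp: q q')
    have "dist (orbit (geodesic z (U s)) t) (orbit (geodesic z ?u) t) < e / 2"
      using \<delta>(2)[of z "U s"] U[OF q'(2)] d1(2)[OF q'(2) ds(1)] q' T by auto
    moreover have "dist (orbit (geodesic z ?u) t) (orbit (geodesic z ?u) t0) < e / 2"
      using d2(2)[of t] ds q' T by simp
    ultimately show "dist (case q' of (s, t) \<Rightarrow> orbit (geodesic z (U s)) t)
        (case q of (s, t) \<Rightarrow> orbit (geodesic z (U s)) t) < e"
      using dist_triangle[of "orbit (geodesic z (U s)) t" "orbit (geodesic z ?u) t0" "orbit (geodesic z ?u) t"]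
      unfolding q q' prod.case by linarith
  qed
qed

end

section \<open>Homotopy classes\<close>

lemma homotopic_orbits_sym:
  assumes "(\<gamma>, \<gamma>') \<in> homotopic_orbits P S z l"
  shows "(\<gamma>', \<gamma>) \<in> homotopic_orbits P S z l"
proof -
  obtain H where H: "continuous_on ({0..1} \<times> {0..l}) (\<lambda>(s, t). H s t)"
    "\<And>s. s \<in> {0..1} \<Longrightarrow> H s \<in> regular_orbits P S z l" "H 0 = \<gamma>" "H (1::real) = \<gamma>'"
    using assms by (auto simp: homotopic_orbits_def)
  have "continuous_on ({0..1} \<times> {0..l}) ((\<lambda>(s, t). H s t) \<circ> (\<lambda>q. (1 - fst q, snd q)))"
    by (intro continuous_on_compose continuous_intros continuous_on_subset[OF H(1)]) auto
  then have "continuous_on ({0..1} \<times> {0..l}) (\<lambda>(s, t). H (1 - s) t)"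
    by (simp add: o_def case_prod_beta)
  then show ?thesis
    using H unfolding homotopic_orbits_def by (auto intro!: exI[of _ "\<lambda>s. H (1 - s)"])
qed

lemma homotopic_orbits_trans:
  assumes "(\<gamma>, \<gamma>') \<in> homotopic_orbits P S z l" "(\<gamma>', \<gamma>'') \<in> homotopic_orbits P S z l"
  shows "(\<gamma>, \<gamma>'') \<in> homotopic_orbits P S z l"
proof -
  obtain H where H: "continuous_on ({0..1} \<times> {0..l}) (\<lambda>(s, t). H s t)"
    "\<And>s. s \<in> {0..1} \<Longrightarrow> H s \<in> regular_orbits P S z l" "H 0 = \<gamma>" "H (1::real) = \<gamma>'"
    using assms(1) by (auto simp: homotopic_orbits_def)
  obtain K where K: "continuous_on ({0..1} \<times> {0..l}) (\<lambda>(s, t). K s t)"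
    "\<And>s. s \<in> {0..1} \<Longrightarrow> K s \<in> regular_orbits P S z l" "K 0 = \<gamma>'" "K (1::real) = \<gamma>''"
    using assms(2) by (auto simp: homotopic_orbits_def)
  define L where "L s = (if s \<le> 1 / 2 then H (2 * s) else K (2 * s - 1))" for s
  have "continuous_on ({0..1/2} \<times> {0..l}) ((\<lambda>(s, t). H s t) \<circ> (\<lambda>q. (2 * fst q, snd q)))"
    by (intro continuous_on_compose continuous_intros continuous_on_subset[OF H(1)]) auto
  then have c1: "continuous_on ({0..1/2} \<times> {0..l}) (\<lambda>q. L (fst q) (snd q))"
    by (rule continuous_on_eq) (auto simp: L_def)
  have "continuous_on ({1/2..1} \<times> {0..l}) ((\<lambda>(s, t). K s t) \<circ> (\<lambda>q. (2 * fst q - 1, snd q)))"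
    by (intro continuous_on_compose continuous_intros continuous_on_subset[OF K(1)]) auto
  then have c2: "continuous_on ({1/2..1} \<times> {0..l}) (\<lambda>q. L (fst q) (snd q))"
  proof (rule continuous_on_eq)
    fix q :: "real \<times> real" assume q: "q \<in> {1/2..1} \<times> {0..l}"
    show "((\<lambda>(s, t). K s t) \<circ> (\<lambda>q. (2 * fst q - 1, snd q))) q = L (fst q) (snd q)"
    proof (cases "fst q = 1 / 2")
      case True
      then obtain t where "q = (1 / 2, t)" by (cases q) auto
      then show ?thesis using H(4) K(3) by (simp add: L_def)
    next
      case False
      then show ?thesis using q by (auto simp: L_def)
    qed
  qed
  have "continuous_on ({0..1/2} \<times> {0..l} \<union> {1/2..1} \<times> {0..l}) (\<lambda>q. L (fst q) (snd q))"
    by (intro continuous_on_closed_Un c1 c2 closed_Times) auto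
  also have "{0..1/2} \<times> {0..l} \<union> {1/2..1} \<times> {0..l} = {0..1::real} \<times> {0..l}" by auto
  finally have "continuous_on ({0..1} \<times> {0..l}) (\<lambda>(s, t). L s t)" by (simp add: case_prod_beta)
  moreover have "L s \<in> regular_orbits P S z l" if "s \<in> {0..1}" for s
    using H(2)[of "2 * s"] K(2)[of "2 * s - 1"] that by (auto simp: L_def)
  moreover have "L 0 = \<gamma>" "L 1 = \<gamma>''" using H(3) K(4) by (auto simp: L_def)
  ultimately show ?thesis unfolding homotopic_orbits_def by blast
qed

text \<open>The directions at \<open>z\<close> form the great circle orthogonal to \<open>z\<close>,
  so \<open>geodesic e1 e2\<close> serves as an angular coordinate on them.\<close>

lemma tangent_frame:
  assumes "norm z = 1"
  obtains e1 e2 where "unit_tangent e1 e2"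
    "\<And>\<phi>. unit_tangent z (geodesic e1 e2 \<phi>)"
    "\<And>u. unit_tangent z u \<Longrightarrow> \<exists>\<phi>\<ge>0. \<phi> < 2 * pi \<and> u = geodesic e1 e2 \<phi>"
proof -
  obtain y :: "real^3" where "y \<noteq> 0" "orthogonal z y"
    using orthogonal_to_vector_exists[of z] by auto
  define e1 where "e1 = y /\<^sub>R norm y"
  have e1: "unit_tangent z e1"
    using assms \<open>y \<noteq> 0\<close> \<open>orthogonal z y\<close> by (simp add: e1_def unit_tangent_def orthogonal_def)
  define e2 where "e2 = cross3 z e1"
  have n: "z \<bullet> z = 1" "e1 \<bullet> e1 = 1" "e1 \<bullet> z = 0" "z \<bullet> e1 = 0"
    using e1 by (auto simp: unit_tangent_def norm_eq_1 inner_commute)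
  have e12: "unit_tangent e1 e2"
    using norm_cross3_unit_tangent[OF e1] e1 by (simp add: e2_def unit_tangent_def dot_cross_self)
  have "cross3 e1 e2 = z" unfolding e2_def Lagrange by (simp add: n)
  show thesis
  proof (rule that[OF e12])
    show "unit_tangent z (geodesic e1 e2 \<phi>)" for \<phi>
      using assms e12 n(4) by (simp add: unit_tangent_def[of z] inner_geodesic e2_def dot_cross_self)
    show "\<exists>\<phi>\<ge>0. \<phi> < 2 * pi \<and> u = geodesic e1 e2 \<phi>" if "unit_tangent z u" for u
      using great_circle_param[OF e12, of u] that \<open>cross3 e1 e2 = z\<close>
      by (metis unit_tangent_def inner_commute)
  qed
qed

context polygon
begin

lemma homotopic_if_no_singular:
  assumes z: "z \<in> I" "0 < l"
    and U: "\<And>\<psi>. unit_tangent z (geodesic e1 e2 \<psi>)" 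
    and no_singular: "\<And>\<psi>. \<phi> \<le> \<psi> \<Longrightarrow> \<psi> \<le> \<phi>' \<Longrightarrow> geodesic e1 e2 \<psi> \<notin> singular_directions z l"
    and "\<phi> \<le> \<phi>'"
    and \<gamma>: "\<gamma> \<in> regular_orbits P S z l" "\<gamma>' \<in> regular_orbits P S z l"
      "\<And>t. 0 \<le> t \<Longrightarrow> t \<le> l \<Longrightarrow> \<gamma> t = orbit (geodesic z (geodesic e1 e2 \<phi>)) t"
      "\<And>t. 0 \<le> t \<Longrightarrow> t \<le> l \<Longrightarrow> \<gamma>' t = orbit (geodesic z (geodesic e1 e2 \<phi>')) t"
  shows "(\<gamma>, \<gamma>') \<in> homotopic_orbits P S z l"
proof -
  define U where "U s = geodesic e1 e2 (\<phi> + s * (\<phi>' - \<phi>))" for s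
  \<comment> \<open>The ends have to be \<open>\<gamma>\<close> and \<open>\<gamma>'\<close> as
    functions, and these are known only on \<open>{0..l}\<close>.\<close>
  define H where "H s = (if s = 0 then \<gamma> else if s = 1 then \<gamma>' else orbit (geodesic z (U s)))" for s
  have U_reg: "unit_tangent z (U s) \<and> U s \<notin> singular_directions z l" if "s \<in> {0..1}" for s
  proof -
    have "s * (\<phi>' - \<phi>) \<le> 1 * (\<phi>' - \<phi>)"
      using that \<open>\<phi> \<le> \<phi>'\<close> by (intro mult_right_mono) auto
    moreover have "0 \<le> s * (\<phi>' - \<phi>)" using that \<open>\<phi> \<le> \<phi>'\<close> by simp
    ultimately show ?thesis using U no_singular by (simp add: U_def)
  qed
  have "continuous_on {0..1} U" unfolding U_def by (intro continuous_intros)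
  then have "continuous_on ({0..1} \<times> {0..l}) (\<lambda>(s, t). orbit (geodesic z (U s)) t)"
    by (rule continuous_on_orbit_family[OF z _ U_reg])
  then have "continuous_on ({0..1} \<times> {0..l}) (\<lambda>(s, t). H s t)"
    by (rule continuous_on_eq) (auto simp: H_def U_def \<gamma>)
  moreover have "H s \<in> regular_orbits P S z l" if "s \<in> {0..1}" for s
    using \<gamma>(1,2) regular_orbitsI[OF z] U_reg[OF that] by (simp add: H_def)
  moreover have "H 0 = \<gamma>" "H 1 = \<gamma>'" by (simp_all add: H_def)
  ultimately show ?thesis unfolding homotopic_orbits_def by blast
qed

text \<open>The singular angles cut \<open>[0, 2 * pi)\<close> into intervals whose directions are
  all homotopic. The intervals are not joined across angle 0, whence the summand 1.\<close>

lemma orbit_classes_bound: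
  assumes z: "z \<in> I" "0 < l" and fin: "finite (singular_directions z l)"
  shows "finite (orbit_classes P S z l)"
    and "position_complexity P S z l \<le> card (singular_directions z l) + 1"
proof -
  let ?R = "regular_orbits P S z l" and ?r = "homotopic_orbits P S z l"
  obtain e1 e2 where e: "unit_tangent e1 e2" "\<And>\<phi>. unit_tangent z (geodesic e1 e2 \<phi>)"
    "\<And>u. unit_tangent z u \<Longrightarrow> \<exists>\<phi>\<ge>0. \<phi> < 2 * pi \<and> u = geodesic e1 e2 \<phi>"
    using tangent_frame[OF norm_I[OF z(1)]] by blast
  let ?U = "geodesic e1 e2"
  define A where "A = {\<psi>. 0 \<le> \<psi> \<and> \<psi> < 2 * pi \<and> ?U \<psi> \<in> singular_directions z l}"
  have "inj_on ?U A"
  proof (rule inj_onI)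
    fix s t assume st: "s \<in> A" "t \<in> A" "?U s = ?U t"
    then obtain n :: int where n: "s = t + 2 * pi * n" using geodesic_inj[OF e(1)] by blast
    have "0 \<le> s" "s < 2 * pi" "0 \<le> t" "t < 2 * pi" using st by (auto simp: A_def)
    then have "2 * pi * n < 2 * pi * 1" "2 * pi * (-1) < 2 * pi * n"
      using n by linarith+
    moreover from this(2) have "0 < 2 * pi * (real_of_int n + 1)" by (simp add: algebra_simps)
    ultimately have "n < 1" "-1 < n" by (simp_all add: zero_less_mult_iff)
    then show "s = t" using n by simp
  qed
  moreover have UA: "?U ` A \<subseteq> singular_directions z l" by (auto simp: A_def)
  ultimately have A: "finite A" "card A \<le> card (singular_directions z l)"
    using fin inj_on_finite card_inj_on_le by blast+
  have "\<exists>\<phi>. 0 \<le> \<phi> \<and> \<phi> < 2 * pi \<and> ?U \<phi> \<notin> singular_directions z l \<and>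
      (\<forall>t. 0 \<le> t \<longrightarrow> t \<le> l \<longrightarrow> \<gamma> t = orbit (geodesic z (?U \<phi>)) t)" if \<gamma>: "\<gamma> \<in> ?R" for \<gamma>
  proof -
    obtain u where u: "unit_tangent z u" "u \<notin> singular_directions z l"
      "\<And>t. 0 \<le> t \<Longrightarrow> t \<le> l \<Longrightarrow> \<gamma> t = orbit (geodesic z u) t"
      using regular_orbitsE[OF \<gamma> z(1)] by blast
    then show ?thesis using e(3)[OF u(1)] by blast
  qed
  then obtain \<phi> where \<phi>: "\<And>\<gamma>. \<gamma> \<in> ?R \<Longrightarrow> 0 \<le> \<phi> \<gamma> \<and> \<phi> \<gamma> < 2 * pi \<and>
      ?U (\<phi> \<gamma>) \<notin> singular_directions z l \<and>
      (\<forall>t. 0 \<le> t \<longrightarrow> t \<le> l \<longrightarrow> \<gamma> t = orbit (geodesic z (?U (\<phi> \<gamma>))) t)"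
    by metis
  \<comment> \<open>Numbers the interval containing \<open>\<phi> \<gamma>\<close>: equal values
    mean that no singular angle separates two orbits.\<close>
  define \<kappa> where "\<kappa> \<gamma> = card {\<psi>\<in>A. \<psi> < \<phi> \<gamma>}" for \<gamma>
  have "\<kappa> \<gamma> \<le> card A" for \<gamma> using A(1) by (auto simp: \<kappa>_def intro: card_mono)
  then have \<kappa>: "\<kappa> \<gamma> \<le> card (singular_directions z l)" for \<gamma> using A(2) order_trans by blast
  have hom: "(\<gamma>, \<gamma>') \<in> ?r" if R: "\<gamma> \<in> ?R" "\<gamma>' \<in> ?R" and eq: "\<kappa> \<gamma> = \<kappa> \<gamma>'" and le: "\<phi> \<gamma> \<le> \<phi> \<gamma>'" for \<gamma> \<gamma>'
  proof (rule homotopic_if_no_singular[OF z e(2) _ le R])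
    have "{\<psi>\<in>A. \<psi> < \<phi> \<gamma>} = {\<psi>\<in>A. \<psi> < \<phi> \<gamma>'}"
      using A(1) le eq by (intro card_subset_eq) (auto simp: \<kappa>_def)
    then have notin: "\<psi> \<notin> A" if "\<phi> \<gamma> \<le> \<psi>" "\<psi> < \<phi> \<gamma>'" for \<psi>
      using that not_less by blast
    show "?U \<psi> \<notin> singular_directions z l" if "\<phi> \<gamma> \<le> \<psi>" "\<psi> \<le> \<phi> \<gamma>'" for \<psi>
    proof (cases "\<psi> = \<phi> \<gamma>'")
      case True
      then show ?thesis using \<phi>[OF R(2)] by blast
    next
      case False
      then have "\<psi> \<notin> A" "0 \<le> \<psi>" "\<psi> < 2 * pi"
        using notin[of \<psi>] that \<phi>[OF R(1)] \<phi>[OF R(2)] by linarith+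
      then show ?thesis by (simp add: A_def)
    qed
  qed (use \<phi>[OF R(1)] \<phi>[OF R(2)] in auto)
  have class_eq: "?r `` {\<gamma>} = ?r `` {\<gamma>'}" if "\<gamma> \<in> ?R" "\<gamma>' \<in> ?R" "\<kappa> \<gamma> = \<kappa> \<gamma>'" for \<gamma> \<gamma>'
  proof -
    have "(\<gamma>, \<gamma>') \<in> ?r" "(\<gamma>', \<gamma>) \<in> ?r"
      using hom[OF that] hom[OF that(2,1)] that(3) homotopic_orbits_sym linear by metis+
    then show ?thesis using homotopic_orbits_trans by blast
  qed
  \<comment> \<open>One representative for each value of \<open>\<kappa>\<close>; values that do not
    occur give some set that merely enlarges the image.\<close>
  let ?g = "\<lambda>k. ?r `` {SOME \<gamma>. \<gamma> \<in> ?R \<and> \<kappa> \<gamma> = k}"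
  have sub: "orbit_classes P S z l \<subseteq> ?g ` {..card (singular_directions z l)}"
  proof
    fix X assume "X \<in> orbit_classes P S z l"
    then obtain \<gamma> where \<gamma>: "\<gamma> \<in> ?R" "X = ?r `` {\<gamma>}" by (auto simp: orbit_classes_def quotient_def)
    define \<gamma>0 where "\<gamma>0 = (SOME \<gamma>'. \<gamma>' \<in> ?R \<and> \<kappa> \<gamma>' = \<kappa> \<gamma>)"
    have "\<gamma>0 \<in> ?R \<and> \<kappa> \<gamma>0 = \<kappa> \<gamma>"
      unfolding \<gamma>0_def by (rule someI[of _ \<gamma>]) (use \<gamma> in simp)
    then have "X = ?g (\<kappa> \<gamma>)"
      using class_eq[of \<gamma> \<gamma>0] \<gamma> unfolding \<gamma>0_def by simp
    then show "X \<in> ?g ` {..card (singular_directions z l)}" using \<kappa> by blast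
  qed
  then show "finite (orbit_classes P S z l)" by (rule finite_subset) simp
  have "card (orbit_classes P S z l) \<le> card {..card (singular_directions z l)}"
    by (rule surj_card_le[OF _ sub]) simp
  then show "position_complexity P S z l \<le> card (singular_directions z l) + 1"
    by (simp add: position_complexity_def)
qed

end

section \<open>Area on the sphere\<close>

lemma borel_sphere_sets:
  "A \<in> sets (restrict_space borel unit_sphere) \<longleftrightarrow> A \<in> sets borel \<and> A \<subseteq> unit_sphere"
  by (subst sets_restrict_space_iff) (auto simp: borel_closed)

lemma space_sphere_area: "space sphere_area = unit_sphere"
  by (simp add: sphere_area_def space_scale_measure space_restrict_space)

lemma sets_sphere_area: "sets sphere_area = sets (restrict_space borel unit_sphere)"
  by (simp add: sphere_area_def)

definition unit_cone :: "(real^3) set \<Rightarrow> (real^3) set" where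
  "unit_cone A = {y \<in> cball 0 1 - {0}. y /\<^sub>R norm y \<in> A}"

lemma emeasure_sphere_area_cone:
  assumes "A \<in> sets borel" "A \<subseteq> unit_sphere"
  shows "emeasure sphere_area A = 3 * emeasure lborel (unit_cone A)"
  unfolding unit_cone_def by (rule emeasure_sphere_area) (simp add: borel_sphere_sets assms)

lemma unit_cone_borel: "A \<in> sets borel \<Longrightarrow> unit_cone A \<in> sets borel"
proof -
  assume [measurable]: "A \<in> sets borel"
  have "unit_cone A = (cball 0 1 - {0}) \<inter> ((\<lambda>y. y /\<^sub>R norm y) -` A \<inter> space borel)"
    by (auto simp: unit_cone_def)
  also have "\<dots> \<in> sets borel"
    by (intro sets.Int measurable_sets[of _ borel borel]) auto
  finally show ?thesis .
qed

lemma emeasure_sphere_area_finite: "emeasure sphere_area unit_sphere < \<infinity>"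
proof -
  have "emeasure lborel (unit_cone unit_sphere) \<le> emeasure lborel (cball 0 1 :: (real^3) set)"
    by (rule emeasure_mono) (auto simp: unit_cone_def)
  also have "\<dots> < \<infinity>" using emeasure_lborel_cball_finite by auto
  finally show ?thesis
    by (subst emeasure_sphere_area_cone) (auto simp: borel_closed ennreal_mult_less_top)
qed

text \<open>An orthogonal map commutes with radial projection, so it carries cone to cone, and it
  preserves volume.\<close>

lemma emeasure_sphere_area_image:
  assumes f: "orthogonal_transformation (f :: real^3 \<Rightarrow> real^3)"
    and A: "A \<in> sets borel" "A \<subseteq> unit_sphere"
  shows "f ` A \<in> sets borel" "f ` A \<subseteq> unit_sphere"
    "emeasure sphere_area (f ` A) = emeasure sphere_area A"
proof -
  have inj: "inj f" and bij: "bij f"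
    using f orthogonal_transformation_inj orthogonal_transformation_bij by blast+
  have "continuous_on UNIV (inv f)"
    using orthogonal_transformation_inv[OF f] orthogonal_transformation_linear linear_continuous_on
      linear_conv_bounded_linear by blast
  then have "inv f \<in> borel_measurable borel" by (rule borel_measurable_continuous_onI)
  then have "inv f -` A \<inter> space borel \<in> sets borel" using A(1) by (rule measurable_sets)
  then show *: "f ` A \<in> sets borel" by (simp add: bij_vimage_eq_inv_image[OF bij_imp_bij_inv[OF bij]] inv_inv_eq bij)
  show **: "f ` A \<subseteq> unit_sphere" using A(2) orthogonal_transformation_norm[OF f] by auto
  have lin: "linear f" using f orthogonal_transformation_linear by blast
  have f_div: "f (y /\<^sub>R norm y) = f y /\<^sub>R norm (f y)" for y
    using lin orthogonal_transformation_norm[OF f] by (simp add: linear_scale)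
  have "unit_cone (f ` A) = f ` unit_cone A"
  proof (intro equalityI subsetI)
    fix x assume x: "x \<in> unit_cone (f ` A)"
    obtain y where y: "x = f y" using bij by (metis bij_pointE)
    have "f (y /\<^sub>R norm y) \<in> f ` A" using x by (simp add: unit_cone_def y f_div)
    then have "y /\<^sub>R norm y \<in> A" using inj by (simp add: inj_image_mem_iff)
    moreover have "norm y \<le> 1" "y \<noteq> 0"
      using x orthogonal_transformation_norm[OF f, of y] linear_0[OF lin] by (auto simp: unit_cone_def y)
    ultimately show "x \<in> f ` unit_cone A" by (auto simp: unit_cone_def y)
  next
    fix x assume "x \<in> f ` unit_cone A"
    then obtain y where y: "x = f y" "y \<in> unit_cone A" by auto
    have "norm x \<le> 1" "x \<noteq> 0"
      using y orthogonal_transformation_norm[OF f, of y] by (auto simp: unit_cone_def)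
    then show "x \<in> unit_cone (f ` A)" using y f_div[of y] by (force simp: unit_cone_def)
  qed
  moreover have "emeasure lborel (f ` unit_cone A) = emeasure lborel (unit_cone A)"
  proof -
    have b: "unit_cone A \<in> sets borel" "unit_cone (f ` A) \<in> sets borel" using unit_cone_borel A * by blast+
    have sub: "unit_cone B \<subseteq> cball 0 1" for B by (auto simp: unit_cone_def)
    have lm: "unit_cone B \<in> lmeasurable" if "unit_cone B \<in> sets borel" for B
      using that bounded_subset[OF bounded_cball sub] by (intro bounded_set_imp_lmeasurable) auto
    have "emeasure lborel (unit_cone B) = ennreal (measure lebesgue (unit_cone B))" if "unit_cone B \<in> sets borel" for B
      using emeasure_eq_measure2[OF lm[OF that]] that by simp
    then show ?thesis
      using measure_orthogonal_image[OF f lm[OF b(1)]] b \<open>unit_cone (f ` A) = f ` unit_cone A\<close> by metis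
  qed
  ultimately show "emeasure sphere_area (f ` A) = emeasure sphere_area A"
    using emeasure_sphere_area_cone[OF A] emeasure_sphere_area_cone[OF * **] by simp
qed

text \<open>The cone over a great circle lies in a plane, which has volume 0.\<close>

lemma AE_not_great_circle:
  assumes "n \<noteq> 0"
  shows "AE z in sphere_area. n \<bullet> z \<noteq> 0"
proof -
  let ?C = "{z \<in> unit_sphere. n \<bullet> z = 0}"
  have C: "?C = unit_sphere \<inter> {z. n \<bullet> z = 0}" by auto
  have b: "?C \<in> sets borel" "?C \<subseteq> unit_sphere"
    unfolding C by (auto intro!: borel_closed closed_Int closed_hyperplane)
  have H: "{y. n \<bullet> y = 0} \<in> null_sets lborel"
  proof -
    have "negligible {y. n \<bullet> y = 0}" using assms negligible_hyperplane by blast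
    moreover have "{y. n \<bullet> y = 0} \<in> sets borel" by (intro borel_closed closed_hyperplane)
    ultimately show ?thesis
      by (simp add: negligible_iff_null_sets null_sets_def)
  qed
  have "unit_cone ?C \<subseteq> {y. n \<bullet> y = 0}" by (auto simp: unit_cone_def)
  then have "emeasure lborel (unit_cone ?C) = 0"
    using H unit_cone_borel[OF b(1)] null_sets_subset[OF H, of "unit_cone ?C"] by auto
  then have "?C \<in> null_sets sphere_area"
    using emeasure_sphere_area_cone[OF b] b
    by (simp add: null_sets_def sets_sphere_area borel_sphere_sets)
  then show ?thesis
    by (rule AE_I') (auto simp: space_sphere_area)
qed

lemma AE_neq: "AE z in sphere_area. z \<noteq> y"
proof -
  obtain n :: "real^3" where "n \<noteq> 0" "orthogonal y n"
    using orthogonal_to_vector_exists[of y] by auto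
  show ?thesis
    using AE_not_great_circle[OF \<open>n \<noteq> 0\<close>]
    by eventually_elim (use \<open>orthogonal y n\<close> in \<open>auto simp: orthogonal_def inner_commute\<close>)
qed

section \<open>Counting hits of a corner\<close>

lemma cos_strip: "cos (real m * pi + \<theta>) = (-1) ^ m * cos \<theta>"
  and sin_strip: "sin (real m * pi + \<theta>) = (-1) ^ m * sin \<theta>"
  by (simp_all add: cos_add sin_add)

lemma strip_sin_nonzero:
  assumes "real m * pi < T" "T < (real m + 1) * pi"
  shows "sin T \<noteq> 0"
proof -
  have "0 < sin (T - real m * pi)" using assms by (intro sin_gt_zero) (auto simp: algebra_simps)
  then show ?thesis using sin_strip[of m "T - real m * pi"] by simp
qed

lemma strip_cos_inj:
  assumes "real m * pi < T" "T < (real m + 1) * pi" "real m * pi < T'" "T' < (real m + 1) * pi"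
    "cos T = cos T'"
  shows "T = T'"
proof -
  have "cos (T - real m * pi) = cos (T' - real m * pi)"
    using cos_strip[of m "T - real m * pi"] cos_strip[of m "T' - real m * pi"] assms(5) by simp
  then have "T - real m * pi = T' - real m * pi"
    by (rule cos_inj_pi[rotated 4]) (use assms in \<open>auto simp: algebra_simps\<close>)
  then show ?thesis by simp
qed

text \<open>The inner product of the end points is \<open>cos T\<close>, which determines
  \<open>T\<close> within an open strip; there \<open>sin T\<close> is nonzero, so the end point
  determines the direction.\<close>

lemma geodesic_endpoints_unique:
  assumes "unit_tangent x v" "unit_tangent x v'" "geodesic x v T = geodesic x v' T'"
    "real m * pi < T" "T < (real m + 1) * pi" "real m * pi < T'" "T' < (real m + 1) * pi"
  shows "T = T'" "v = v'"
proof -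
  have "x \<bullet> geodesic x v T = cos T" "x \<bullet> geodesic x v' T' = cos T'"
    using assms(1,2) by (auto simp: inner_geodesic unit_tangent_def norm_eq_1)
  then show "T = T'" using strip_cos_inj assms(3-) by metis
  then show "v = v'"
    using assms(3) strip_sin_nonzero[OF assms(4,5)] by (simp add: geodesic_def)
qed

context polygon
begin

text \<open>Read back from \<open>T\<close>, the last reflection is the latest time at which the
  common folded curve is outside \<open>I\<close>. Its side is unique, and undoing the reflection on
  both curves leaves the same situation with shorter codes.\<close>

lemma backward_deterministic:
  assumes "flight G w a T" "flight G' w' a' T" "\<And>t. reflections w (G t) = reflections w' (G' t)"
    "G 0 \<in> I" "G' 0 \<in> I"
  shows "w = w'"
  using assms
proof (induction w arbitrary: w' a a' T)
  case Nil
  have "a = 0" using Nil(1) by (auto simp: flight_def elim: reach.cases)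
  show ?case
  proof (cases w')
    case (Cons s v)
    have r: "reach G' (s # v) a'" "a' < T" using Nil(2) Cons by (auto simp: flight_def)
    have "reflections w' (G' a') \<in> I"
      using Nil(1) Nil(3)[of a'] reach_pos[OF r(1)] r(2) \<open>a = 0\<close> by (auto simp: flight_def)
    moreover have "reflections w' (G' a') \<notin> I"
      using reach_reflection_point[OF r(1)] not_I_side Cons by (metis DiffD1)
    ultimately show ?thesis by blast
  qed simp
next
  case (Cons s v)
  have r: "reach G (s # v) a" "a < T" using Cons.prems(1) by (auto simp: flight_def)
  have off: "reflections (s # v) (G a) \<notin> I"
    using reach_reflection_point[OF r(1)] not_I_side by (metis DiffD1)
  show ?case
  proof (cases w')
    case Nil
    then have "a' = 0" using Cons.prems(2) by (auto simp: flight_def elim: reach.cases)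
    then have "reflections w' (G' a) \<in> I"
      using Cons.prems(2) reach_pos[OF r(1)] r(2) by (auto simp: flight_def)
    then show ?thesis using off Cons.prems(3)[of a] by metis
  next
    case w': (Cons s' v')
    have r': "reach G' (s' # v') a'" "a' < T" using Cons.prems(2) w' by (auto simp: flight_def)
    have off': "reflections (s' # v') (G' a') \<notin> I"
      using reach_reflection_point[OF r'(1)] not_I_side by (metis DiffD1)
    have "a = a'"
    proof (rule ccontr)
      assume "a \<noteq> a'"
      then consider "a < a'" | "a' < a" by linarith
      then show False
      proof cases
        case 1
        then have "reflections (s # v) (G a') \<in> I" using Cons.prems(1) r' by (simp add: flight_def)
        then show False using off' Cons.prems(3)[of a'] w' by metis
      next
        case 2
        then have "reflections (s' # v') (G' a) \<in> I" using Cons.prems(2) r w' by (simp add: flight_def)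
        then show False using off Cons.prems(3)[of a] w' by metis
      qed
    qed
    have p: "reflections v (G a) = reflections v' (G' a)"
      using reach_reflection_point(3)[OF r(1)] reach_reflection_point(3)[OF r'(1)]
        Cons.prems(3)[of a] \<open>a = a'\<close> w' by metis
    have "s' = s"
      using side_unique[of s s' "reflections v (G a)"] reach_reflection_point(1,2)[OF r(1)]
        reach_reflection_point(1,2)[OF r'(1)] p \<open>a = a'\<close> by auto
    have n: "norm (arc_normal s) = 1"
      using norm_arc_normal valid_arcs reach_reflection_point(1)[OF r(1)] by blast
    have eq: "reflections v (G t) = reflections v' (G' t)" for t
      using Cons.prems(3)[of t] w' \<open>s' = s\<close> reflection_reflection[OF n] by (metis reflections.simps(2))
    obtain b where "flight G v b a"
      using r(1) by (cases rule: reach.cases) (auto simp: flight_def)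
    moreover obtain b' where "flight G' v' b' a"
      using r'(1) \<open>a = a'\<close> by (cases rule: reach.cases) (auto simp: flight_def)
    ultimately have "v = v'" using Cons.IH eq Cons.prems(4,5) by blast
    then show ?thesis using w' \<open>s' = s\<close> by simp
  qed
qed

section \<open>Starting points that hit a given corner\<close>

definition hitting :: "real^3 \<Rightarrow> nat \<Rightarrow> great_arc list \<Rightarrow> (real^3) set" where
  "hitting c m w = {z \<in> I. \<exists>u a T. unit_tangent z u \<and> real m * pi < T \<and> T < (real m + 1) * pi \<and>
     flight (geodesic z u) w a T \<and> reflections w (geodesic z u T) = c}"

lemma inj_reflections: "set w \<subseteq> S \<Longrightarrow> inj (reflections w)"
  using orthogonal_transformation_reflections orthogonal_transformation_inj by blast

lemma flight_set: "flight G w a T \<Longrightarrow> set w \<subseteq> S"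
  by (auto simp: flight_def dest: reach_set)

text \<open>A common image point and \<open>c\<close> are the end points of both folded great
  circles within one strip, so the two circles coincide and \<open>backward_deterministic\<close>
  applies.\<close>

lemma hitting_disjoint:
  assumes "w \<noteq> w'"
  shows "reflections w ` hitting c m w \<inter> reflections w' ` hitting c m w' = {}"
proof (rule ccontr)
  assume "\<not> ?thesis"
  then obtain z z' where z: "z \<in> hitting c m w" "z' \<in> hitting c m w'"
    "reflections w z = reflections w' z'" by auto
  obtain u a T where u: "unit_tangent z u" "real m * pi < T" "T < (real m + 1) * pi"
     "flight (geodesic z u) w a T" "reflections w (geodesic z u T) = c"
    using z(1) by (auto simp: hitting_def)
  obtain u' a' T' where u': "unit_tangent z' u'" "real m * pi < T'" "T' < (real m + 1) * pi"
     "flight (geodesic z' u') w' a' T'" "reflections w' (geodesic z' u' T') = c"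
    using z(2) by (auto simp: hitting_def)
  have S: "set w \<subseteq> S" "set w' \<subseteq> S" using u(4) u'(4) flight_set by blast+
  have ut: "unit_tangent (reflections w z) (reflections w u)"
    "unit_tangent (reflections w z) (reflections w' u')"
    using unit_tangent_reflections[OF S(1) u(1)] unit_tangent_reflections[OF S(2) u'(1)] z(3) by auto
  have "geodesic (reflections w z) (reflections w u) T = geodesic (reflections w z) (reflections w' u') T'"
    using u(5) u'(5) z(3) by (simp add: reflections_geodesic S)
  from geodesic_endpoints_unique[OF ut this u(2,3) u'(2,3)]
  have "T = T'" "reflections w u = reflections w' u'" by blast+
  then have "w = w'"
    using backward_deterministic[OF u(4), of "geodesic z' u'" w' a'] u'(4) z
    by (simp add: reflections_geodesic S hitting_def)
  then show False using assms by simp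
qed

text \<open>Hence counting the codes \<open>w\<close> with \<open>z\<close> in
  \<open>hitting c m w\<close> counts the hitting directions.\<close>

lemma hitting_direction_unique:
  assumes "unit_tangent z u" "real m * pi < T" "T < (real m + 1) * pi"
     "flight (geodesic z u) w a T" "reflections w (geodesic z u T) = c"
    "unit_tangent z u'" "real m * pi < T'" "T' < (real m + 1) * pi"
     "flight (geodesic z u') w a' T'" "reflections w (geodesic z u' T') = c"
  shows "u = u'"
proof -
  have "geodesic z u T = geodesic z u' T'"
    using inj_reflections[OF flight_set[OF assms(4)]] assms(5,10) by (metis injD)
  then show ?thesis using geodesic_endpoints_unique assms by blast
qed

text \<open>From \<open>z\<close> near \<open>z0\<close> one can aim at the same unfolded corner
  \<open>y\<close>, with time and direction continuous in \<open>z\<close>. Stability secures the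
  flight until shortly before the hit, and the conical structure at \<open>c\<close> the
  rest.\<close>

lemma openin_hitting: "openin (top_of_set unit_sphere) (hitting c m w)"
  unfolding openin_euclidean_subtopology_iff
proof (intro conjI ballI)
  show "hitting c m w \<subseteq> unit_sphere" using norm_I by (auto simp: hitting_def)
  fix z0 assume "z0 \<in> hitting c m w"
  then obtain u0 a0 T0 where z0: "z0 \<in> I" "unit_tangent z0 u0" "real m * pi < T0" "T0 < (real m + 1) * pi"
    "flight (geodesic z0 u0) w a0 T0" "reflections w (geodesic z0 u0 T0) = c"
    by (auto simp: hitting_def)
  have wS: "set w \<subseteq> S" using z0(5) flight_set by blast
  define y where "y = geodesic z0 u0 T0"
  have y: "norm y = 1" "reflections w y = c" using z0 by (simp_all add: y_def)
  define \<sigma> :: real where "\<sigma> = (-1) ^ m"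
  have \<sigma>: "\<sigma> * \<sigma> = 1" "\<bar>\<sigma>\<bar> = 1" by (simp_all add: \<sigma>_def power_abs flip: power_mult_distrib)
  \<comment> \<open>\<open>\<sigma>\<close> compensates the sign of \<open>cos\<close> on odd
    strips, so that \<open>\<T> z\<close> is the solution of \<open>cos T = z \<bullet> y\<close> in
    the strip.\<close>
  define \<theta> where "\<theta> z = arccos (\<sigma> * (z \<bullet> y))" for z
  define \<T> where "\<T> z = real m * pi + \<theta> z" for z
  \<comment> \<open>The component of \<open>y\<close> orthogonal to \<open>z\<close>, normalised; a
    negative sine on odd strips makes the direction point away from \<open>y\<close>, the long way
    round.\<close>
  define U where "U z = (1 / sin (\<T> z)) *\<^sub>R (y - (z \<bullet> y) *\<^sub>R z)" for z
  have aim: "unit_tangent z (U z)" "geodesic z (U z) (\<T> z) = y"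
      "real m * pi < \<T> z" "\<T> z < (real m + 1) * pi"
    if z: "norm z = 1" "\<bar>z \<bullet> y\<bar> < 1" for z
  proof -
    have k: "-1 < \<sigma> * (z \<bullet> y)" "\<sigma> * (z \<bullet> y) < 1"
      using z(2) \<sigma>(2) abs_mult[of \<sigma> "z \<bullet> y"] by auto
    then have \<theta>: "0 < \<theta> z" "\<theta> z < pi" "cos (\<theta> z) = \<sigma> * (z \<bullet> y)"
      using arccos_lt_bounded by (auto simp: \<theta>_def cos_arccos_abs)
    show st: "real m * pi < \<T> z" "\<T> z < (real m + 1) * pi"
      using \<theta> by (simp_all add: \<T>_def algebra_simps)
    have sin0: "sin (\<T> z) \<noteq> 0" using strip_sin_nonzero[OF st] .
    have cos: "cos (\<T> z) = z \<bullet> y"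
      using cos_strip[of m "\<theta> z"] \<theta>(3) \<sigma>(1) by (simp add: \<T>_def \<sigma>_def mult.assoc[symmetric])
    have sin2: "(sin (\<T> z))\<^sup>2 = 1 - (z \<bullet> y)\<^sup>2"
      using sin_squared_eq[of "\<T> z"] cos by simp
    have zz: "z \<bullet> z = 1" "y \<bullet> y = 1" using z y by (simp_all add: norm_eq_1)
    have dot: "(y - (z \<bullet> y) *\<^sub>R z) \<bullet> (y - (z \<bullet> y) *\<^sub>R z) = (sin (\<T> z))\<^sup>2"
      using zz unfolding sin2
      by (simp add: inner_diff_left inner_diff_right inner_commute power2_eq_square algebra_simps)
    have "U z \<bullet> U z = 1"
      unfolding U_def inner_scaleR_left inner_scaleR_right dot
      using sin0 by (simp add: power2_eq_square)
    moreover have "z \<bullet> U z = 0"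
      using zz by (simp add: U_def inner_diff_right inner_commute)
    ultimately show "unit_tangent z (U z)" using z by (simp add: unit_tangent_def norm_eq_1)
    show "geodesic z (U z) (\<T> z) = y"
      using sin0 by (simp add: geodesic_def U_def cos)
  qed
  have z0y: "z0 \<bullet> y = cos T0"
    using z0(2) by (simp add: y_def inner_geodesic unit_tangent_def norm_eq_1)
  have sinT0: "sin T0 \<noteq> 0" using strip_sin_nonzero z0(3,4) by blast
  have "\<bar>cos T0\<bar> < 1"
  proof -
    have "(cos T0)\<^sup>2 < 1" using sinT0 by (simp add: cos_squared_eq)
    then show ?thesis by (simp add: abs_square_less_1)
  qed
  then have z0y1: "\<bar>z0 \<bullet> y\<bar> < 1" using z0y by simp
  have at0: "\<T> z0 = T0" "U z0 = u0"
    using geodesic_endpoints_unique[OF aim(1)[OF norm_I[OF z0(1)] z0y1] z0(2) _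
        aim(3,4)[OF norm_I[OF z0(1)] z0y1] z0(3,4)]
      aim(2)[OF norm_I[OF z0(1)] z0y1] y_def by auto
  have cont_k: "isCont (\<lambda>z. z \<bullet> y) z0" by (intro continuous_intros)
  have "-1 < \<sigma> * (z0 \<bullet> y)" "\<sigma> * (z0 \<bullet> y) < 1"
    using z0y1 \<sigma>(2) abs_mult[of \<sigma> "z0 \<bullet> y"] by auto
  then have "isCont arccos (\<sigma> * (z0 \<bullet> y))" by (rule isCont_arccos)
  moreover have "isCont (\<lambda>z. \<sigma> * (z \<bullet> y)) z0" by (intro continuous_intros)
  ultimately have "isCont \<theta> z0" unfolding \<theta>_def by (rule isCont_o2[rotated])
  then have cont_T: "isCont \<T> z0" unfolding \<T>_def by (intro continuous_intros)
  have cont_U: "isCont U z0"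
    unfolding U_def using sinT0 at0 by (intro continuous_intros cont_T isCont_sin) auto
  obtain \<rho> where \<rho>: "0 < \<rho>" "\<And>e t t'. unit_tangent c e \<Longrightarrow> 0 < t \<Longrightarrow> t < \<rho> \<Longrightarrow> 0 < t' \<Longrightarrow> t' < \<rho> \<Longrightarrow>
       geodesic c e t \<in> I \<Longrightarrow> geodesic c e t' \<in> I"
    using interior_locally_conical[of c] by blast
  \<comment> \<open>Hitting times within \<open>h\<close> of \<open>T0\<close> come after
    \<open>T1\<close>, and by less than \<open>2 * h \<le> \<rho>\<close>, so the end of the flight
    is within the conical radius of \<open>c\<close>.\<close>
  define h where "h = min (T0 - a0) \<rho> / 2"
  define T1 where "T1 = T0 - h"
  have h: "0 < h" "h < T0 - a0" "2 * h \<le> \<rho>" using \<rho>(1) z0(5) by (auto simp: h_def flight_def)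
  have "reach (geodesic z0 u0) w a0" "a0 < T1"
    and "\<And>t. a0 < t \<Longrightarrow> t \<le> T1 \<Longrightarrow> reflections w (geodesic z0 u0 t) \<in> I"
    using z0(5) h by (auto simp: flight_def T1_def)
  from flight_stable[OF this(1) z0(2,1) this(2,3) zero_less_one]
  obtain \<delta> where \<delta>: "0 < \<delta>" "\<And>x' v'. unit_tangent x' v' \<Longrightarrow> dist x' z0 + dist v' u0 < \<delta> \<Longrightarrow>
    \<exists>a'. flight (geodesic x' v') w a' T1 \<and> reflections w (geodesic x' v' T1) \<in> I"
    by blast
  obtain r1 where r1: "0 < r1" "\<And>z. norm z = 1 \<Longrightarrow> dist z z0 < r1 \<Longrightarrow> z \<in> I"
    using I_ball[OF z0(1)] by blast
  obtain r2 where r2: "0 < r2" "\<And>z. dist z z0 < r2 \<Longrightarrow> dist (z \<bullet> y) (z0 \<bullet> y) < 1 - \<bar>z0 \<bullet> y\<bar>"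
    using cont_k z0y1 unfolding continuous_at_eps_delta by (metis diff_gt_0_iff_gt)
  obtain r3 where r3: "0 < r3" "\<And>z. dist z z0 < r3 \<Longrightarrow> dist (\<T> z) T0 < h"
    using cont_T h(1) unfolding continuous_at_eps_delta at0 by blast
  obtain r4 where r4: "0 < r4" "\<And>z. dist z z0 < r4 \<Longrightarrow> dist (U z) u0 < \<delta> / 2"
    using cont_U half_gt_zero[OF \<delta>(1)] unfolding continuous_at_eps_delta at0 by blast
  define r where "r = min (min r1 r2) (min (min r3 r4) (\<delta> / 2))"
  have "z \<in> hitting c m w" if z: "norm z = 1" "dist z z0 < r" for z
  proof -
    have "\<bar>z \<bullet> y\<bar> < 1" using r2(2)[of z] z(2) by (auto simp: r_def dist_real_def)
    note aim = aim[OF z(1) this]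
    have "dist z z0 + dist (U z) u0 < \<delta>" using r4(2)[of z] z(2) by (auto simp: r_def)
    then obtain a' where a': "flight (geodesic z (U z)) w a' T1" "reflections w (geodesic z (U z) T1) \<in> I"
      using \<delta>(2)[OF aim(1)] by blast
    have TT: "T1 < \<T> z" "\<T> z - T1 < \<rho>"
      using r3(2)[of z] z(2) h by (auto simp: r_def T1_def dist_real_def)
    define x' v' where "x' = reflections w z" and "v' = reflections w (U z)"
    have g: "reflections w (geodesic z (U z) t) = geodesic x' v' t" for t
      by (simp add: reflections_geodesic[OF wS] x'_def v'_def)
    have ut: "unit_tangent x' v'"
      using unit_tangent_reflections[OF wS aim(1)] by (simp add: x'_def v'_def)
    have c: "geodesic x' v' (\<T> z) = c" using g[of "\<T> z"] aim(2) y(2) by simp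
    define e where "e = - geodesic_velocity x' v' (\<T> z)"
    have ute: "unit_tangent c e" using unit_tangent_geodesic(2)[OF ut] c by (auto simp: e_def)
    have ge: "geodesic x' v' t = geodesic c e (\<T> z - t)" for t
      using geodesic_diff[of x' v' "\<T> z" "\<T> z - t"] by (simp add: c e_def)
    have "geodesic x' v' t \<in> I" if "T1 \<le> t" "t < \<T> z" for t
      using \<rho>(2)[OF ute, of "\<T> z - T1" "\<T> z - t"] a'(2) TT that unfolding g ge by simp
    then have "flight (geodesic z (U z)) w a' (\<T> z)"
      using a'(1) TT unfolding flight_def g by (meson dual_order.strict_trans not_le)
    then show ?thesis
      using aim r1(2)[OF z(1)] z(2) y(2) unfolding hitting_def r_def by auto
  qed
  moreover have "0 < r" using r1 r2 r3 r4 \<delta>(1) by (simp add: r_def)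
  ultimately show "\<exists>e>0. \<forall>x'\<in>unit_sphere. dist x' z0 < e \<longrightarrow> x' \<in> hitting c m w" by auto
qed

lemma hitting_borel: "hitting c m w \<in> sets borel" "hitting c m w \<subseteq> unit_sphere"
proof -
  obtain V where "open V" "hitting c m w = unit_sphere \<inter> V"
    using openin_hitting[of c m w] by (auto simp: openin_open)
  then show "hitting c m w \<in> sets borel" "hitting c m w \<subseteq> unit_sphere"
    by (auto intro!: sets.Int borel_closed)
qed

section \<open>The mean number of hits\<close>

definition code :: "nat \<Rightarrow> great_arc list" where
  "code = from_nat_into (lists S)"

text \<open>Injectivity matters as well: distinct indices must give distinct codes for the images to
  be disjoint.\<close>

lemma bij_code: "bij_betw code UNIV (lists S)"
proof -
  obtain s where "s \<in> S" using S_nonempty by blast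
  then have "range (\<lambda>n. replicate n s) \<subseteq> lists S" by auto
  moreover have "infinite (range (\<lambda>n. replicate n s))"
    by (intro range_inj_infinite injI) (metis length_replicate)
  ultimately have "infinite (lists S)" using finite_subset by blast
  moreover have "countable (lists S)" using finite_S countable_finite countable_lists by blast
  ultimately show ?thesis unfolding code_def by (rule bij_betw_from_nat_into[rotated])
qed

lemma code_set: "set (code k) \<subseteq> S"
  using bij_code by (auto simp: bij_betw_def lists_eq_set)

definition hits :: "real^3 \<Rightarrow> nat \<Rightarrow> real^3 \<Rightarrow> nat set" where
  "hits c m z = {k. z \<in> hitting c m (code k)}"

text \<open>Counting measure instead of \<open>card\<close>, so that infinitely many hits count as
  infinity and not as the default 0.\<close>

definition hit_count :: "real^3 \<Rightarrow> nat \<Rightarrow> real^3 \<Rightarrow> ennreal" where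
  "hit_count c m z = emeasure (count_space UNIV) (hits c m z)"

lemma hit_count_eq: "hit_count c m z = (\<Sum>k. indicator (hitting c m (code k)) z)"
proof -
  have "hit_count c m z = (\<integral>\<^sup>+k. indicator (hits c m z) k \<partial>count_space UNIV)"
    by (simp add: hit_count_def)
  also have "\<dots> = (\<Sum>k. indicator (hits c m z) k)" by (rule nn_integral_count_space_nat)
  also have "\<dots> = (\<Sum>k. indicator (hitting c m (code k)) z)"
    by (intro suminf_cong) (simp add: hits_def indicator_def)
  finally show ?thesis .
qed

lemma sets_hitting [measurable]: "hitting c m w \<in> sets sphere_area"
  using hitting_borel by (simp add: sets_sphere_area borel_sphere_sets)

lemma measurable_hit_count [measurable]: "hit_count c m \<in> borel_measurable sphere_area"
  unfolding hit_count_eq[abs_def] by measurable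

text \<open>Term by term the integral is the sum of the areas of the hitting sets; their images
  under the foldings have the same areas and are disjoint subsets of the sphere.\<close>

lemma nn_integral_hit_count:
  "(\<integral>\<^sup>+z. hit_count c m z \<partial>sphere_area) \<le> emeasure sphere_area unit_sphere"
proof -
  let ?E = "\<lambda>k. hitting c m (code k)"
  let ?F = "\<lambda>k. reflections (code k) ` ?E k"
  have iso: "orthogonal_transformation (reflections (code k))" for k
    using orthogonal_transformation_reflections code_set by blast
  note F = emeasure_sphere_area_image[OF iso hitting_borel]
  have "disjoint_family ?F"
    unfolding disjoint_family_on_def
  proof (intro ballI impI)
    fix j k :: nat assume "j \<noteq> k"
    then have "code j \<noteq> code k" using bij_code by (auto simp: bij_betw_def inj_on_def)
    then show "?F j \<inter> ?F k = {}" by (rule hitting_disjoint)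
  qed
  moreover have F_sets: "range ?F \<subseteq> sets sphere_area"
    using F by (auto simp: sets_sphere_area borel_sphere_sets)
  ultimately have "(\<Sum>k. emeasure sphere_area (?F k)) = emeasure sphere_area (\<Union>k. ?F k)"
    by (intro suminf_emeasure)
  also have "\<dots> \<le> emeasure sphere_area (space sphere_area)"
    by (intro emeasure_space)
  finally have "(\<Sum>k. emeasure sphere_area (?E k)) \<le> emeasure sphere_area unit_sphere"
    by (simp add: F(3) space_sphere_area)
  moreover have "(\<integral>\<^sup>+z. hit_count c m z \<partial>sphere_area) = (\<Sum>k. emeasure sphere_area (?E k))"
    unfolding hit_count_eq by (subst nn_integral_suminf) auto
  ultimately show ?thesis by simp
qed

text \<open>The weighted series of counts has finite integral, so it has a finite value
  \<open>b\<close> almost everywhere. The weights decrease, so the unweighted sum up to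
  \<open>M\<close> is at most \<open>b / p M\<close>.\<close>

lemma AE_hit_growth:
  assumes "0 < \<epsilon>"
  shows "AE z in sphere_area. \<exists>b. \<forall>M. (\<forall>m\<le>M. finite (hits c m z)) \<and>
    (\<Sum>m\<le>M. real (card (hits c m z))) \<le> b * (real M + 1) powr (1 + \<epsilon>)"
proof -
  define p :: "nat \<Rightarrow> real" where "p m = (real m + 1) powr (- (1 + \<epsilon>))" for m
  let ?F = "\<lambda>z. \<Sum>m. ennreal (p m) * hit_count c m z"
  have p_pos: "0 < p m" for m by (simp add: p_def)
  have "summable (\<lambda>n. real n powr (- (1 + \<epsilon>)))"
    using assms by (simp add: summable_real_powr_iff)
  then have "summable (\<lambda>n. real (Suc n) powr (- (1 + \<epsilon>)))"
    using summable_Suc_iff[of "\<lambda>n. real n powr (- (1 + \<epsilon>))"] by simp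
  then have "summable p" by (simp add: p_def[abs_def] add.commute)
  then have p_fin: "(\<Sum>m. ennreal (p m)) < \<infinity>"
    using suminf_ennreal2[OF less_imp_le[OF p_pos] \<open>summable p\<close>] by simp
  have "(\<integral>\<^sup>+z. ?F z \<partial>sphere_area) = (\<Sum>m. ennreal (p m) * (\<integral>\<^sup>+z. hit_count c m z \<partial>sphere_area))"
    by (subst nn_integral_suminf) (auto simp: nn_integral_cmult)
  also have "\<dots> \<le> (\<Sum>m. ennreal (p m) * emeasure sphere_area unit_sphere)"
    by (intro suminf_le mult_left_mono nn_integral_hit_count) auto
  also have "\<dots> = (\<Sum>m. ennreal (p m)) * emeasure sphere_area unit_sphere" by simp
  also have "\<dots> < \<infinity>" using p_fin emeasure_sphere_area_finite by (simp add: ennreal_mult_less_top)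
  finally have "(\<integral>\<^sup>+z. ?F z \<partial>sphere_area) \<noteq> \<infinity>" by simp
  moreover have "?F \<in> borel_measurable sphere_area" by measurable
  ultimately have "AE z in sphere_area. ?F z \<noteq> \<infinity>" by (rule nn_integral_PInf_AE[rotated])
  then show ?thesis
  proof eventually_elim
    fix z assume fin: "?F z \<noteq> \<infinity>"
    define b where "b = enn2real (?F z)"
    have b: "?F z = ennreal b" using fin by (simp add: b_def less_top)
    have part: "(\<Sum>m\<le>M. ennreal (p m) * hit_count c m z) \<le> ennreal b" for M
      unfolding b[symmetric] by (intro sum_le_suminf) auto
    have "finite (hits c m z)" for m
    proof (rule ccontr)
      assume "infinite (hits c m z)"
      then have "hit_count c m z = \<infinity>" by (simp add: hit_count_def)
      \<comment> \<open>One infinite count, having positive weight, would already make the series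
        infinite.\<close>
      moreover have "ennreal (p m) * hit_count c m z \<le> (\<Sum>m\<le>m. ennreal (p m) * hit_count c m z)"
        by (rule member_le_sum) auto
      then have "ennreal (p m) * hit_count c m z \<le> ennreal b" using part[of m] by (rule order_trans)
      ultimately show False
        using p_pos[of m] by (simp add: ennreal_mult_top top_unique)
    qed
    note finite_hits = this
    have "(\<Sum>m\<le>M. real (card (hits c m z))) \<le> b * (real M + 1) powr (1 + \<epsilon>)" for M
    proof -
      have "ennreal (p m) * hit_count c m z = ennreal (p m * card (hits c m z))" for m
        using p_pos[of m] finite_hits
        by (simp add: hit_count_def ennreal_mult ennreal_of_nat_eq_real_of_nat)
      moreover have "0 \<le> p m * card (hits c m z)" for m using p_pos[of m] by simp
      ultimately have "(\<Sum>m\<le>M. ennreal (p m) * hit_count c m z) = ennreal (\<Sum>m\<le>M. p m * card (hits c m z))"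
        by (simp add: sum_ennreal)
      then have "(\<Sum>m\<le>M. p m * card (hits c m z)) \<le> b"
        using part[of M] by (simp add: b_def)
      moreover have "(\<Sum>m\<le>M. p M * card (hits c m z)) \<le> (\<Sum>m\<le>M. p m * card (hits c m z))"
        using assms by (intro sum_mono mult_right_mono) (auto simp: p_def intro!: powr_mono2')
      ultimately have "p M * (\<Sum>m\<le>M. real (card (hits c m z))) \<le> b"
        by (simp add: sum_distrib_left)
      moreover define q where "q = (real M + 1) powr (1 + \<epsilon>)"
      moreover have "p M = inverse q" unfolding p_def q_def by (rule powr_minus)
      moreover have "0 < q" by (simp add: q_def)
      ultimately show ?thesis by (simp add: field_simps flip: q_def)
    qed
    then show "\<exists>b. \<forall>M. (\<forall>m\<le>M. finite (hits c m z)) \<and>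
      (\<Sum>m\<le>M. real (card (hits c m z))) \<le> b * (real M + 1) powr (1 + \<epsilon>)"
      using finite_hits by blast
  qed
qed

section \<open>Exceptional points and the final estimate\<close>

lemma AE_interior: "AE z in sphere_area. z \<in> P \<longrightarrow> z \<in> I"
proof -
  have "AE z in sphere_area. \<forall>s\<in>S. arc_normal s \<bullet> z \<noteq> 0"
  proof (intro AE_finite_allI finite_S AE_not_great_circle)
    fix s assume "s \<in> S"
    then show "arc_normal s \<noteq> 0" using norm_arc_normal[OF valid_arcs] by fastforce
  qed
  then show ?thesis
  proof eventually_elim
    fix z assume "\<forall>s\<in>S. arc_normal s \<bullet> z \<noteq> 0"
    then have "z \<notin> boundary" by (auto simp: boundary_def inner_commute dest: arc_normal_orthogonal)
    then show "z \<in> P \<longrightarrow> z \<in> I" using boundary_eq by auto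
  qed
qed

text \<open>Excludes hits at multiples of \<open>pi\<close>, where the great circle is back at
  \<open>z\<close> or at \<open>-z\<close>. For each of the countably many codes and finitely many
  corners this costs two points.\<close>

lemma AE_not_conjugate:
  "AE z in sphere_area. \<forall>k. \<forall>c\<in>corners S. reflections (code k) z \<noteq> c \<and> reflections (code k) z \<noteq> - c"
proof -
  have *: "AE z in sphere_area. reflections (code k) z \<noteq> c" for k c
  proof -
    have bij: "bij (reflections (code k))"
      using orthogonal_transformation_reflections[OF code_set] orthogonal_transformation_bij by blast
    show ?thesis
      using AE_neq[of "inv (reflections (code k)) c"]
      by eventually_elim (use bij in \<open>auto simp: bij_def inv_f_f\<close>)
  qed
  show ?thesis
    by (intro AE_all_countable[THEN iffD2] allI AE_finite_allI finite_corners AE_conjI *)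
qed

definition hit_direction :: "real^3 \<Rightarrow> nat \<Rightarrow> real^3 \<Rightarrow> nat \<Rightarrow> real^3" where
  "hit_direction c m z k = (SOME u. \<exists>a T. unit_tangent z u \<and> real m * pi < T \<and> T < (real m + 1) * pi \<and>
     flight (geodesic z u) (code k) a T \<and> reflections (code k) (geodesic z u T) = c)"

lemma singular_directions_subset:
  assumes "z \<in> I"
    "\<And>k c. c \<in> corners S \<Longrightarrow> reflections (code k) z \<noteq> c \<and> reflections (code k) z \<noteq> - c"
  shows "singular_directions z l \<subseteq>
    (\<Union>c\<in>corners S. \<Union>m\<in>{..nat \<lfloor>l / pi\<rfloor>}. hit_direction c m z ` hits c m z)"
proof
  fix u assume "u \<in> singular_directions z l"
  then obtain w a T where u: "unit_tangent z u" "flight (geodesic z u) w a T" "T \<le> l"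
    "reflections w (geodesic z u T) \<in> corners S" by (auto simp: singular_directions_def)
  define c where "c = reflections w (geodesic z u T)"
  have "w \<in> lists S" using flight_set[OF u(2)] by auto
  then have "w \<in> range code" using bij_code by (simp add: bij_betw_def)
  then obtain k where k: "w = code k" by blast
  have "0 < T" using u(2) reach_nonneg by (force simp: flight_def)
  have "sin T \<noteq> 0"
  proof
    assume 0: "sin T = 0"
    then have "cos T = 1 \<or> cos T = -1"
      using sin_zero_abs_cos_one[OF 0] by linarith
    then have "geodesic z u T = z \<or> geodesic z u T = - z" using 0 by (auto simp: geodesic_def)
    moreover have "reflections w (- z) = - reflections w z"
      using orthogonal_transformation_reflections[OF flight_set[OF u(2)]]
      by (intro linear_neg orthogonal_transformation_linear)
    ultimately have "c = reflections w z \<or> c = - reflections w z" by (auto simp: c_def)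
    moreover have "c \<in> corners S" using u(4) by (simp add: c_def)
    ultimately show False using assms(2)[of c k] k by auto
  qed
  \<comment> \<open>The strip of \<open>T\<close>; a nonzero sine keeps \<open>T\<close> off its
    lower end.\<close>
  define m where "m = nat \<lfloor>T / pi\<rfloor>"
  have m: "real m = of_int \<lfloor>T / pi\<rfloor>" using \<open>0 < T\<close> by (simp add: m_def)
  have "real m \<le> T / pi" "T / pi < real m + 1" unfolding m by linarith+
  then have "real m * pi \<le> T" "T < (real m + 1) * pi" by (simp_all add: field_simps)
  moreover have "T \<noteq> real m * pi" using \<open>sin T \<noteq> 0\<close> by auto
  ultimately have st: "real m * pi < T" "T < (real m + 1) * pi" by auto
  have "m \<le> nat \<lfloor>l / pi\<rfloor>"
    unfolding m_def using u(3) by (intro nat_mono floor_mono divide_right_mono) auto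
  moreover have "k \<in> hits c m z"
    using u st assms(1) k by (auto simp: hits_def hitting_def c_def)
  moreover have "hit_direction c m z k = u"
  proof -
    have ex: "\<exists>a T. unit_tangent z u \<and> real m * pi < T \<and> T < (real m + 1) * pi \<and>
     flight (geodesic z u) (code k) a T \<and> reflections (code k) (geodesic z u T) = c"
      using u st k by (auto simp: c_def)
    show ?thesis
      unfolding hit_direction_def
    proof (rule some_equality, rule ex)
      fix u' assume "\<exists>a T. unit_tangent z u' \<and> real m * pi < T \<and> T < (real m + 1) * pi \<and>
        flight (geodesic z u') (code k) a T \<and> reflections (code k) (geodesic z u' T) = c"
      then show "u' = u" using ex hitting_direction_unique by blast
    qed
  qed
  moreover have "c \<in> corners S" using u(4) by (simp add: c_def)
  ultimately show "u \<in> (\<Union>c\<in>corners S. \<Union>m\<in>{..nat \<lfloor>l / pi\<rfloor>}. hit_direction c m z ` hits c m z)"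
    by blast
qed

lemma AE_position_complexity:
  assumes "0 < \<epsilon>"
  shows "AE z in sphere_area. z \<in> P \<longrightarrow>
           (\<forall>\<^sub>F l in at_top. finite (orbit_classes P S z l)) \<and>
           (\<lambda>l. real (position_complexity P S z l)) \<in> O[at_top](\<lambda>l. l powr (1 + \<epsilon>))"
proof -
  have "AE z in sphere_area. \<forall>c\<in>corners S. \<exists>b. \<forall>M. (\<forall>m\<le>M. finite (hits c m z)) \<and>
    (\<Sum>m\<le>M. real (card (hits c m z))) \<le> b * (real M + 1) powr (1 + \<epsilon>)"
    using AE_hit_growth[OF assms] by (intro AE_finite_allI finite_corners)
  with AE_interior AE_not_conjugate show ?thesis
  proof eventually_elim
    fix z
    assume int: "z \<in> P \<longrightarrow> z \<in> I"
      and gen: "\<forall>k. \<forall>c\<in>corners S. reflections (code k) z \<noteq> c \<and> reflections (code k) z \<noteq> - c"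
      and "\<forall>c\<in>corners S. \<exists>b. \<forall>M. (\<forall>m\<le>M. finite (hits c m z)) \<and>
        (\<Sum>m\<le>M. real (card (hits c m z))) \<le> b * (real M + 1) powr (1 + \<epsilon>)"
    then obtain b where b: "\<And>c M m. c \<in> corners S \<Longrightarrow> m \<le> M \<Longrightarrow> finite (hits c m z)"
      "\<And>c M. c \<in> corners S \<Longrightarrow>
         (\<Sum>m\<le>M. real (card (hits c m z))) \<le> b c * (real M + 1) powr (1 + \<epsilon>)"
      by metis
    \<comment> \<open>The absolute value makes \<open>B\<close> nonnegative, as the monotonicity
      steps below require.\<close>
    define B where "B = \<bar>\<Sum>c\<in>corners S. b c\<bar>"
    \<comment> \<open>The factor \<open>2 powr (1 + \<epsilon>)\<close> comes from
      \<open>M + 1 \<le> 2 * l\<close>; the added 1 absorbs the extra interval, as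
      \<open>1 \<le> l powr (1 + \<epsilon>)\<close>.\<close>
    have bound: "finite (orbit_classes P S z l) \<and>
       real (position_complexity P S z l) \<le> (B * 2 powr (1 + \<epsilon>) + 1) * l powr (1 + \<epsilon>)"
      if "z \<in> P" "1 \<le> l" for l
    proof -
      have zI: "z \<in> I" using int that by blast
      define M where "M = nat \<lfloor>l / pi\<rfloor>"
      let ?V = "\<Union>c\<in>corners S. \<Union>m\<in>{..M}. hit_direction c m z ` hits c m z"
      have sub: "singular_directions z l \<subseteq> ?V"
        using singular_directions_subset[OF zI] gen unfolding M_def by blast
      have finV: "finite ?V" using b(1) finite_corners by blast
      have fin: "finite (singular_directions z l)" using sub finV finite_subset by blast
      have "card (singular_directions z l) \<le> card ?V" using sub finV by (intro card_mono)
      also have "\<dots> \<le> (\<Sum>c\<in>corners S. card (\<Union>m\<in>{..M}. hit_direction c m z ` hits c m z))"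
        by (rule card_UN_le[OF finite_corners])
      also have "\<dots> \<le> (\<Sum>c\<in>corners S. \<Sum>m\<le>M. card (hits c m z))"
      proof (rule sum_mono)
        fix c assume c: "c \<in> corners S"
        have "card (\<Union>m\<in>{..M}. hit_direction c m z ` hits c m z)
            \<le> (\<Sum>m\<le>M. card (hit_direction c m z ` hits c m z))"
          by (intro card_UN_le) simp
        also have "\<dots> \<le> (\<Sum>m\<le>M. card (hits c m z))"
          using b(1)[OF c] by (intro sum_mono card_image_le) auto
        finally show "card (\<Union>m\<in>{..M}. hit_direction c m z ` hits c m z) \<le> (\<Sum>m\<le>M. card (hits c m z))" .
      qed
      finally have "real (card (singular_directions z l)) \<le> (\<Sum>c\<in>corners S. \<Sum>m\<le>M. real (card (hits c m z)))"
        by (simp flip: of_nat_sum)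
      also have "\<dots> \<le> (\<Sum>c\<in>corners S. b c * (real M + 1) powr (1 + \<epsilon>))"
        using b(2) by (intro sum_mono) auto
      also have "\<dots> = (\<Sum>c\<in>corners S. b c) * (real M + 1) powr (1 + \<epsilon>)"
        by (simp add: sum_distrib_right)
      also have "\<dots> \<le> B * (real M + 1) powr (1 + \<epsilon>)"
        by (intro mult_right_mono) (auto simp: B_def)
      also have "\<dots> \<le> B * (2 * l) powr (1 + \<epsilon>)"
      proof -
        have "l / pi \<le> l / 1" using that pi_gt3 by (intro divide_left_mono) auto
        then have "real M \<le> l" using that unfolding M_def by linarith
        then show ?thesis using that assms by (intro mult_left_mono powr_mono2) (auto simp: B_def)
      qed
      finally have "real (card (singular_directions z l)) \<le> B * 2 powr (1 + \<epsilon>) * l powr (1 + \<epsilon>)"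
        using that by (simp add: powr_mult mult.assoc)
      moreover have "1 \<le> l powr (1 + \<epsilon>)" using that assms by (simp add: ge_one_powr_ge_zero)
      moreover have "finite (orbit_classes P S z l)"
        "position_complexity P S z l \<le> card (singular_directions z l) + 1"
        using orbit_classes_bound[OF zI _ fin] that by auto
      ultimately show ?thesis by (simp add: distrib_right)
    qed
    show "z \<in> P \<longrightarrow> (\<forall>\<^sub>F l in at_top. finite (orbit_classes P S z l)) \<and>
           (\<lambda>l. real (position_complexity P S z l)) \<in> O[at_top](\<lambda>l. l powr (1 + \<epsilon>))"
    proof (intro impI conjI)
      assume z: "z \<in> P"
      show "\<forall>\<^sub>F l in at_top. finite (orbit_classes P S z l)"
        using eventually_ge_at_top[of 1] by eventually_elim (use bound[OF z] in blast)
      show "(\<lambda>l. real (position_complexity P S z l)) \<in> O[at_top](\<lambda>l. l powr (1 + \<epsilon>))"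
      proof (rule bigoI)
        show "\<forall>\<^sub>F l in at_top. norm (real (position_complexity P S z l))
            \<le> (B * 2 powr (1 + \<epsilon>) + 1) * norm (l powr (1 + \<epsilon>))"
          using eventually_ge_at_top[of 1] by eventually_elim (use bound[OF z] in simp)
      qed
    qed
  qed
qed

end

theorem corollary11:
  fixes P :: "(real^3) set" and S :: "great_arc set" and \<epsilon> :: real
  assumes "geodesic_polygon P S" and "\<epsilon> > 0"
  shows "AE z in sphere_area. z \<in> P \<longrightarrow>
           (\<forall>\<^sub>F l in at_top. finite (orbit_classes P S z l)) \<and>
           (\<lambda>l. real (position_complexity P S z l)) \<in> O[at_top](\<lambda>l. l powr (1 + \<epsilon>))"
proof -
  interpret polygon P S using assms(1) by unfold_locales
  show ?thesis using AE_position_complexity[OF assms(2)] .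
qed

end
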